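(* Let $\mu=E\{\tau(X,Y)\}$ and let $\mathcal{M}_{\mathrm{np}}$ be the semiparametric model for the observed data $(R,X,Z,RY)$ defined through the restriction $$E\{\gamma(X,Y)\mid R=1,X,Z\}=\beta(X,Z),\qquad\gamma(X,Y)=\frac{f(R=0\mid X,Y)}{f(R=1\mid X,Y)},\quad\beta(X,Z)=\frac{f(R=0\mid X,Z)}{f(R=1\mid X,Z)}.$$ Then the influence function $$(1-R)\delta_0(X,Z)+R\tau(X,Y)+R\,E\{h_0(X,Z)\mid R=1,X,Y\}\{\tau(X,Y)-\delta_0(X,Z)\}-\mu$$ attains the semiparametric efficiency bound of $\mu$ in $\mathcal{M}_{\mathrm{np}}$ at the submodel where conditions (A1)-(A8) listed in the context hold and $h_0(x,z)$ solves $$E\{h_0(X,Z)+1\mid R=1,X,Y\}=\frac{1}{f(R=1\mid X,Y)}.$$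
   Context: Setting. $X\in\mathbb{R}^d$ are fully observed covariates, $Y\in\mathbb{R}$ an outcome, $R\in\{0,1\}$ the missingness indicator ($Y$ observed iff $R=1$), $Z\in\mathbb{R}$ a fully observed variable with support $\mathcal{Z}$, and $\tau(x,y)$ a given real function; $f(\cdot)$ denotes a density or mass function. Data are i.i.d. copies $(R_i,X_i,Y_i,Z_i)$, $i=1,\dots,n$, with $Y_i$ missing when $R_i=0$. The semiparametric efficiency bound is the usual one: attaining it means that the variance of the displayed influence function equals the semiparametric efficiency bound for $\mu$ in $\mathcal{M}_{\mathrm{np}}$ at the given law. Operators. $L_2(X,Y)$, $L_2(X,Z)$ are the spaces of real functions of $(X,Y)$, respectively $(X,Z)$, square integrable with respect to the conditional law of $(X,Y,Z)$ given $R=1$; $T:L_2(X,Y)\to L_2(X,Z)$, $T(\xi)=E\{\xi(X,Y)\mid R=1,X,Z\}$, with adjoint $T':L_2(X,Z)\to L_2(X,Y)$, $T'(\eta)=E\{\eta(X,Z)\mid R=1,X,Y\}$. Smoothness norm. For $\rho$ defined on a subset of a Euclidean space and $\alpha>0$, with $\underline\alpha$ the largest integer smaller than $\alpha$, $$\|\rho\|_{\infty,\alpha}=\max_{|\lambda|\le\underline\alpha}\sup_w|D^\lambda\rho(w)|+\max_{|\lambda|=\underline\alpha}\sup_{w\ne w'}\frac{|D^\lambda\rho(w)-D^\lambda\rho(w')|}{\|w-w'\|^{\alpha-\underline\alpha}},$$ where $\lambda$ is a multi-index of nonnegative integers, $|\lambda|=\sum_i\lambda_i$, $D^\lambda$ the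 corresponding partial derivative. $\|\cdot\|_\infty$ is the supremum norm. Sets. $\Delta$ is a set of functions $\delta(x,z)$, and $\Delta_0=\{\delta\in\Delta:E\{\delta(X,Z)\mid R=1,X,Y\}=\tau(X,Y)\}$. Given known functions $\{\psi_q(x,z)\}_{q\ge1}$ and integers $q_n$, $\Delta_n=\{\delta\in\Delta:\delta=\sum_{q=1}^{q_n}\beta_q\psi_q\text{ for some real }\beta_q\}$. Given known functions $\{\phi_k(x,y)\}_{k\ge1}$ and integers $k_n$, $\boldsymbol\phi=(\phi_1,\dots,\phi_{k_n})^{T}$. Pseudo-norm and inner product. $\|\delta\|_w^2=E[R\{E(\delta(X,Z)\mid R=1,X,Y)\}^2]$; $\overline\Delta$ is the closure of the linear span of $\Delta$ under $\|\cdot\|_w$, with inner product $\langle\delta_1,\delta_2\rangle_w=E[R\,E\{\delta_1(X,Z)\mid R=1,X,Y\}E\{\delta_2(X,Z)\mid R=1,X,Y\}]$. Conditions. (A1) (Shadow variable) $Z$ is conditionally independent of $R$ given $(X,Y)$, and $Z$ is not conditionally independent of $Y$ given $X$. (A2) (Representer) $\tau(X,Y)$ lies in the range of $T'$, i.e. there exists $\delta_0(X,Z)$ with $E\{\delta_0(X,Z)\mid R=1,X,Y\}=\tau(X,Y)$. (A3) $X$ has support $[0,1]^d$; $Y$ and $Z$ have compact supports. (A4) (i) $\sup_{\delta\in\Delta}\|\delta\|_{\infty,\alpha}<\infty$ for some $\alpha>(d+1)/2$; $\Delta_0\neq\emptyset$; both $\Delta_n$ and $\Delta$ are closed (with respect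 to $\|\cdot\|_\infty$). (ii) For every $\delta\in\Delta$ there is $\Pi_n\delta\in\Delta_n$ such that $\sup_{\delta\in\Delta}\|\delta-\Pi_n\delta\|_\infty=O(\eta_n)$ for some $\eta_n=o(1)$. (A5) (i) The smallest and largest eigenvalues of $E\{R\boldsymbol\phi(X,Y)\boldsymbol\phi(X,Y)^{T}\}$ are bounded above and away from zero for all $k_n$. (ii) For every $\delta\in\Delta$ there is $\boldsymbol\pi_n(\delta)\in\mathbb{R}^{k_n}$ with $\sup_{\delta\in\Delta}\|E\{\delta(X,Z)\mid R=1,x,y\}-\boldsymbol\phi^{T}(x,y)\boldsymbol\pi_n(\delta)\|_\infty=O(k_n^{-\alpha/(d+1)})$. (iii) $\xi_n^2k_n=o(n)$, where $\xi_n=\sup_{x,y}\|\boldsymbol\phi(x,y)\|_2$. (A6) $\Delta$ is convex; the functional $M:\Delta\to\mathbb{R}$ is strictly convex and attains a unique minimum at $\delta_0$ on $\Delta_0$; its sample analogue $M_n:\Delta\to\mathbb{R}$ (a random functional computed from the data) is continuous (with respect to $\|\cdot\|_\infty$) and $\sup_{\delta\in\Delta}|M_n(\delta)-M(\delta)|=o_p(1)$. This $\delta_0$ is the one in the influence function. (A7) (i) There exists $h_0\in\Delta$ such that $\langle h_0,\delta\rangle_w=E\{(1-R)\delta(X,Z)\}$ for all $\delta\in\overline\Delta$. (ii) $\eta_n=o(n^{-1/3})$, $k_n^{-3\alpha/(d+1)}=o(n^{-1})$, $k_n^3=o(n)$, $\xi_n^2k_n^2=o(n)$, and $\xi_n^2k_n^{-2\alpha/(d+1)}=o(1)$.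 (A8) (i) Completeness: (1) for any square-integrable $\xi(x,y)$, $E\{\xi(X,Y)\mid R=1,X,Z\}=0$ almost surely if and only if $\xi(X,Y)=0$ almost surely; (2) for any square-integrable $\eta(x,z)$, $E\{\eta(X,Z)\mid R=1,X,Y\}=0$ almost surely if and only if $\eta(X,Z)=0$ almost surely. (ii) With $\Omega(x,z)=E[\{\gamma(X,Y)-\beta(X,Z)\}^2\mid R=1,X=x,Z=z]$, $0<\inf_{x,z}\Omega(x,z)\le\sup_{x,z}\Omega(x,z)<\infty$. (iii) $T$ and $T'$ are both bounded. *)

theory Defs
  imports "HOL-Probability.Probability" "HOL-Library.Landau_Symbols"
begin

section \<open>Full and observed data\<close>

text \<open>A full-data point is a tuple $(r,x,y,z)$, and full-data laws live on the canonical space,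
  so that $R$, $X$, $Y$, $Z$ are the coordinate maps.\<close>

type_synonym 'd full = "bool \<times> (real ^ 'd) \<times> real \<times> real"

definition full_space :: "('d::finite) full measure" where
  "full_space = count_space UNIV \<Otimes>\<^sub>M borel"

definition Rv :: "('d::finite) full \<Rightarrow> bool" where "Rv = (\<lambda>(r, x, y, z). r)"
definition Xv :: "('d::finite) full \<Rightarrow> real ^ 'd" where "Xv = (\<lambda>(r, x, y, z). x)"
definition Yv :: "('d::finite) full \<Rightarrow> real" where "Yv = (\<lambda>(r, x, y, z). y)"
definition Zv :: "('d::finite) full \<Rightarrow> real" where "Zv = (\<lambda>(r, x, y, z). z)"
definition XYv :: "('d::finite) full \<Rightarrow> (real ^ 'd) \<times> real" where "XYv w = (Xv w, Yv w)"
definition XZv :: "('d::finite) full \<Rightarrow> (real ^ 'd) \<times> real" where "XZv w = (Xv w, Zv w)"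

text \<open>The observed data $(R,X,Z,RY)$; the tuple type happens to coincide with that of the
  full data, but the last two slots are now $Z$ and $RY$.\<close>

type_synonym 'd obs = "bool \<times> (real ^ 'd) \<times> real \<times> real"

definition obs :: "('d::finite) full \<Rightarrow> 'd obs" where
  "obs w = (Rv w, Xv w, Zv w, of_bool (Rv w) * Yv w)"

definition obs_law :: "('d::finite) full measure \<Rightarrow> 'd obs measure" where
  "obs_law P = distr P full_space obs"

definition sample :: "nat \<Rightarrow> (nat \<Rightarrow> ('d::finite) full) \<Rightarrow> 'd obs list" where
  "sample n \<omega> = map (\<lambda>i. obs (\<omega> i)) [0..<n]"

definition iid :: "('d::finite) full measure \<Rightarrow> (nat \<Rightarrow> 'd full) measure" where
  "iid P = Pi\<^sub>M UNIV (\<lambda>_. P)"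


section \<open>Conditional expectations\<close>

definition cexp :: "'a measure \<Rightarrow> ('a \<Rightarrow> 'b::topological_space) \<Rightarrow> ('a \<Rightarrow> real) \<Rightarrow> 'a \<Rightarrow> real" where
  "cexp M W g = real_cond_exp M (vimage_algebra (space M) W borel) g"

definition cond_indep :: "'a measure \<Rightarrow> ('a \<Rightarrow> 'u) \<Rightarrow> 'u measure \<Rightarrow> ('a \<Rightarrow> 'v) \<Rightarrow> 'v measure
    \<Rightarrow> ('a \<Rightarrow> 'w::topological_space) \<Rightarrow> bool" where
  "cond_indep M U MU V MV W \<longleftrightarrow>
     (\<forall>A\<in>sets MU. \<forall>B\<in>sets MV. AE w in M.
        cexp M W (\<lambda>w. indicator A (U w) * indicator B (V w)) w
          = cexp M W (\<lambda>w. indicator A (U w)) w * cexp M W (\<lambda>w. indicator B (V w)) w)"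

definition given_R1 :: "('d::finite) full measure \<Rightarrow> 'd full measure" where
  "given_R1 P = uniform_measure P {w \<in> space P. Rv w}"

text \<open>With $V = (X,Y)$ or $V = (X,Z)$ these are the spaces $L_2(X,Y)$ and $L_2(X,Z)$; their elements
  are functions, to be identified when they agree almost surely given $R=1$.\<close>

definition L2 :: "('d::finite) full measure \<Rightarrow> ('d full \<Rightarrow> (real ^ 'd) \<times> real)
    \<Rightarrow> ((real ^ 'd) \<times> real \<Rightarrow> real) set" where
  "L2 P V = {g \<in> borel_measurable borel. integrable (given_R1 P) (\<lambda>w. (g (V w))\<^sup>2)}"

text \<open>The random variables $E\{\xi(X,Y)\mid R=1,X,Z\}$ and $E\{\eta(X,Z)\mid R=1,X,Y\}$.\<close>

definition Top :: "('d::finite) full measure \<Rightarrow> ((real ^ 'd) \<times> real \<Rightarrow> real) \<Rightarrow> 'd full \<Rightarrow> real" where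
  "Top P \<xi> = cexp (given_R1 P) XZv (\<lambda>w. \<xi> (XYv w))"

definition Tadj :: "('d::finite) full measure \<Rightarrow> ((real ^ 'd) \<times> real \<Rightarrow> real) \<Rightarrow> 'd full \<Rightarrow> real" where
  "Tadj P \<eta> = cexp (given_R1 P) XYv (\<lambda>w. \<eta> (XZv w))"

text \<open>\<open>propensity P V\<close> is $f(R=1\mid V)$; \<open>odds P XYv\<close> is $\gamma(X,Y)$ and \<open>odds P XZv\<close> is
  $\beta(X,Z)$.\<close>

definition propensity :: "('d::finite) full measure \<Rightarrow> ('d full \<Rightarrow> 'b::topological_space)
    \<Rightarrow> 'd full \<Rightarrow> real" where
  "propensity P V = cexp P V (\<lambda>w. of_bool (Rv w))"

definition odds :: "('d::finite) full measure \<Rightarrow> ('d full \<Rightarrow> 'b::topological_space)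
    \<Rightarrow> 'd full \<Rightarrow> real" where
  "odds P V w = cexp P V (\<lambda>w. of_bool (\<not> Rv w)) w / propensity P V w"


section \<open>The model, its regular submodels and the efficiency bound\<close>

text \<open>The observed-data laws in the model are the laws \<open>obs_law P\<close> for \<open>P\<close> satisfying \<open>M_np\<close>.
  The full-data law is kept because $\gamma$ and $\mu$ refer to it. The two positivity requirements
  say that the ratios defining $\gamma$ and $\beta$ make sense.\<close>

definition M_np :: "('d::finite) full measure \<Rightarrow> bool" where
  "M_np P \<longleftrightarrow> prob_space P \<and> sets P = sets full_space
     \<and> (AE w in P. propensity P XYv w > 0) \<and> (AE w in P. propensity P XZv w > 0)
     \<and> (AE w in given_R1 P. cexp (given_R1 P) XZv (odds P XYv) w = odds P XZv w)"

definition mu :: "((real ^ 'd::finite) \<times> real \<Rightarrow> real) \<Rightarrow> 'd full measure \<Rightarrow> real" where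
  "mu \<tau> P = (\<integral>w. \<tau> (XYv w) \<partial>P)"

text \<open>Differentiability in quadratic mean at $t=0$ with score $s$ of a path $t\mapsto Q_t$, $t\ge 0$,
  that starts at \<open>P\<close> and is dominated by it.\<close>

definition qmd :: "'a measure \<Rightarrow> (real \<Rightarrow> 'a measure) \<Rightarrow> ('a \<Rightarrow> real) \<Rightarrow> bool" where
  "qmd P Q s \<longleftrightarrow> Q 0 = P \<and> (\<forall>t\<ge>0. sets (Q t) = sets P \<and> absolutely_continuous P (Q t))
     \<and> s \<in> borel_measurable P \<and> integrable P (\<lambda>w. (s w)\<^sup>2)
     \<and> ((\<lambda>t. \<integral>\<^sup>+w. ennreal (((sqrt (enn2real (RN_deriv P (Q t) w)) - 1) / t - s w / 2)\<^sup>2) \<partial>P)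
          \<longlongrightarrow> 0) (at_right 0)"

text \<open>A regular one-dimensional submodel through \<open>P\<close> with observed-data score \<open>S\<close>, along which
  $\mu$ has derivative \<open>D\<close>. Paths are one-sided, because $\gamma\ge 0$ may vanish on part of the
  sample space, where it can only be perturbed upwards. Mean square continuity of the nuisance
  function $\gamma$ is part of regularity: without it $\mu$ is not controlled by the observed-data
  law, as $\gamma$ need not be unique at laws near \<open>P\<close>.\<close>

definition regular_submodel :: "((real ^ 'd::finite) \<times> real \<Rightarrow> real) \<Rightarrow> 'd full measure
    \<Rightarrow> (real \<Rightarrow> 'd full measure) \<Rightarrow> ('d obs \<Rightarrow> real) \<Rightarrow> real \<Rightarrow> bool" where
  "regular_submodel \<tau> P Q S D \<longleftrightarrow>
     Q 0 = P \<and> (\<forall>t\<ge>0. M_np (Q t) \<and> integrable (Q t) (\<lambda>w. \<tau> (XYv w)))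
     \<and> qmd (obs_law P) (\<lambda>t. obs_law (Q t)) S
     \<and> ((\<lambda>t. \<integral>\<^sup>+w. ennreal (of_bool (Rv w) * (odds (Q t) XYv w - odds P XYv w)\<^sup>2) \<partial>Q t)
          \<longlongrightarrow> 0) (at_right 0)
     \<and> ((\<lambda>t. mu \<tau> (Q t)) has_real_derivative D) (at 0 within {0..})"

text \<open>The supremum of the Cramer-Rao bounds $(c^{T}D)^2/E\{(c^{T}S)^2\}$, taken over the linear span of
  the scores of regular submodels (the tangent space); equivalently the squared norm of the
  canonical gradient.\<close>

definition efficiency_bound :: "((real ^ 'd::finite) \<times> real \<Rightarrow> real) \<Rightarrow> 'd full measure \<Rightarrow> ennreal" where
  "efficiency_bound \<tau> P =
     Sup {ennreal ((\<Sum>j<N. c j * D j)\<^sup>2 / I) | N c Q S D I.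
        (\<forall>j<N. regular_submodel \<tau> P (Q j) (S j) (D j))
        \<and> I = (\<integral>w. (\<Sum>j<(N::nat). c j * S j w)\<^sup>2 \<partial>obs_law P) \<and> I > 0}"

definition infl :: "((real ^ 'd::finite) \<times> real \<Rightarrow> real) \<Rightarrow> 'd full measure
    \<Rightarrow> ((real ^ 'd) \<times> real \<Rightarrow> real) \<Rightarrow> ((real ^ 'd) \<times> real \<Rightarrow> real) \<Rightarrow> 'd full \<Rightarrow> real" where
  "infl \<tau> P \<delta>0 h0 w =
     of_bool (\<not> Rv w) * \<delta>0 (XZv w) + of_bool (Rv w) * \<tau> (XYv w)
     + of_bool (Rv w) * Tadj P h0 w * (\<tau> (XYv w) - \<delta>0 (XZv w)) - mu \<tau> P"


section \<open>Function classes and norms\<close>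

definition msupport :: "'a::topological_space measure \<Rightarrow> 'a set" where
  "msupport M = {x. \<forall>U. open U \<and> x \<in> U \<longrightarrow> emeasure M U > 0}"

definition dom_XY :: "('d::finite) full measure \<Rightarrow> ((real ^ 'd) \<times> real) set" where
  "dom_XY P = msupport (distr P borel Xv) \<times> msupport (distr P borel Yv)"

definition dom_XZ :: "('d::finite) full measure \<Rightarrow> ((real ^ 'd) \<times> real) set" where
  "dom_XZ P = msupport (distr P borel Xv) \<times> msupport (distr P borel Zv)"

text \<open>The largest integer smaller than $\alpha$ (strictly), for $\alpha>0$.\<close>

definition floor_below :: "real \<Rightarrow> nat" where
  "floor_below \<alpha> = nat (\<lceil>\<alpha>\<rceil> - 1)"

definition multi_indices :: "nat \<Rightarrow> ('a::euclidean_space \<Rightarrow> nat) set" where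
  "multi_indices m = {l. (\<forall>b. b \<notin> Basis \<longrightarrow> l b = 0) \<and> (\<Sum>b\<in>Basis. l b) = m}"

text \<open>\<open>D l\<close> is the partial derivative of \<open>\<rho>\<close> on \<open>S\<close> with multi-index \<open>l\<close>, for all orders up to \<open>m\<close>.\<close>

definition partials :: "'a::euclidean_space set \<Rightarrow> nat \<Rightarrow> ('a \<Rightarrow> real)
    \<Rightarrow> (('a \<Rightarrow> nat) \<Rightarrow> 'a \<Rightarrow> real) \<Rightarrow> bool" where
  "partials S m \<rho> D \<longleftrightarrow> (\<forall>w\<in>S. D (\<lambda>_. 0) w = \<rho> w)
     \<and> (\<forall>j<m. \<forall>l\<in>multi_indices j. \<forall>b\<in>Basis. \<forall>w\<in>S.
          ((\<lambda>t. D l (w + t *\<^sub>R b)) has_real_derivative D (l(b := Suc (l b))) w)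
            (at 0 within {t. w + t *\<^sub>R b \<in> S}))"

text \<open>The infimum only matters at points of \<open>S\<close> that are isolated in a coordinate direction, where
  the partial derivative is not unique; otherwise \<open>D\<close> is determined on \<open>S\<close>. It makes the norm
  infinite when some partial derivative does not exist.\<close>

definition holder_norm :: "'a::euclidean_space set \<Rightarrow> real \<Rightarrow> ('a \<Rightarrow> real) \<Rightarrow> ennreal" where
  "holder_norm S \<alpha> \<rho> = (INF D \<in> {D. partials S (floor_below \<alpha>) \<rho> D}.
     (SUP l \<in> (\<Union>j\<le>floor_below \<alpha>. multi_indices j). SUP w\<in>S. ennreal \<bar>D l w\<bar>)
     + (SUP l \<in> multi_indices (floor_below \<alpha>). SUP (w, w') \<in> {(w, w'). w \<in> S \<and> w' \<in> S \<and> w \<noteq> w'}.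
          ennreal (\<bar>D l w - D l w'\<bar> / norm (w - w') powr (\<alpha> - real (floor_below \<alpha>)))))"

text \<open>Functions on \<open>S\<close> are represented as elements of \<open>extensional S\<close>.\<close>

definition supnorm_closed :: "'a set \<Rightarrow> ('a \<Rightarrow> real) set \<Rightarrow> bool" where
  "supnorm_closed S F \<longleftrightarrow> (\<forall>\<rho>\<in>extensional S.
     (\<forall>\<epsilon>>0. \<exists>\<delta>\<in>F. \<forall>w\<in>S. \<bar>\<delta> w - \<rho> w\<bar> \<le> \<epsilon>) \<longrightarrow> \<rho> \<in> F)"

definition supnorm_continuous :: "'a set \<Rightarrow> ('a \<Rightarrow> real) set \<Rightarrow> (('a \<Rightarrow> real) \<Rightarrow> real) \<Rightarrow> bool" where
  "supnorm_continuous S F G \<longleftrightarrow> (\<forall>\<delta>\<in>F. \<forall>\<epsilon>>0. \<exists>r>0. \<forall>\<delta>'\<in>F.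
     (\<forall>w\<in>S. \<bar>\<delta>' w - \<delta> w\<bar> \<le> r) \<longrightarrow> \<bar>G \<delta>' - G \<delta>\<bar> \<le> \<epsilon>)"

definition mix :: "'a set \<Rightarrow> real \<Rightarrow> ('a \<Rightarrow> real) \<Rightarrow> ('a \<Rightarrow> real) \<Rightarrow> 'a \<Rightarrow> real" where
  "mix S u \<delta>1 \<delta>2 = restrict (\<lambda>w. u * \<delta>1 w + (1 - u) * \<delta>2 w) S"

definition convex_class :: "'a set \<Rightarrow> ('a \<Rightarrow> real) set \<Rightarrow> bool" where
  "convex_class S F \<longleftrightarrow> (\<forall>\<delta>1\<in>F. \<forall>\<delta>2\<in>F. \<forall>u\<in>{0..1}. mix S u \<delta>1 \<delta>2 \<in> F)"

definition strictly_convex :: "'a set \<Rightarrow> ('a \<Rightarrow> real) set \<Rightarrow> (('a \<Rightarrow> real) \<Rightarrow> real) \<Rightarrow> bool" where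
  "strictly_convex S F G \<longleftrightarrow> (\<forall>\<delta>1\<in>F. \<forall>\<delta>2\<in>F. \<forall>u\<in>{0<..<1}. \<delta>1 \<noteq> \<delta>2 \<longrightarrow>
     G (mix S u \<delta>1 \<delta>2) < u * G \<delta>1 + (1 - u) * G \<delta>2)"

text \<open>The set $\Delta_0$.\<close>

definition representers :: "((real ^ 'd::finite) \<times> real \<Rightarrow> real) \<Rightarrow> 'd full measure
    \<Rightarrow> ((real ^ 'd) \<times> real \<Rightarrow> real) set \<Rightarrow> ((real ^ 'd) \<times> real \<Rightarrow> real) set" where
  "representers \<tau> P \<Delta> = {\<delta>\<in>\<Delta>. AE w in given_R1 P. Tadj P \<delta> w = \<tau> (XYv w)}"

text \<open>The set $\Delta_n$, with \<open>m\<close> in place of $q_n$.\<close>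

definition sieve :: "'a set \<Rightarrow> ('a \<Rightarrow> real) set \<Rightarrow> (nat \<Rightarrow> 'a \<Rightarrow> real) \<Rightarrow> nat \<Rightarrow> ('a \<Rightarrow> real) set" where
  "sieve S \<Delta> \<psi> m = {\<delta>\<in>\<Delta>. \<exists>b. \<forall>w\<in>S. \<delta> w = (\<Sum>i=1..m. b i * \<psi> i w)}"

definition w_inner :: "('d::finite) full measure \<Rightarrow> ((real ^ 'd) \<times> real \<Rightarrow> real)
    \<Rightarrow> ((real ^ 'd) \<times> real \<Rightarrow> real) \<Rightarrow> real" where
  "w_inner P \<delta>1 \<delta>2 = (\<integral>w. of_bool (Rv w) * Tadj P \<delta>1 w * Tadj P \<delta>2 w \<partial>P)"

definition w_norm :: "('d::finite) full measure \<Rightarrow> ((real ^ 'd) \<times> real \<Rightarrow> real) \<Rightarrow> real" where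
  "w_norm P \<delta> = sqrt (w_inner P \<delta> \<delta>)"

definition lin_span :: "('a \<Rightarrow> real) set \<Rightarrow> ('a \<Rightarrow> real) set" where
  "lin_span F = {(\<lambda>w. \<Sum>\<rho>\<in>G. c \<rho> * \<rho> w) | G c. finite G \<and> G \<subseteq> F}"

text \<open>The closure of the linear span under the pseudo-norm, taken inside $L_2(X,Z)$.\<close>

definition w_closure :: "('d::finite) full measure \<Rightarrow> ((real ^ 'd) \<times> real \<Rightarrow> real) set
    \<Rightarrow> ((real ^ 'd) \<times> real \<Rightarrow> real) set" where
  "w_closure P \<Delta> = {\<delta>\<in>L2 P XZv. \<forall>\<epsilon>>0. \<exists>\<rho>\<in>lin_span \<Delta>. w_norm P (\<lambda>w. \<delta> w - \<rho> w) < \<epsilon>}"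

text \<open>Real eigenvalues of the \<open>m\<close> by \<open>m\<close> matrix with entries \<open>G i j\<close>, indices running from 1.\<close>

definition is_eigenvalue :: "nat \<Rightarrow> (nat \<Rightarrow> nat \<Rightarrow> real) \<Rightarrow> real \<Rightarrow> bool" where
  "is_eigenvalue m G e \<longleftrightarrow> (\<exists>v. (\<exists>i\<in>{1..m}. v i \<noteq> 0) \<and>
     (\<forall>i\<in>{1..m}. (\<Sum>j=1..m. G i j * v j) = e * v i))"

definition gram :: "('d::finite) full measure \<Rightarrow> (nat \<Rightarrow> (real ^ 'd) \<times> real \<Rightarrow> real)
    \<Rightarrow> nat \<Rightarrow> nat \<Rightarrow> real" where
  "gram P \<phi> i j = (\<integral>w. of_bool (Rv w) * \<phi> i (XYv w) * \<phi> j (XYv w) \<partial>P)"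

definition basis_norm :: "(nat \<Rightarrow> 'a \<Rightarrow> real) \<Rightarrow> nat \<Rightarrow> 'a \<Rightarrow> real" where
  "basis_norm \<phi> m w = sqrt (\<Sum>i=1..m. (\<phi> i w)\<^sup>2)"

text \<open>$\sup_{\delta\in F}|G_n(\delta)-G(\delta)|=o_p(1)$, in outer probability, so that measurability of
  the supremum is not an issue.\<close>

definition uniformly_op1 :: "'w measure \<Rightarrow> 'f set \<Rightarrow> (nat \<Rightarrow> 'w \<Rightarrow> 'f \<Rightarrow> real) \<Rightarrow> ('f \<Rightarrow> real) \<Rightarrow> bool" where
  "uniformly_op1 W F Gn G \<longleftrightarrow> (\<forall>\<epsilon>>0. \<exists>A.
     (\<forall>n. A n \<in> sets W \<and> {\<omega>\<in>space W. \<exists>\<delta>\<in>F. \<bar>Gn n \<omega> \<delta> - G \<delta>\<bar> > \<epsilon>} \<subseteq> A n)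
     \<and> (\<lambda>n. measure W (A n)) \<longlonglongrightarrow> 0)"

end

theory Submission
  imports Defs "HOL-Real_Asymp.Real_Asymp"
begin

text \<open>
  Write $\gamma$ for the odds of nonresponse given $(X,Y)$, $\beta$ for those given $(X,Z)$, $U=(1-R)\delta_0+R\{\tau+\gamma(\tau-\delta_0)\}$
  and $\varphi=U-\mu$. The equation for $h_0$ says $E(h_0\mid R=1,X,Y)=1/f(R=1\mid X,Y)-1=\gamma$, so that $\varphi$
  is the influence function of the statement. Since $h_0$ is bounded, $\gamma$ is bounded; together with
  the lower bound on $\Omega$ this keeps $\beta$ away from $0$. The theorem then says that the observed data
  impose no restriction on scores: $\varphi$ is a gradient, and scores come arbitrarily close to it.

  Upper bound (\<open>submodel_derivative\<close>). On every law of the model the mean of $(1-R)\delta_0$ equals that of $R\gamma\delta_0$,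
  with the odds $\gamma$ of that law, so $\mu$ is the mean of $U$ computed with these odds
  (\<open>mu_representation\<close>). Along a regular submodel the observed density is differentiable in quadratic mean,
  which gives the derivative $E(SU)$ as long as the odds stay fixed. The effect of moving the odds is of
  second order (\<open>remainder_bound\<close>), because $\tau-\delta_0$ has conditional mean zero given $R=1,X,Y$ and so is
  orthogonal to every perturbation of the odds. Hence the derivative is $E(S\varphi)$, and the Cauchy-Schwarz
  inequality bounds every quotient in the supremum by $E\varphi^2$.

  Lower bound (\<open>score_approximation\<close>). The observed data of a law in the model are determined by the law of
  its respondents and its odds, both of which can be chosen freely. Moving them linearly (\<open>linear_path\<close>) moves the observed
  density linearly: a direction $s$ for the respondents and $g$ for the odds yields, up to a constant, the score
  $Rs+(1-R)\,T(\gamma s+g)/\beta$. To reach $\varphi$ one takes for $s$ the respondents' part of $\varphi$, and has to solve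
  $T(g)=u$ for a given $u(X,Z)$. Completeness makes $T'$ injective, so the range of $T$ is dense
  (\<open>range_dense\<close>), and approximate solutions suffice for a supremum.
\<close>

section \<open>Square-integrable functions\<close>

definition l2_norm :: "'a measure \<Rightarrow> ('a \<Rightarrow> real) \<Rightarrow> real" where
  "l2_norm M f = sqrt (\<integral>x. (f x)\<^sup>2 \<partial>M)"

definition sq_int :: "'a measure \<Rightarrow> ('a \<Rightarrow> real) \<Rightarrow> bool" where
  "sq_int M f \<longleftrightarrow> f \<in> borel_measurable M \<and> integrable M (\<lambda>x. (f x)\<^sup>2)"

lemma sq_intD:
  assumes "sq_int M f"
  shows "f \<in> borel_measurable M" "integrable M (\<lambda>x. (f x)\<^sup>2)"
  using assms by (auto simp: sq_int_def)

lemma l2_norm_nonneg [simp]: "0 \<le> l2_norm M f"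
  by (simp add: l2_norm_def)

lemma l2_norm_sq: "(l2_norm M f)\<^sup>2 = (\<integral>x. (f x)\<^sup>2 \<partial>M)"
  by (simp add: l2_norm_def)

lemma sq_int_mult_integrable:
  assumes "sq_int M f" "sq_int M g"
  shows "integrable M (\<lambda>x. f x * g x)"
proof (rule Bochner_Integration.integrable_bound)
  show "integrable M (\<lambda>x. (f x)\<^sup>2 + (g x)\<^sup>2)"
    using assms by (auto simp: sq_int_def)
  show "(\<lambda>x. f x * g x) \<in> borel_measurable M"
    using assms by (auto simp: sq_int_def)
  have "\<bar>a * b\<bar> \<le> a\<^sup>2 + b\<^sup>2" for a b :: real
    using sum_squares_bound[of "\<bar>a\<bar>" "\<bar>b\<bar>"] abs_ge_zero[of "a * b"]
    unfolding abs_mult power2_abs by linarith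
  then show "AE x in M. norm (f x * g x) \<le> norm ((f x)\<^sup>2 + (g x)\<^sup>2)"
    by (intro AE_I2) simp
qed

lemma sq_int_scale: "sq_int M f \<Longrightarrow> sq_int M (\<lambda>x. c * f x)"
  by (auto simp: sq_int_def power_mult_distrib)

lemma sq_int_add:
  assumes "sq_int M f" "sq_int M g"
  shows "sq_int M (\<lambda>x. f x + g x)"
  using sq_int_mult_integrable[OF assms] assms
  by (auto simp: sq_int_def power2_sum mult.assoc)

lemma sq_int_diff:
  assumes "sq_int M f" "sq_int M g"
  shows "sq_int M (\<lambda>x. f x - g x)"
  using sq_int_add[OF assms(1) sq_int_scale[OF assms(2), of "-1"]] by simp

lemma sq_int_sum:
  assumes "\<And>i. i \<in> I \<Longrightarrow> sq_int M (f i)"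
  shows "sq_int M (\<lambda>x. \<Sum>i\<in>I. f i x)"
  using assms
proof (induction I rule: infinite_finite_induct)
  case (insert i I)
  then show ?case by (auto intro: sq_int_add)
qed (auto simp: sq_int_def)

lemma (in finite_measure) sq_int_bounded:
  assumes "f \<in> borel_measurable M" "AE x in M. \<bar>f x\<bar> \<le> K"
  shows "sq_int M f"
proof -
  have "integrable M (\<lambda>x. (f x)\<^sup>2)"
  proof (rule integrable_const_bound[where B = "K\<^sup>2"])
    show "AE x in M. norm ((f x)\<^sup>2) \<le> K\<^sup>2"
      using assms(2) by eventually_elim (auto simp: abs_le_square_iff[symmetric])
  qed (use assms in auto)
  then show ?thesis using assms by (simp add: sq_int_def)
qed

lemma (in finite_measure) sq_int_integrable:
  assumes "sq_int M f"
  shows "integrable M f"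
  using sq_int_mult_integrable[OF assms sq_int_bounded[of "\<lambda>_. 1" 1]] by simp

text \<open>The absolute value is kept inside the integral, for use as a bound in $L_1$. The proof expands the
  square of $\|f\|^2|g|-X|f|$, where $X$ is the left-hand side.\<close>

lemma integral_cauchy_schwarz:
  assumes "sq_int M f" "sq_int M g"
  shows "(\<integral>x. \<bar>f x * g x\<bar> \<partial>M) \<le> l2_norm M f * l2_norm M g"
proof -
  define A where "A = (\<integral>x. (f x)\<^sup>2 \<partial>M)"
  define B where "B = (\<integral>x. (g x)\<^sup>2 \<partial>M)"
  define X where "X = (\<integral>x. \<bar>f x * g x\<bar> \<partial>M)"
  have iA: "integrable M (\<lambda>x. (f x)\<^sup>2)" and iB: "integrable M (\<lambda>x. (g x)\<^sup>2)"
    and iX: "integrable M (\<lambda>x. \<bar>f x * g x\<bar>)"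
    using assms sq_int_mult_integrable[OF assms] by (auto simp: sq_int_def)
  have A0: "0 \<le> A" and X0: "0 \<le> X" by (auto simp: A_def X_def)
  have "X\<^sup>2 \<le> A * B"
  proof (cases "A = 0")
    case True
    then have "AE x in M. (f x)\<^sup>2 = 0"
      using integral_nonneg_eq_0_iff_AE[OF iA] by (simp add: A_def)
    then have "AE x in M. \<bar>f x * g x\<bar> = 0" by eventually_elim auto
    then have "X = 0" unfolding X_def by (rule integral_eq_zero_AE)
    with True show ?thesis by simp
  next
    case False
    have "(\<integral>x. (A * \<bar>g x\<bar> - X * \<bar>f x\<bar>)\<^sup>2 \<partial>M)
        = (\<integral>x. A\<^sup>2 * (g x)\<^sup>2 - 2 * A * X * \<bar>f x * g x\<bar> + X\<^sup>2 * (f x)\<^sup>2 \<partial>M)"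
      by (intro Bochner_Integration.integral_cong)
         (auto simp: power2_eq_square algebra_simps abs_mult)
    also have "\<dots> = A\<^sup>2 * B - 2 * A * X * X + X\<^sup>2 * A"
      using iA iB iX by (simp add: A_def B_def X_def)
    also have "\<dots> = A * (A * B - X\<^sup>2)" by (simp add: power2_eq_square algebra_simps)
    finally have "0 \<le> A * (A * B - X\<^sup>2)"
      by (metis (no_types, lifting) integral_nonneg_AE AE_I2 zero_le_power2)
    then show ?thesis using A0 False by (simp add: zero_le_mult_iff)
  qed
  then have "X \<le> sqrt (A * B)" using X0 real_le_rsqrt by blast
  then show ?thesis by (simp add: X_def A_def B_def l2_norm_def real_sqrt_mult)
qed

lemma abs_integral_cauchy_schwarz:
  assumes "sq_int M f" "sq_int M g"
  shows "\<bar>\<integral>x. f x * g x \<partial>M\<bar> \<le> l2_norm M f * l2_norm M g"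
  by (rule order_trans[OF integral_abs_bound integral_cauchy_schwarz[OF assms]])

lemma l2_norm_triangle:
  assumes "sq_int M f" "sq_int M g"
  shows "l2_norm M (\<lambda>x. f x + g x) \<le> l2_norm M f + l2_norm M g"
proof -
  have "(\<integral>x. (f x + g x)\<^sup>2 \<partial>M) = (\<integral>x. (f x)\<^sup>2 + 2 * (f x * g x) + (g x)\<^sup>2 \<partial>M)"
    by (simp add: power2_sum algebra_simps)
  also have "\<dots> = (l2_norm M f)\<^sup>2 + 2 * (\<integral>x. f x * g x \<partial>M) + (l2_norm M g)\<^sup>2"
    using assms sq_int_mult_integrable[OF assms] by (simp add: sq_int_def l2_norm_sq)
  also have "\<dots> \<le> (l2_norm M f + l2_norm M g)\<^sup>2"
    using abs_integral_cauchy_schwarz[OF assms] by (simp add: power2_sum)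
  finally show ?thesis unfolding l2_norm_def[of M "\<lambda>x. f x + g x"]
    by (intro real_le_lsqrt) auto
qed

lemma l2_norm_scale: "l2_norm M (\<lambda>x. c * f x) = \<bar>c\<bar> * l2_norm M f"
  by (simp add: l2_norm_def power_mult_distrib real_sqrt_mult)

lemma l2_norm_triangle_diff:
  assumes "sq_int M f" "sq_int M g"
  shows "l2_norm M (\<lambda>x. f x - g x) \<le> l2_norm M f + l2_norm M g"
  using l2_norm_triangle[OF assms(1) sq_int_scale[OF assms(2), of "-1"]]
    l2_norm_scale[of M "-1" g] by simp

lemma (in prob_space) integral_abs_le_l2_norm:
  assumes "sq_int M f"
  shows "(\<integral>x. \<bar>f x\<bar> \<partial>M) \<le> l2_norm M f"
  using integral_cauchy_schwarz[OF assms sq_int_bounded[of "\<lambda>_. 1" 1]]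
  by (simp add: l2_norm_def prob_space)

lemma sq_int_mult_bounded:
  assumes "sq_int M f" "g \<in> borel_measurable M" "AE x in M. \<bar>g x\<bar> \<le> C" "0 \<le> C"
  shows "sq_int M (\<lambda>x. f x * g x)" "l2_norm M (\<lambda>x. f x * g x) \<le> C * l2_norm M f"
proof -
  have i: "integrable M (\<lambda>x. C\<^sup>2 * (f x)\<^sup>2)" using assms by (auto simp: sq_int_def)
  have le: "AE x in M. (f x * g x)\<^sup>2 \<le> C\<^sup>2 * (f x)\<^sup>2"
    using assms(3)
  proof eventually_elim
    case (elim x)
    then have "(g x)\<^sup>2 \<le> C\<^sup>2" using assms(4) by (simp add: abs_le_square_iff[symmetric])
    then have "(f x)\<^sup>2 * (g x)\<^sup>2 \<le> (f x)\<^sup>2 * C\<^sup>2" by (intro mult_left_mono) auto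
    then show ?case by (simp add: power_mult_distrib mult.commute)
  qed
  have i2: "integrable M (\<lambda>x. (f x * g x)\<^sup>2)"
  proof (rule Bochner_Integration.integrable_bound[OF i])
    show "AE x in M. norm ((f x * g x)\<^sup>2) \<le> norm (C\<^sup>2 * (f x)\<^sup>2)"
      using le by eventually_elim simp
  qed (use assms in \<open>auto simp: sq_int_def\<close>)
  then show "sq_int M (\<lambda>x. f x * g x)" using assms by (auto simp: sq_int_def)
  have "(\<integral>x. (f x * g x)\<^sup>2 \<partial>M) \<le> (\<integral>x. C\<^sup>2 * (f x)\<^sup>2 \<partial>M)"
    by (rule integral_mono_AE[OF i2 i le])
  then have "l2_norm M (\<lambda>x. f x * g x) \<le> sqrt (C\<^sup>2 * (\<integral>x. (f x)\<^sup>2 \<partial>M))"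
    unfolding l2_norm_def by (intro real_sqrt_le_mono) simp
  then show "l2_norm M (\<lambda>x. f x * g x) \<le> C * l2_norm M f"
    using assms(4) by (simp add: l2_norm_def real_sqrt_mult)
qed

text \<open>The Hilbert-space fact that a subspace with trivial orthogonal complement is dense. A minimising
  sequence for the distance to \<open>u\<close> is asymptotically orthogonal to the subspace, is Cauchy by the
  parallelogram law, and so converges to a function whose difference from \<open>u\<close> is orthogonal to the
  subspace. Working with a sequence in the subspace avoids forming its closure.\<close>

lemma (in prob_space) dense_if_orthogonal_complement_trivial:
  fixes L :: "('a \<Rightarrow> real) set"
  assumes sq: "\<And>f. f \<in> L \<Longrightarrow> sq_int M f"
    and zero: "(\<lambda>_. 0) \<in> L"
    and lin: "\<And>f g c. f \<in> L \<Longrightarrow> g \<in> L \<Longrightarrow> (\<lambda>x. f x + c * g x) \<in> L"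
    and u: "sq_int M u"
    and trivial: "\<And>v. sq_int M v \<Longrightarrow> (\<And>f. f \<in> L \<Longrightarrow> (\<integral>x. v x * f x \<partial>M) = 0) \<Longrightarrow> AE x in M. v x = 0"
  obtains F :: "nat \<Rightarrow> 'a \<Rightarrow> real"
  where "\<And>n. F n \<in> L" "(\<lambda>n. l2_norm M (\<lambda>x. F n x - u x)) \<longlonglongrightarrow> 0"
proof -
  define J where "J f = (\<integral>x. (f x - u x)\<^sup>2 \<partial>M)" for f
  define d where "d = (INF f\<in>L. J f)"
  have J0: "0 \<le> J f" for f by (simp add: J_def)
  have bdd: "bdd_below (J ` L)" using J0 by (auto intro!: bdd_belowI2[of _ 0])
  have d_le: "d \<le> J f" if "f \<in> L" for f
    unfolding d_def using cINF_lower[OF bdd that] by simp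
  have "\<exists>f\<in>L. J f < d + 1 / real (Suc n)" for n
  proof -
    have "(INF f\<in>L. J f) < d + 1 / real (Suc n)" unfolding d_def by simp
    moreover have "L \<noteq> {}" using zero by auto
    ultimately show ?thesis using cINF_less_iff[OF _ bdd] by blast
  qed
  then obtain F where F: "\<And>n. F n \<in> L" "\<And>n. J (F n) < d + 1 / real (Suc n)" by metis
  have sqF: "sq_int M (F n)" for n using sq F by auto
  have dsq: "sq_int M (\<lambda>x. f x - u x)" if "f \<in> L" for f using sq_int_diff[OF sq[OF that] u] .
  have expand: "(\<integral>x. (f x + c * g x)\<^sup>2 \<partial>M)
      = (\<integral>x. (f x)\<^sup>2 \<partial>M) + 2 * c * (\<integral>x. f x * g x \<partial>M) + c\<^sup>2 * (\<integral>x. (g x)\<^sup>2 \<partial>M)"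
    if "sq_int M f" "sq_int M g" for f g c
  proof -
    have "(\<integral>x. (f x + c * g x)\<^sup>2 \<partial>M)
        = (\<integral>x. (f x)\<^sup>2 + 2 * c * (f x * g x) + c\<^sup>2 * (g x)\<^sup>2 \<partial>M)"
      by (intro Bochner_Integration.integral_cong) (auto simp: power2_eq_square algebra_simps)
    then show ?thesis
      using that sq_int_mult_integrable[OF that] by (simp add: sq_int_def)
  qed
  \<comment> \<open>Moving along \<open>g\<close> cannot lower the distance by more than the slack, whatever the step \<open>c\<close>.\<close>
  have orth: "(\<integral>x. (F n x - u x) * g x \<partial>M)\<^sup>2 \<le> (1 / real (Suc n)) * (\<integral>x. (g x)\<^sup>2 \<partial>M)"
    if g: "g \<in> L" for g n
  proof -
    define X where "X = (\<integral>x. (F n x - u x) * g x \<partial>M)"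
    define G where "G = (\<integral>x. (g x)\<^sup>2 \<partial>M)"
    have key: "0 \<le> 1 / real (Suc n) + 2 * c * X + c\<^sup>2 * G" for c
    proof -
      have "d \<le> J (\<lambda>x. F n x + c * g x)" by (intro d_le lin F g)
      also have "\<dots> = (\<integral>x. ((F n x - u x) + c * g x)\<^sup>2 \<partial>M)"
        unfolding J_def by (simp add: algebra_simps)
      also have "\<dots> = J (F n) + 2 * c * X + c\<^sup>2 * G"
        unfolding expand[OF dsq[OF F(1)] sq[OF g]] J_def X_def G_def ..
      finally show ?thesis using F(2)[of n] by linarith
    qed
    have G0: "0 \<le> G" by (simp add: G_def)
    show "X\<^sup>2 \<le> (1 / real (Suc n)) * G"
    proof (cases "G = 0")
      case True
      have "X = 0"
      proof (rule ccontr)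
        assume "X \<noteq> 0"
        then have "2 * (- 1 / (real (Suc n) * X)) * X = - 2 / real (Suc n)" by simp
        then show False using key[of "- 1 / (real (Suc n) * X)"] True by simp
      qed
      with True show ?thesis by simp
    next
      case False
      with G0 have "0 < G" by simp
      have "2 * (- X / G) * X + (- X / G)\<^sup>2 * G = - (X\<^sup>2 / G)"
        using \<open>0 < G\<close> by (simp add: power2_eq_square field_simps)
      then have "X\<^sup>2 / G \<le> 1 / real (Suc n)" using key[of "- X / G"] by linarith
      then show ?thesis using \<open>0 < G\<close> by (simp add: pos_divide_le_eq)
    qed
  qed
  \<comment> \<open>Parallelogram law, with the midpoint again in the subspace.\<close>
  have cauchy: "l2_norm M (\<lambda>x. F n x - F m x) \<le> sqrt (2 / real (Suc n) + 2 / real (Suc m))" for n m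
  proof -
    let ?a = "\<lambda>x. F n x - u x" and ?b = "\<lambda>x. F m x - u x"
    have mid: "(\<lambda>x. 1/2 * F n x + 1/2 * F m x) \<in> L"
      using lin[OF lin[OF zero F(1)[of n], of "1/2"] F(1)[of m], of "1/2"] by simp
    have "(\<integral>x. (F n x - F m x)\<^sup>2 \<partial>M)
        = (\<integral>x. 2 * (?a x)\<^sup>2 + 2 * (?b x)\<^sup>2 - 4 * ((1/2 * F n x + 1/2 * F m x) - u x)\<^sup>2 \<partial>M)"
      by (intro Bochner_Integration.integral_cong) (auto simp: power2_eq_square algebra_simps)
    also have "\<dots> = 2 * J (F n) + 2 * J (F m) - 4 * J (\<lambda>x. 1/2 * F n x + 1/2 * F m x)"
      using dsq[OF F(1)[of n]] dsq[OF F(1)[of m]] dsq[OF mid] by (simp add: J_def sq_int_def)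
    also have "\<dots> \<le> 2 / real (Suc n) + 2 / real (Suc m)"
      using F(2)[of n] F(2)[of m] d_le[OF mid] by linarith
    finally show ?thesis unfolding l2_norm_def by (rule real_sqrt_le_mono)
  qed
  have small: "\<exists>N. \<forall>i\<ge>N. \<forall>j\<ge>N. sqrt (2 / real (Suc i) + 2 / real (Suc j)) < e" if "0 < e" for e
  proof -
    have "(\<lambda>n. sqrt (4 / real (Suc n))) \<longlonglongrightarrow> sqrt 0"
      by (intro tendsto_real_sqrt) real_asymp
    then have "\<forall>\<^sub>F n in sequentially. sqrt (4 / real (Suc n)) < e"
      using that by (auto dest: order_tendstoD)
    then obtain N where N: "sqrt (4 / real (Suc N)) < e" by (auto simp: eventually_sequentially)
    have "sqrt (2 / real (Suc i) + 2 / real (Suc j)) < e" if "i \<ge> N" "j \<ge> N" for i j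
    proof -
      have "2 / real (Suc i) \<le> 2 / real (Suc N)" "2 / real (Suc j) \<le> 2 / real (Suc N)"
        using that by (auto intro!: divide_left_mono)
      then have "sqrt (2 / real (Suc i) + 2 / real (Suc j)) \<le> sqrt (4 / real (Suc N))"
        by (intro real_sqrt_le_mono) linarith
      with N show ?thesis by linarith
    qed
    then show ?thesis by blast
  qed
  obtain r where r: "strict_mono r" "AE x in M. Cauchy (\<lambda>i. F (r i) x)"
  proof (rule cauchy_L1_AE_cauchy_subseq[where s = F and M = M])
    show "integrable M (F n)" for n using sq_int_integrable[OF sqF] .
    fix e :: real assume "0 < e"
    then obtain N where N: "\<And>i j. i \<ge> N \<Longrightarrow> j \<ge> N \<Longrightarrow> sqrt (2 / real (Suc i) + 2 / real (Suc j)) < e"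
      using small by blast
    have "(LINT x|M. norm (F i x - F j x)) < e" if "i \<ge> N" "j \<ge> N" for i j
      using integral_abs_le_l2_norm[OF sq_int_diff[OF sqF[of i] sqF[of j]]] cauchy[of i j] N[OF that]
      by simp
    then show "\<exists>N. \<forall>i\<ge>N. \<forall>j\<ge>N. (LINT x|M. norm (F i x - F j x)) < e" by blast
  qed
  define v where "v x = lim (\<lambda>i. F (r i) x)" for x
  have [measurable]: "F n \<in> borel_measurable M" for n using sqF by (auto simp: sq_int_def)
  have v_meas [measurable]: "v \<in> borel_measurable M" unfolding v_def by measurable
  have v_lim: "AE x in M. (\<lambda>i. F (r i) x) \<longlonglongrightarrow> v x"
    using r(2) by eventually_elim (simp add: v_def Cauchy_convergent_iff convergent_LIMSEQ_iff)
  have fatou: "(\<integral>\<^sup>+x. ennreal ((v x - F n x)\<^sup>2) \<partial>M) \<le> ennreal (4 / real (Suc n))" for n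
  proof -
    have "(\<integral>\<^sup>+x. ennreal ((v x - F n x)\<^sup>2) \<partial>M)
        = (\<integral>\<^sup>+x. liminf (\<lambda>i. ennreal ((F (r i) x - F n x)\<^sup>2)) \<partial>M)"
    proof (intro nn_integral_cong_AE, use v_lim in eventually_elim)
      case (elim x)
      have "(\<lambda>i. ennreal ((F (r i) x - F n x)\<^sup>2)) \<longlonglongrightarrow> ennreal ((v x - F n x)\<^sup>2)"
        by (intro tendsto_ennrealI tendsto_intros elim)
      then show ?case by (metis lim_imp_Liminf sequentially_bot)
    qed
    also have "\<dots> \<le> liminf (\<lambda>i. \<integral>\<^sup>+x. ennreal ((F (r i) x - F n x)\<^sup>2) \<partial>M)"
      by (intro nn_integral_liminf) measurable
    also have "\<dots> \<le> ennreal (4 / real (Suc n))"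
    proof (rule Liminf_le)
      show "\<forall>\<^sub>F i in sequentially. (\<integral>\<^sup>+x. ennreal ((F (r i) x - F n x)\<^sup>2) \<partial>M) \<le> ennreal (4 / real (Suc n))"
        using eventually_ge_at_top[of n]
      proof eventually_elim
        case (elim i)
        have "r i \<ge> n" using elim seq_suble[OF r(1), of i] by linarith
        then have "2 / real (Suc (r i)) \<le> 2 / real (Suc n)" by (auto intro!: divide_left_mono)
        then have *: "2 / real (Suc (r i)) + 2 / real (Suc n) \<le> 4 / real (Suc n)" by simp
        have "(\<integral>x. (F (r i) x - F n x)\<^sup>2 \<partial>M) \<le> 2 / real (Suc (r i)) + 2 / real (Suc n)"
          using cauchy[of "r i" n] unfolding l2_norm_def by simp
        with * show ?case
          using sq_int_diff[OF sqF[of "r i"] sqF[of n]]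
          by (subst nn_integral_eq_integral) (auto simp: sq_int_def intro!: ennreal_leI)
      qed
    qed simp
    finally show ?thesis .
  qed
  have vF: "sq_int M (\<lambda>x. v x - F n x)" for n
  proof -
    have "(\<integral>\<^sup>+x. ennreal ((v x - F n x)\<^sup>2) \<partial>M) < \<infinity>"
      using fatou[of n] by (simp add: le_less_trans ennreal_less_top)
    then show ?thesis unfolding sq_int_def by (auto intro!: integrableI_bounded)
  qed
  have vF_norm: "l2_norm M (\<lambda>x. v x - F n x) \<le> sqrt (4 / real (Suc n))" for n
  proof -
    have "ennreal (\<integral>x. (v x - F n x)\<^sup>2 \<partial>M) \<le> ennreal (4 / real (Suc n))"
      using fatou[of n] vF[of n] by (subst nn_integral_eq_integral[symmetric]) (auto simp: sq_int_def)
    then show ?thesis unfolding l2_norm_def by (intro real_sqrt_le_mono) (simp add: ennreal_le_iff)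
  qed
  have lim4: "(\<lambda>n. sqrt (4 / real (Suc n))) \<longlonglongrightarrow> 0"
    using tendsto_real_sqrt[of "\<lambda>n. 4 / real (Suc n)" 0 sequentially] by (simp, real_asymp)
  have sqv: "sq_int M v" using sq_int_add[OF vF[of 0] sqF[of 0]] by simp
  have "AE x in M. v x - u x = 0"
  proof (rule trivial)
    show sqvu: "sq_int M (\<lambda>x. v x - u x)" using sq_int_diff[OF sqv u] .
    fix g assume g: "g \<in> L"
    define c where "c = sqrt (\<integral>x. (g x)\<^sup>2 \<partial>M)"
    have "\<bar>\<integral>x. (v x - u x) * g x \<partial>M\<bar> \<le> (sqrt (4 / real (Suc n)) + sqrt (1 / real (Suc n))) * c" for n
    proof -
      have "(\<integral>x. (v x - u x) * g x \<partial>M)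
          = (\<integral>x. (v x - F n x) * g x + (F n x - u x) * g x \<partial>M)"
        by (simp add: algebra_simps)
      also have "\<dots> = (\<integral>x. (v x - F n x) * g x \<partial>M) + (\<integral>x. (F n x - u x) * g x \<partial>M)"
        by (intro Bochner_Integration.integral_add sq_int_mult_integrable vF sq g dsq F)
      finally have "\<bar>\<integral>x. (v x - u x) * g x \<partial>M\<bar>
        \<le> \<bar>\<integral>x. (v x - F n x) * g x \<partial>M\<bar> + \<bar>\<integral>x. (F n x - u x) * g x \<partial>M\<bar>" by simp
      also have "\<bar>\<integral>x. (v x - F n x) * g x \<partial>M\<bar> \<le> sqrt (4 / real (Suc n)) * c"
        using abs_integral_cauchy_schwarz[OF vF sq[OF g], of n] vF_norm[of n]
          mult_right_mono[OF vF_norm[of n], of c]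
        by (simp add: c_def l2_norm_def)
      also have "\<bar>\<integral>x. (F n x - u x) * g x \<partial>M\<bar> \<le> sqrt (1 / real (Suc n)) * c"
        using real_sqrt_le_mono[OF orth[OF g, of n]] by (simp add: c_def real_sqrt_mult[symmetric] real_sqrt_divide)
      finally show ?thesis by (simp add: algebra_simps)
    qed
    moreover have "(\<lambda>n. (sqrt (4 / real (Suc n)) + sqrt (1 / real (Suc n))) * c) \<longlonglongrightarrow> (0 + 0) * c"
      using tendsto_real_sqrt[of "\<lambda>n. 1 / real (Suc n)" 0 sequentially]
      by (intro tendsto_intros lim4) (simp, real_asymp)
    ultimately have "\<bar>\<integral>x. (v x - u x) * g x \<partial>M\<bar> \<le> 0"
      by (intro LIMSEQ_le_const[of _ 0]) auto
    then show "(\<integral>x. (v x - u x) * g x \<partial>M) = 0" by simp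
  qed
  then have "l2_norm M (\<lambda>x. F n x - u x) = l2_norm M (\<lambda>x. v x - F n x)" for n
    unfolding l2_norm_def
    using u by (intro arg_cong[where f = sqrt] integral_cong_AE)
      (auto simp: sq_int_def power2_commute)
  then have "(\<lambda>n. l2_norm M (\<lambda>x. F n x - u x)) \<longlonglongrightarrow> 0"
    using vF_norm by (intro tendsto_sandwich[OF _ _ tendsto_const lim4]) auto
  with F(1) show thesis by (rule that)
qed

section \<open>Paths that are differentiable in quadratic mean\<close>

text \<open>Here \<open>q t\<close> is the density of the \<open>t\<close>-th law of the path with respect to \<open>M\<close>, and \<open>S\<close> is the score.\<close>

locale qmd_path = prob_space M for M :: "'a measure" +
  fixes q :: "real \<Rightarrow> 'a \<Rightarrow> real" and S :: "'a \<Rightarrow> real"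
  assumes q_meas [measurable]: "\<And>t. q t \<in> borel_measurable M"
    and q_nonneg: "\<And>t x. 0 \<le> q t x"
    and score: "sq_int M S"
    and qmd_lim: "((\<lambda>t. \<integral>\<^sup>+x. ennreal (((sqrt (q t x) - 1) / t - S x / 2)\<^sup>2) \<partial>M) \<longlongrightarrow> 0) (at_right 0)"
begin

definition err :: "real \<Rightarrow> 'a \<Rightarrow> real" where
  "err t x = (sqrt (q t x) - 1) / t - S x / 2"

lemma S_meas [measurable]: "S \<in> borel_measurable M"
  using score by (simp add: sq_int_def)

lemma err_meas [measurable]: "err t \<in> borel_measurable M"
  unfolding err_def by measurable

lemma ev_err: "\<forall>\<^sub>F t in at_right 0. sq_int M (err t)"
proof -
  have "\<forall>\<^sub>F t in at_right 0. (\<integral>\<^sup>+x. ennreal ((err t x)\<^sup>2) \<partial>M) < 1"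
    using order_tendstoD(2)[OF qmd_lim, of 1] by (simp add: err_def)
  then show ?thesis
  proof eventually_elim
    case (elim t)
    then have "(\<integral>\<^sup>+x. ennreal ((err t x)\<^sup>2) \<partial>M) < \<infinity>" by (simp add: order_less_trans)
    then show ?case unfolding sq_int_def by (auto intro!: integrableI_bounded)
  qed
qed

lemma err_lim: "((\<lambda>t. l2_norm M (err t)) \<longlongrightarrow> 0) (at_right 0)"
proof -
  have "((\<lambda>t. enn2real (\<integral>\<^sup>+x. ennreal ((err t x)\<^sup>2) \<partial>M)) \<longlongrightarrow> enn2real 0) (at_right 0)"
    using qmd_lim by (intro tendsto_enn2real) (auto simp: err_def)
  then have "((\<lambda>t. sqrt (enn2real (\<integral>\<^sup>+x. ennreal ((err t x)\<^sup>2) \<partial>M))) \<longlongrightarrow> 0) (at_right 0)"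
    using tendsto_real_sqrt by fastforce
  moreover have "sqrt (enn2real (\<integral>\<^sup>+x. ennreal ((err t x)\<^sup>2) \<partial>M)) = l2_norm M (err t)" for t
    unfolding l2_norm_def by (subst integral_eq_nn_integral) auto
  ultimately show ?thesis by simp
qed

lemma root_eq: "t \<noteq> 0 \<Longrightarrow> sqrt (q t x) - 1 = t * (err t x + 1/2 * S x)"
  by (simp add: err_def field_simps)

lemma root_bound:
  "\<forall>\<^sub>F t in at_right 0. sq_int M (\<lambda>x. sqrt (q t x) - 1)
     \<and> l2_norm M (\<lambda>x. sqrt (q t x) - 1) \<le> t * (1 + l2_norm M S)"
proof -
  have "\<forall>\<^sub>F t in at_right 0. l2_norm M (err t) < 1"
    using order_tendstoD(2)[OF err_lim, of 1] by simp
  moreover have "\<forall>\<^sub>F t::real in at_right 0. 0 < t" by (simp add: eventually_at_right_less)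
  ultimately show ?thesis using ev_err
  proof eventually_elim
    case (elim t)
    have eq: "(\<lambda>x. sqrt (q t x) - 1) = (\<lambda>x. t * (err t x + 1/2 * S x))"
      using root_eq[of t] elim(2) by auto
    have sq: "sq_int M (\<lambda>x. err t x + 1/2 * S x)"
      by (intro sq_int_add elim sq_int_scale score)
    have "l2_norm M (\<lambda>x. err t x + 1/2 * S x) \<le> l2_norm M (err t) + l2_norm M (\<lambda>x. 1/2 * S x)"
      by (intro l2_norm_triangle elim sq_int_scale score)
    also have "\<dots> \<le> 1 + l2_norm M S"
    proof -
      have "\<bar>1/2\<bar> * l2_norm M S \<le> 1 * l2_norm M S" by (intro mult_right_mono) auto
      then show ?thesis unfolding l2_norm_scale using elim(1) by linarith
    qed
    finally show ?case unfolding eq l2_norm_scale using sq_int_scale[OF sq] elim(2) by simp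
  qed
qed

lemma sq_int_const: "sq_int M (\<lambda>_. c)"
  by (rule sq_int_bounded[where K = "\<bar>c\<bar>"]) auto

lemma l2_norm_const: "l2_norm M (\<lambda>_. c) = \<bar>c\<bar>"
  by (simp add: l2_norm_def prob_space)

text \<open>With \<open>e\<close> the error of the square roots, $(q_t-1)/t-S=e(\sqrt{q_t}+1)+S(\sqrt{q_t}-1)/2$ tends to $0$ in $L_1$,
  as $e$ and $\sqrt{q_t}-1$ tend to $0$ in $L_2$.\<close>

lemma integral_derivative:
  assumes f [measurable]: "f \<in> borel_measurable M" and K: "AE x in M. \<bar>f x\<bar> \<le> K"
  shows "((\<lambda>t. ((\<integral>x. q t x * f x \<partial>M) - (\<integral>x. f x \<partial>M)) / t) \<longlongrightarrow> (\<integral>x. S x * f x \<partial>M)) (at_right 0)"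
proof -
  define C where "C = 1 + l2_norm M S"
  define bound where "bound t = \<bar>K\<bar> * (l2_norm M (err t) * (t * C + 2) + 1/2 * l2_norm M S * (t * C))" for t
  have K': "AE x in M. \<bar>f x\<bar> \<le> \<bar>K\<bar>" using K by eventually_elim auto
  have sf: "sq_int M f" by (rule sq_int_bounded[OF f K])
  have "\<forall>\<^sub>F t::real in at_right 0. 0 < t" by (simp add: eventually_at_right_less)
  with root_bound ev_err have "\<forall>\<^sub>F t in at_right 0.
    norm (((\<integral>x. q t x * f x \<partial>M) - (\<integral>x. f x \<partial>M)) / t - (\<integral>x. S x * f x \<partial>M)) \<le> bound t"
  proof eventually_elim
    case (elim t)
    let ?r = "\<lambda>x. sqrt (q t x)"
    have sr1: "sq_int M (\<lambda>x. ?r x - 1)" and lr1: "l2_norm M (\<lambda>x. ?r x - 1) \<le> t * C"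
      using elim by (auto simp: C_def)
    have srp: "sq_int M (\<lambda>x. ?r x + 1)"
      using sq_int_add[OF sr1 sq_int_const[of 2]] by (simp add: algebra_simps)
    have lrp: "l2_norm M (\<lambda>x. ?r x + 1) \<le> t * C + 2"
      using l2_norm_triangle[OF sr1 sq_int_const[of 2]] lr1 by (simp add: l2_norm_const algebra_simps)
    have sr: "sq_int M ?r" using sq_int_add[OF sr1 sq_int_const[of 1]] by simp
    have iq: "integrable M (q t)"
      using sr q_nonneg by (simp add: sq_int_def)
    have iqf: "integrable M (\<lambda>x. q t x * f x)"
    proof (rule Bochner_Integration.integrable_bound[OF integrable_mult_left[OF iq, of "\<bar>K\<bar>"]])
      show "AE x in M. norm (q t x * f x) \<le> norm (q t x * \<bar>K\<bar>)"
        using K' by eventually_elim (auto simp: abs_mult intro!: mult_left_mono)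
    qed measurable
    have pw: "(q t x - 1) / t - S x = err t x * (?r x + 1) + 1/2 * S x * (?r x - 1)" for x
    proof -
      have "q t x - 1 = (?r x - 1) * (?r x + 1)"
        using q_nonneg[of t x] by (simp add: algebra_simps)
      also have "\<dots> = t * ((err t x + 1/2 * S x) * (?r x + 1))"
        using root_eq[of t x] elim(3) by simp
      finally show ?thesis using elim(3) by (simp add: field_simps)
    qed
    have i1: "integrable M (\<lambda>x. err t x * (?r x + 1))"
      by (intro sq_int_mult_integrable elim srp)
    have i2: "integrable M (\<lambda>x. 1/2 * S x * (?r x - 1))"
      by (intro sq_int_mult_integrable sq_int_scale score sr1)
    have "((\<integral>x. q t x * f x \<partial>M) - (\<integral>x. f x \<partial>M)) / t - (\<integral>x. S x * f x \<partial>M)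
        = (\<integral>x. (q t x * f x - f x) / t - S x * f x \<partial>M)"
      using iqf sq_int_integrable[OF sf] sq_int_mult_integrable[OF score sf] by simp
    also have "\<dots> = (\<integral>x. ((q t x - 1) / t - S x) * f x \<partial>M)"
      by (simp add: diff_divide_distrib algebra_simps)
    finally have "norm (((\<integral>x. q t x * f x \<partial>M) - (\<integral>x. f x \<partial>M)) / t - (\<integral>x. S x * f x \<partial>M))
        = \<bar>\<integral>x. ((q t x - 1) / t - S x) * f x \<partial>M\<bar>" by simp
    also have "\<dots> \<le> (\<integral>x. \<bar>((q t x - 1) / t - S x) * f x\<bar> \<partial>M)" by (rule integral_abs_bound)
    also have "\<dots> \<le> (\<integral>x. \<bar>K\<bar> * (\<bar>err t x * (?r x + 1)\<bar> + \<bar>1/2 * S x * (?r x - 1)\<bar>) \<partial>M)"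
    proof (rule integral_mono_AE')
      show "integrable M (\<lambda>x. \<bar>K\<bar> * (\<bar>err t x * (?r x + 1)\<bar> + \<bar>1/2 * S x * (?r x - 1)\<bar>))"
        by (intro integrable_mult_right Bochner_Integration.integrable_add integrable_abs i1 i2)
      show "AE x in M. \<bar>((q t x - 1) / t - S x) * f x\<bar>
          \<le> \<bar>K\<bar> * (\<bar>err t x * (?r x + 1)\<bar> + \<bar>1/2 * S x * (?r x - 1)\<bar>)"
        using K'
      proof eventually_elim
        case (elim x)
        have "\<bar>(q t x - 1) / t - S x\<bar> * \<bar>f x\<bar>
            \<le> (\<bar>err t x * (?r x + 1)\<bar> + \<bar>1/2 * S x * (?r x - 1)\<bar>) * \<bar>K\<bar>"
          unfolding pw by (intro mult_mono elim abs_triangle_ineq) auto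
        then show ?case by (simp only: abs_mult[of _ "f x"] mult.commute[of "\<bar>K\<bar>"])
      qed
    qed simp
    also have "\<dots> = \<bar>K\<bar> * ((\<integral>x. \<bar>err t x * (?r x + 1)\<bar> \<partial>M) + (\<integral>x. \<bar>1/2 * S x * (?r x - 1)\<bar> \<partial>M))"
      using i1 i2 by (simp only: integral_mult_right_zero integrable_abs Bochner_Integration.integral_add)
    also have "\<dots> \<le> bound t"
      unfolding bound_def
    proof (intro mult_left_mono add_mono)
      show "(\<integral>x. \<bar>err t x * (?r x + 1)\<bar> \<partial>M) \<le> l2_norm M (err t) * (t * C + 2)"
        using integral_cauchy_schwarz[OF elim(2) srp] mult_left_mono[OF lrp l2_norm_nonneg[of M "err t"]]
        by linarith
      show "(\<integral>x. \<bar>1/2 * S x * (?r x - 1)\<bar> \<partial>M) \<le> 1/2 * l2_norm M S * (t * C)"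
        using integral_cauchy_schwarz[OF sq_int_scale[OF score, of "1/2"] sr1]
          mult_left_mono[OF lr1, of "l2_norm M (\<lambda>x. 1/2 * S x)"]
        unfolding l2_norm_scale by simp
    qed simp
    finally show ?case .
  qed
  moreover have "(bound \<longlongrightarrow> \<bar>K\<bar> * (0 * (0 * C + 2) + 1/2 * l2_norm M S * (0 * C))) (at_right 0)"
    unfolding bound_def by (intro tendsto_intros err_lim)
  then have "(bound \<longlongrightarrow> 0) (at_right 0)" by simp
  ultimately have "((\<lambda>t. ((\<integral>x. q t x * f x \<partial>M) - (\<integral>x. f x \<partial>M)) / t
      - (\<integral>x. S x * f x \<partial>M)) \<longlongrightarrow> 0) (at_right 0)"
    by (rule Lim_null_comparison)
  then show ?thesis by (rule LIM_zero_cancel)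
qed

end

section \<open>Laws on the full data space\<close>

abbreviation sig :: "('d::finite full \<Rightarrow> 'b::topological_space) \<Rightarrow> 'd full measure" where
  "sig V \<equiv> vimage_algebra UNIV V borel"

lemma space_full_space [simp]: "space full_space = UNIV"
  by (simp add: full_space_def space_pair_measure)

lemma Rv_eq: "Rv = fst"
  by (auto simp: Rv_def)

lemma measurable_Rv [measurable]: "Rv \<in> measurable full_space (count_space UNIV)"
  unfolding full_space_def Rv_eq by measurable

lemma measurable_snd_full [measurable]: "snd \<in> borel_measurable full_space"
  unfolding full_space_def by measurable

lemma measurable_Xv [measurable]: "Xv \<in> borel_measurable full_space"
proof -
  have eq: "Xv = (\<lambda>w. fst (snd w))" by (auto simp: Xv_def)
  show ?thesis unfolding eq full_space_def borel_prod[symmetric] by measurable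
qed

lemma measurable_Yv [measurable]: "Yv \<in> borel_measurable full_space"
proof -
  have eq: "Yv = (\<lambda>w. fst (snd (snd w)))" by (auto simp: Yv_def)
  show ?thesis unfolding eq full_space_def borel_prod[symmetric] by measurable
qed

lemma measurable_Zv [measurable]: "Zv \<in> borel_measurable full_space"
proof -
  have eq: "Zv = (\<lambda>w. snd (snd (snd w)))" by (auto simp: Zv_def)
  show ?thesis unfolding eq full_space_def borel_prod[symmetric] by measurable
qed

lemma measurable_XYv [measurable]: "XYv \<in> borel_measurable full_space"
  unfolding XYv_def[abs_def] by measurable

lemma measurable_XZv [measurable]: "XZv \<in> borel_measurable full_space"
  unfolding XZv_def[abs_def] by measurable

lemma measurable_full_tuple:
  assumes "a \<in> measurable N (count_space UNIV)" "b \<in> borel_measurable N"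
    "c \<in> borel_measurable N" "e \<in> borel_measurable N"
  shows "(\<lambda>w. (a w, b w, c w, e w)) \<in> measurable N full_space"
  using assms unfolding full_space_def by measurable

lemma measurable_obs [measurable]: "obs \<in> measurable full_space full_space"
  unfolding obs_def[abs_def] by (intro measurable_full_tuple) measurable

lemma sig_measurable_comp: "f \<in> borel_measurable borel \<Longrightarrow> (\<lambda>w. f (V w)) \<in> borel_measurable (sig V)"
  by (rule measurable_compose[OF measurable_vimage_algebra1]) auto

text \<open>The preimage of a point is a preimage under \<open>V\<close>. This replaces a factorisation of \<open>f\<close> through \<open>V\<close>.\<close>

lemma sig_measurable_const_on_fibres:
  fixes f :: "'d::finite full \<Rightarrow> 'c::t1_space"
  assumes f: "f \<in> borel_measurable (sig V)" and V: "V w = V w'"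
  shows "f w = f w'"
proof -
  have "f -` {f w} \<inter> space (sig V) \<in> sets (sig V)"
    using f by (rule measurable_sets) simp
  then obtain B where B: "f -` {f w} = V -` B" by (auto simp: sets_vimage_algebra2)
  have "w \<in> f -` {f w}" by simp
  then have "w' \<in> f -` {f w}" using V unfolding B by simp
  then show ?thesis by simp
qed

locale full_law = prob_space Q for Q :: "('d::finite) full measure" +
  assumes sets_Q [measurable_cong]: "sets Q = sets full_space"
begin

lemma space_Q [simp]: "space Q = UNIV"
  using sets_eq_imp_space_eq[OF sets_Q] by simp

lemma prob_UNIV [simp]: "prob UNIV = 1"
  using prob_space by simp

lemma measurable_Q: "measurable Q N = measurable full_space N"
  by (rule measurable_cong_sets[OF sets_Q refl])

lemma subalgebra_sig:
  assumes "V \<in> borel_measurable full_space"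
  shows "subalgebra Q (sig V)"
proof -
  have "V -` B \<in> sets Q" if "B \<in> sets borel" for B
    using measurable_sets[of V Q borel B] assms that measurable_Q by simp
  then show ?thesis unfolding subalgebra_def by (auto simp: sets_vimage_algebra2)
qed

lemma sig_borel: "V \<in> borel_measurable full_space \<Longrightarrow> f \<in> measurable (sig V) N \<Longrightarrow> f \<in> measurable Q N"
  using measurable_from_subalg[OF subalgebra_sig] .

lemma sigma_finite_sig:
  assumes "V \<in> borel_measurable full_space"
  shows "sigma_finite_subalgebra Q (sig V)"
  by (intro finite_measure_subalgebra_is_sigma_finite finite_measure_subalgebra.intro
      finite_measure_subalgebra_axioms.intro subalgebra_sig assms finite_measure_axioms)

lemma cexp_eq: "cexp Q V g = real_cond_exp Q (sig V) g"
  by (simp add: cexp_def)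

lemma cexp_sig_measurable [measurable]: "cexp Q V g \<in> borel_measurable (sig V)"
  by (simp add: cexp_eq)

lemma cexp_measurable [measurable]: "cexp Q V g \<in> borel_measurable Q"
  by (simp add: cexp_eq)

text \<open>Nonnegative integrals are needed because the odds need not be integrable against the functions that
  they multiply.\<close>

lemma nn_integral_cexp:
  assumes V: "V \<in> borel_measurable full_space"
    and f: "f \<in> borel_measurable (sig V)"
    and g: "integrable Q g" "\<And>w. 0 \<le> g w"
  shows "(\<integral>\<^sup>+w. f w * ennreal (cexp Q V g w) \<partial>Q) = (\<integral>\<^sup>+w. f w * ennreal (g w) \<partial>Q)"
proof -
  interpret S: sigma_finite_subalgebra Q "sig V" by (rule sigma_finite_sig[OF V])
  have gm [measurable]: "g \<in> borel_measurable Q" using g by simp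
  have pos: "AE w in Q. 0 \<le> cexp Q V g w"
    unfolding cexp_eq using g by (intro S.real_cond_exp_pos) auto
  have "AE w in Q. ennreal (cexp Q V g w) = nn_cond_exp Q (sig V) (\<lambda>w. ennreal (g w)) w"
  proof (rule S.nn_cond_exp_charact)
    fix A assume A: "A \<in> sets (sig V)"
    then have A' [measurable]: "A \<in> sets Q" using subalgebra_sig[OF V] by (auto simp: subalgebra_def)
    have "(\<integral>\<^sup>+w\<in>A. ennreal (g w) \<partial>Q) = (\<integral>\<^sup>+w. ennreal (indicator A w * g w) \<partial>Q)"
      by (intro nn_integral_cong) (auto split: split_indicator)
    also have "\<dots> = ennreal (\<integral>w. indicator A w * g w \<partial>Q)"
      using g integrable_mult_indicator[OF A' g(1)]
      by (intro nn_integral_eq_integral) (auto split: split_indicator)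
    also have "(\<integral>w. indicator A w * g w \<partial>Q) = (\<integral>w. indicator A w * cexp Q V g w \<partial>Q)"
      using S.real_cond_exp_intA[OF g(1) A] by (simp add: set_lebesgue_integral_def cexp_eq)
    also have "ennreal \<dots> = (\<integral>\<^sup>+w. ennreal (indicator A w * cexp Q V g w) \<partial>Q)"
      using pos integrable_mult_indicator[OF A' S.real_cond_exp_int(1)[OF g(1)]]
      by (intro nn_integral_eq_integral[symmetric]) (auto split: split_indicator simp: cexp_eq)
    also have "\<dots> = (\<integral>\<^sup>+w\<in>A. ennreal (cexp Q V g w) \<partial>Q)"
      by (intro nn_integral_cong) (auto split: split_indicator)
    finally show "(\<integral>\<^sup>+w\<in>A. ennreal (g w) \<partial>Q) = (\<integral>\<^sup>+w\<in>A. ennreal (cexp Q V g w) \<partial>Q)" .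
  qed measurable
  then have "(\<integral>\<^sup>+w. f w * ennreal (cexp Q V g w) \<partial>Q)
      = (\<integral>\<^sup>+w. f w * nn_cond_exp Q (sig V) (\<lambda>w. ennreal (g w)) w \<partial>Q)"
    by (intro nn_integral_cong_AE) auto
  also have "\<dots> = (\<integral>\<^sup>+w. f w * ennreal (g w) \<partial>Q)"
    by (rule S.nn_cond_exp_intg[OF f]) measurable
  finally show ?thesis .
qed

lemma cexp_compl:
  assumes V: "V \<in> borel_measurable full_space"
  shows "AE w in Q. cexp Q V (\<lambda>w. of_bool (\<not> Rv w)) w = 1 - propensity Q V w"
proof -
  interpret S: sigma_finite_subalgebra Q "sig V" by (rule sigma_finite_sig[OF V])
  have i: "integrable Q (\<lambda>w. of_bool (Rv w) :: real)"
    by (rule integrable_const_bound[where B = 1]) auto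
  have eq: "(\<lambda>w. of_bool (\<not> Rv w)) = (\<lambda>w. 1 - of_bool (Rv w) :: real)" by (auto simp: of_bool_def)
  have "AE w in Q. real_cond_exp Q (sig V) (\<lambda>w. 1 - of_bool (Rv w)) w
      = real_cond_exp Q (sig V) (\<lambda>_. 1) w - real_cond_exp Q (sig V) (\<lambda>w. of_bool (Rv w)) w"
    by (rule S.real_cond_exp_diff[OF _ i]) simp
  moreover have "AE w in Q. real_cond_exp Q (sig V) (\<lambda>_. 1) w = 1"
    by (rule S.real_cond_exp_F_meas) auto
  ultimately show ?thesis
    unfolding propensity_def cexp_eq eq by eventually_elim simp
qed

lemma odds_sig_measurable [measurable]: "odds Q V \<in> borel_measurable (sig V)"
  unfolding odds_def[abs_def] propensity_def by measurable

lemma odds_measurable [measurable]: "odds Q V \<in> borel_measurable Q"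
  unfolding odds_def[abs_def] propensity_def by measurable

lemma integrable_of_bool [simp]: "Measurable.pred Q A \<Longrightarrow> integrable Q (\<lambda>w. of_bool (A w) :: real)"
  by (rule integrable_const_bound[where B = 1]) auto

lemma odds_nonneg:
  assumes V: "V \<in> borel_measurable full_space"
  shows "AE w in Q. 0 \<le> odds Q V w"
proof -
  interpret S: sigma_finite_subalgebra Q "sig V" by (rule sigma_finite_sig[OF V])
  have "AE w in Q. 0 \<le> cexp Q V (\<lambda>w. of_bool (Rv w)) w"
    "AE w in Q. 0 \<le> cexp Q V (\<lambda>w. of_bool (\<not> Rv w)) w"
    unfolding cexp_eq by (auto intro!: S.real_cond_exp_pos)
  then show ?thesis by eventually_elim (simp add: odds_def propensity_def)
qed

lemma odds_eq:
  assumes V: "V \<in> borel_measurable full_space"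
    and pos: "AE w in Q. propensity Q V w > 0"
  shows "AE w in Q. cexp Q V (\<lambda>w. of_bool (\<not> Rv w)) w = odds Q V w * propensity Q V w"
    "AE w in Q. odds Q V w = 1 / propensity Q V w - 1"
proof -
  show "AE w in Q. cexp Q V (\<lambda>w. of_bool (\<not> Rv w)) w = odds Q V w * propensity Q V w"
    using pos by eventually_elim (simp add: odds_def)
  show "AE w in Q. odds Q V w = 1 / propensity Q V w - 1"
    using pos cexp_compl[OF V] by eventually_elim (simp add: odds_def field_simps)
qed

text \<open>As $f(R=0\mid V)$ is the product of the odds and $f(R=1\mid V)$, integrals over the nonrespondents become
  integrals over the respondents.\<close>

lemma nn_integral_odds:
  assumes V: "V \<in> borel_measurable full_space"
    and pos: "AE w in Q. propensity Q V w > 0"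
    and f [measurable]: "f \<in> borel_measurable (sig V)"
  shows "(\<integral>\<^sup>+w. f w * ennreal (of_bool (\<not> Rv w)) \<partial>Q)
       = (\<integral>\<^sup>+w. f w * ennreal (odds Q V w) * ennreal (of_bool (Rv w)) \<partial>Q)"
proof -
  have [measurable]: "f \<in> borel_measurable Q" by (rule sig_borel[OF V f])
  have "(\<integral>\<^sup>+w. f w * ennreal (of_bool (\<not> Rv w)) \<partial>Q)
      = (\<integral>\<^sup>+w. f w * ennreal (cexp Q V (\<lambda>w. of_bool (\<not> Rv w)) w) \<partial>Q)"
    by (intro nn_integral_cexp[symmetric] V f) (auto intro!: integrable_of_bool)
  also have "\<dots> = (\<integral>\<^sup>+w. (f w * ennreal (odds Q V w)) * ennreal (propensity Q V w) \<partial>Q)"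
    using odds_eq(1)[OF V pos] pos odds_nonneg[OF V]
    by (intro nn_integral_cong_AE, eventually_elim) (simp add: ennreal_mult mult.assoc)
  also have "\<dots> = (\<integral>\<^sup>+w. (f w * ennreal (odds Q V w)) * ennreal (of_bool (Rv w)) \<partial>Q)"
    unfolding propensity_def
    by (intro nn_integral_cexp V) (auto intro!: integrable_of_bool)
  finally show ?thesis .
qed

lemma integral_odds:
  assumes V: "V \<in> borel_measurable full_space"
    and pos: "AE w in Q. propensity Q V w > 0"
    and f [measurable]: "f \<in> borel_measurable (sig V)"
    and i: "integrable Q (\<lambda>w. f w * of_bool (\<not> Rv w))"
  shows "integrable Q (\<lambda>w. f w * odds Q V w * of_bool (Rv w))"
    and "(\<integral>w. f w * odds Q V w * of_bool (Rv w) \<partial>Q) = (\<integral>w. f w * of_bool (\<not> Rv w) \<partial>Q)"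
proof -
  interpret S: sigma_finite_subalgebra Q "sig V" by (rule sigma_finite_sig[OF V])
  have fm [measurable]: "f \<in> borel_measurable Q" by (rule sig_borel[OF V f])
  have "(\<integral>\<^sup>+w. ennreal (norm (f w * odds Q V w * of_bool (Rv w))) \<partial>Q)
      = (\<integral>\<^sup>+w. ennreal \<bar>f w\<bar> * ennreal (odds Q V w) * ennreal (of_bool (Rv w)) \<partial>Q)"
    using odds_nonneg[OF V]
    by (intro nn_integral_cong_AE, eventually_elim) (simp add: ennreal_mult[symmetric] abs_mult)
  also have "\<dots> = (\<integral>\<^sup>+w. ennreal \<bar>f w\<bar> * ennreal (of_bool (\<not> Rv w)) \<partial>Q)"
    by (intro nn_integral_odds[symmetric] V pos) measurable
  also have "\<dots> = (\<integral>\<^sup>+w. ennreal (norm (f w * of_bool (\<not> Rv w))) \<partial>Q)"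
    by (intro nn_integral_cong) (simp add: ennreal_mult[symmetric] abs_mult)
  also have "\<dots> < \<infinity>" using i by (simp add: integrable_iff_bounded)
  finally show int: "integrable Q (\<lambda>w. f w * odds Q V w * of_bool (Rv w))"
    by (intro integrableI_bounded) auto
  have "(\<integral>w. f w * of_bool (\<not> Rv w) \<partial>Q) = (\<integral>w. f w * cexp Q V (\<lambda>w. of_bool (\<not> Rv w)) w \<partial>Q)"
    unfolding cexp_eq using i by (intro S.real_cond_exp_intg(2)[symmetric]) auto
  also have "\<dots> = (\<integral>w. (f w * odds Q V w) * propensity Q V w \<partial>Q)"
  proof (rule integral_cong_AE)
    show "AE w in Q. f w * cexp Q V (\<lambda>w. of_bool (\<not> Rv w)) w = (f w * odds Q V w) * propensity Q V w"
      using odds_eq(1)[OF V pos] by eventually_elim simp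
  qed (auto simp: propensity_def)
  also have "\<dots> = (\<integral>w. (f w * odds Q V w) * of_bool (Rv w) \<partial>Q)"
    unfolding propensity_def cexp_eq by (intro S.real_cond_exp_intg(2) int) auto
  finally show "(\<integral>w. f w * odds Q V w * of_bool (Rv w) \<partial>Q) = (\<integral>w. f w * of_bool (\<not> Rv w) \<partial>Q)" ..
qed

text \<open>This property is how the odds of a constructed law are found.\<close>

lemma odds_characterization:
  assumes V: "V \<in> borel_measurable full_space"
    and \<rho> [measurable]: "\<rho> \<in> borel_measurable (sig V)" and nonneg: "\<And>w. 0 \<le> \<rho> w"
    and char: "\<And>f. f \<in> borel_measurable (sig V) \<Longrightarrow>
      (\<integral>\<^sup>+w. f w * ennreal (of_bool (\<not> Rv w)) \<partial>Q)
       = (\<integral>\<^sup>+w. f w * ennreal (\<rho> w) * ennreal (of_bool (Rv w)) \<partial>Q)"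
  shows "AE w in Q. propensity Q V w > 0" "AE w in Q. odds Q V w = \<rho> w"
proof -
  interpret S: sigma_finite_subalgebra Q "sig V" by (rule sigma_finite_sig[OF V])
  have rho_Q [measurable]: "\<rho> \<in> borel_measurable Q" by (rule sig_borel[OF V \<rho>])
  have pos1: "0 < 1 + \<rho> w" for w using nonneg[of w] by linarith
  \<comment> \<open>The assumption at $f=1_A/(1+\rho)$ turns the integral of \<open>f\<close> into the probability of $A\cap\{R=1\}$.\<close>
  have propen: "AE w in Q. propensity Q V w = 1 / (1 + \<rho> w)"
    unfolding propensity_def cexp_eq
  proof (rule S.real_cond_exp_charact)
    show i: "integrable Q (\<lambda>w. 1 / (1 + \<rho> w))"
      by (rule integrable_const_bound[where B = 1]) (auto simp: field_simps nonneg pos1 abs_of_pos)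
    fix A assume A [measurable]: "A \<in> sets (sig V)"
    then have A' [measurable]: "A \<in> sets Q" using subalgebra_sig[OF V] by (auto simp: subalgebra_def)
    have "(\<integral>\<^sup>+w. ennreal (indicator A w * (1 / (1 + \<rho> w))) \<partial>Q)
        = (\<integral>\<^sup>+w. ennreal (indicator A w * (1 / (1 + \<rho> w))) * ennreal (of_bool (Rv w))
             + ennreal (indicator A w * (1 / (1 + \<rho> w))) * ennreal (of_bool (\<not> Rv w)) \<partial>Q)"
      by (intro nn_integral_cong) auto
    also have "\<dots> = (\<integral>\<^sup>+w. ennreal (indicator A w * (1 / (1 + \<rho> w))) * ennreal (of_bool (Rv w)) \<partial>Q)
        + (\<integral>\<^sup>+w. ennreal (indicator A w * (1 / (1 + \<rho> w))) * ennreal (of_bool (\<not> Rv w)) \<partial>Q)"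
      by (rule nn_integral_add) measurable
    also have "(\<integral>\<^sup>+w. ennreal (indicator A w * (1 / (1 + \<rho> w))) * ennreal (of_bool (\<not> Rv w)) \<partial>Q)
        = (\<integral>\<^sup>+w. ennreal (indicator A w * (1 / (1 + \<rho> w))) * ennreal (\<rho> w) * ennreal (of_bool (Rv w)) \<partial>Q)"
      by (rule char) measurable
    also have "(\<integral>\<^sup>+w. ennreal (indicator A w * (1 / (1 + \<rho> w))) * ennreal (of_bool (Rv w)) \<partial>Q) + \<dots>
        = (\<integral>\<^sup>+w. ennreal (indicator A w * (1 / (1 + \<rho> w))) * ennreal (of_bool (Rv w))
           + ennreal (indicator A w * (1 / (1 + \<rho> w))) * ennreal (\<rho> w) * ennreal (of_bool (Rv w)) \<partial>Q)"
      by (rule nn_integral_add[symmetric]) measurable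
    also have "\<dots> = (\<integral>\<^sup>+w. ennreal (indicator A w * of_bool (Rv w)) \<partial>Q)"
    proof (intro nn_integral_cong)
      fix w
      have "ennreal (1 / (1 + \<rho> w)) + ennreal (1 / (1 + \<rho> w)) * ennreal (\<rho> w)
          = ennreal (1 / (1 + \<rho> w) + 1 / (1 + \<rho> w) * \<rho> w)"
        using nonneg[of w] pos1[of w] by (simp add: ennreal_mult[symmetric] ennreal_plus[symmetric] del: ennreal_plus)
      also have "1 / (1 + \<rho> w) + 1 / (1 + \<rho> w) * \<rho> w = 1"
        using pos1[of w] by (simp add: field_simps)
      finally show "ennreal (indicator A w * (1 / (1 + \<rho> w))) * ennreal (of_bool (Rv w))
           + ennreal (indicator A w * (1 / (1 + \<rho> w))) * ennreal (\<rho> w) * ennreal (of_bool (Rv w))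
          = ennreal (indicator A w * of_bool (Rv w))"
        by (auto split: split_indicator)
    qed
    finally have "(\<integral>\<^sup>+w. ennreal (indicator A w * (1 / (1 + \<rho> w))) \<partial>Q)
        = (\<integral>\<^sup>+w. ennreal (indicator A w * of_bool (Rv w)) \<partial>Q)" .
    moreover have "(\<integral>\<^sup>+w. ennreal (indicator A w * (1 / (1 + \<rho> w))) \<partial>Q)
        = ennreal (\<integral>w. indicator A w * (1 / (1 + \<rho> w)) \<partial>Q)"
      using integrable_mult_indicator[OF A' i] nonneg pos1
      by (intro nn_integral_eq_integral) (auto intro!: AE_I2 simp: less_imp_le)
    moreover have "(\<integral>\<^sup>+w. ennreal (indicator A w * of_bool (Rv w)) \<partial>Q)
        = ennreal (\<integral>w. indicator A w * of_bool (Rv w) \<partial>Q)"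
    proof (intro nn_integral_eq_integral)
      show "integrable Q (\<lambda>w. indicator A w * of_bool (Rv w) :: real)"
        by (rule integrable_const_bound[where B = 1]) (auto split: split_indicator)
    qed auto
    moreover have "0 \<le> (\<integral>w. indicator A w * (1 / (1 + \<rho> w)) \<partial>Q)"
      using nonneg by (intro integral_nonneg_AE AE_I2) (auto split: split_indicator)
    moreover have "0 \<le> (\<integral>w. indicator A w * (of_bool (Rv w) :: real) \<partial>Q)"
      by (intro integral_nonneg_AE AE_I2) (auto split: split_indicator)
    ultimately have "(\<integral>w. indicator A w * (1 / (1 + \<rho> w)) \<partial>Q) = (\<integral>w. indicator A w * of_bool (Rv w) \<partial>Q)"
      by simp
    then show "set_lebesgue_integral Q A (\<lambda>w. of_bool (Rv w)) = set_lebesgue_integral Q A (\<lambda>w. 1 / (1 + \<rho> w))"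
      by (simp add: set_lebesgue_integral_def)
  qed (auto intro!: integrable_of_bool)
  show pos: "AE w in Q. propensity Q V w > 0"
    using propen by eventually_elim (simp add: pos1)
  show "AE w in Q. odds Q V w = \<rho> w"
    using propen odds_eq(2)[OF V pos] by eventually_elim simp
qed

end

lemma (in full_law) cexp_contraction:
  assumes V: "V \<in> borel_measurable full_space" and h: "sq_int Q h"
  shows "sq_int Q (cexp Q V h)" "l2_norm Q (cexp Q V h) \<le> l2_norm Q h"
proof -
  interpret S: sigma_finite_subalgebra Q "sig V" by (rule sigma_finite_sig[OF V])
  have i: "integrable Q h" "integrable Q (\<lambda>w. (h w)\<^sup>2)"
    using sq_int_integrable[OF h] h by (auto simp: sq_int_def)
  have jensen: "AE w in Q. (cexp Q V h w)\<^sup>2 \<le> cexp Q V (\<lambda>w. (h w)\<^sup>2) w"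
    unfolding cexp_eq
    by (rule S.real_cond_exp_jensens_inequality(2)[where I = UNIV and q = "\<lambda>x. x\<^sup>2"])
       (use i in \<open>auto intro: convex_power_even\<close>)
  have i2: "integrable Q (cexp Q V (\<lambda>w. (h w)\<^sup>2))"
    unfolding cexp_eq by (rule S.real_cond_exp_int(1)[OF i(2)])
  have i3: "integrable Q (\<lambda>w. (cexp Q V h w)\<^sup>2)"
  proof (rule Bochner_Integration.integrable_bound[OF i2])
    show "AE w in Q. norm ((cexp Q V h w)\<^sup>2) \<le> norm (cexp Q V (\<lambda>w. (h w)\<^sup>2) w)"
      using jensen by eventually_elim simp
  qed measurable
  then show "sq_int Q (cexp Q V h)" by (simp add: sq_int_def)
  have "(\<integral>w. (cexp Q V h w)\<^sup>2 \<partial>Q) \<le> (\<integral>w. cexp Q V (\<lambda>w. (h w)\<^sup>2) w \<partial>Q)"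
    by (rule integral_mono_AE[OF i3 i2 jensen])
  also have "\<dots> = (\<integral>w. (h w)\<^sup>2 \<partial>Q)" unfolding cexp_eq by (rule S.real_cond_exp_int(2)[OF i(2)])
  finally show "l2_norm Q (cexp Q V h) \<le> l2_norm Q h" by (simp add: l2_norm_def)
qed

lemma (in full_law) integrable_bounded:
  fixes f :: "'d full \<Rightarrow> real"
  assumes "f \<in> borel_measurable full_space" "\<And>w. \<bar>f w\<bar> \<le> c"
  shows "integrable Q f"
  by (rule integrable_const_bound[where B = c]) (use assms measurable_Q in auto)

lemma (in full_law) cexp_bounded:
  assumes V: "V \<in> borel_measurable full_space" and f: "f \<in> borel_measurable full_space" "\<And>w. \<bar>f w\<bar> \<le> c"
  shows "AE w in Q. \<bar>cexp Q V f w\<bar> \<le> c"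
proof -
  interpret S: sigma_finite_subalgebra Q "sig V" by (rule sigma_finite_sig[OF V])
  note i = integrable_bounded[OF f]
  have le: "f w \<le> c" "- c \<le> f w" for w using f(2)[of w] by auto
  have "AE w in Q. real_cond_exp Q (sig V) f w \<le> c" by (rule S.real_cond_exp_le_c[OF i]) (simp add: le)
  moreover have "AE w in Q. real_cond_exp Q (sig V) f w \<ge> - c" by (rule S.real_cond_exp_ge_c[OF i]) (simp add: le)
  ultimately show ?thesis unfolding cexp_eq by eventually_elim auto
qed

section \<open>Conditioning on response\<close>

context full_law
begin

definition resp :: real where
  "resp = prob {w. Rv w}"

lemma resp_set [measurable]: "{w. Rv w} \<in> sets Q"
  using measurable_sets[OF measurable_Rv, of "{True}"] by (simp add: sets_Q vimage_def)

lemma given_R1_eq: "given_R1 Q = uniform_measure Q {w. Rv w}"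
  by (simp add: given_R1_def)

lemma emeasure_resp: "emeasure Q {w. Rv w} = ennreal resp"
  by (simp add: resp_def emeasure_eq_measure)

lemma sets_given_R1 [measurable_cong]: "sets (given_R1 Q) = sets full_space"
  by (simp add: given_R1_eq sets_Q)

lemma measurable_given_R1: "measurable (given_R1 Q) N = measurable Q N"
  by (rule measurable_cong_sets) (simp_all add: sets_given_R1 sets_Q)

lemma nn_integral_given_R1:
  assumes "0 < resp" and f: "f \<in> borel_measurable Q"
  shows "(\<integral>\<^sup>+w. f w * ennreal (of_bool (Rv w)) \<partial>Q) = ennreal resp * (\<integral>\<^sup>+w. f w \<partial>given_R1 Q)"
proof -
  have "(\<integral>\<^sup>+w. f w * ennreal (of_bool (Rv w)) \<partial>Q) = (\<integral>\<^sup>+w. f w * indicator {w. Rv w} w \<partial>Q)"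
    by (intro nn_integral_cong) (auto split: split_indicator)
  then show ?thesis
    unfolding given_R1_eq nn_integral_uniform_measure[OF f resp_set] emeasure_resp
    using assms(1) by (simp add: ennreal_times_divide mult.commute[of "ennreal resp"] mult_divide_eq_ennreal)
qed

lemma full_law_given_R1:
  assumes "0 < resp"
  shows "full_law (given_R1 Q)"
proof -
  have "prob_space (given_R1 Q)"
    unfolding given_R1_eq using assms
    by (intro prob_space_uniform_measure) (auto simp: emeasure_resp)
  then show ?thesis by (intro full_law.intro full_law_axioms.intro sets_given_R1)
qed

lemma AE_given_R1:
  assumes "0 < resp"
  shows "(AE w in given_R1 Q. \<phi> w) \<longleftrightarrow> (AE w in Q. Rv w \<longrightarrow> \<phi> w)"
  unfolding given_R1_eq using assms
  by (subst AE_uniform_measure) (auto simp: emeasure_resp)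

lemma AE_given_R1_I:
  assumes "0 < resp" "AE w in Q. \<phi> w"
  shows "AE w in given_R1 Q. \<phi> w"
  unfolding AE_given_R1[OF assms(1)] using assms(2) by eventually_elim simp

lemma integral_given_R1:
  assumes "0 < resp" and f: "f \<in> borel_measurable Q"
  shows "integrable (given_R1 Q) f \<longleftrightarrow> integrable Q (\<lambda>w. f w * of_bool (Rv w))"
    and "(\<integral>w. f w * of_bool (Rv w) \<partial>Q) = resp * (\<integral>w. f w \<partial>given_R1 Q)"
proof -
  have eq: "given_R1 Q = density Q (\<lambda>w. ennreal (of_bool (Rv w) / resp))"
    unfolding given_R1_eq uniform_measure_def emeasure_resp using assms(1)
    by (intro arg_cong[where f = "density Q"] ext) (auto split: split_indicator simp: divide_ennreal ennreal_1[symmetric] simp del: ennreal_1)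
  have "integrable (given_R1 Q) f \<longleftrightarrow> integrable Q (\<lambda>w. (1 / resp) * (f w * of_bool (Rv w)))"
    unfolding eq using assms by (subst integrable_real_density) (auto simp: mult.commute)
  then show "integrable (given_R1 Q) f \<longleftrightarrow> integrable Q (\<lambda>w. f w * of_bool (Rv w))"
    using assms(1) by (simp only: integrable_mult_left_iff) simp
  have "(\<integral>w. f w \<partial>given_R1 Q) = (\<integral>w. (1 / resp) * (f w * of_bool (Rv w)) \<partial>Q)"
    unfolding eq using assms by (subst integral_real_density) (auto simp: mult.commute)
  then show "(\<integral>w. f w * of_bool (Rv w) \<partial>Q) = resp * (\<integral>w. f w \<partial>given_R1 Q)"
    using assms(1) by simp
qed

lemma resp_pos:
  assumes V: "V \<in> borel_measurable full_space" and pos: "AE w in Q. propensity Q V w > 0"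
  shows "0 < resp"
proof (rule ccontr)
  assume "\<not> 0 < resp"
  then have "resp = 0" by (simp add: resp_def order_antisym)
  then have "emeasure Q {w. Rv w} = 0" by (simp add: emeasure_resp)
  then have R: "AE w in Q. \<not> Rv w" by (intro AE_I[of _ _ "{w. Rv w}"]) auto
  have "(\<integral>\<^sup>+w. 1 * ennreal (propensity Q V w) \<partial>Q) = (\<integral>\<^sup>+w. 1 * ennreal (of_bool (Rv w)) \<partial>Q)"
    unfolding propensity_def by (intro nn_integral_cexp V integrable_of_bool) auto
  also have "\<dots> = (\<integral>\<^sup>+w. 0 \<partial>Q)" by (intro nn_integral_cong_AE, use R in eventually_elim) simp
  also have "\<dots> = 0" by simp
  finally have "AE w in Q. ennreal (propensity Q V w) = 0"
    by (subst (asm) nn_integral_0_iff_AE) (auto simp: propensity_def)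
  with pos have "AE w in Q. False" by eventually_elim (simp add: ennreal_eq_0_iff)
  then show False by simp
qed

text \<open>An event determined by \<open>V\<close> that is almost sure among respondents is almost sure, since every
  value of \<open>V\<close> has respondents.\<close>

lemma AE_of_AE_given_R1:
  assumes V: "V \<in> borel_measurable full_space" and pos: "AE w in Q. propensity Q V w > 0"
    and [measurable]: "Measurable.pred (sig V) \<phi>" and ae: "AE w in given_R1 Q. \<phi> w"
  shows "AE w in Q. \<phi> w"
proof -
  have R: "AE w in Q. Rv w \<longrightarrow> \<phi> w" using ae AE_given_R1[OF resp_pos[OF V pos]] by simp
  have \<phi>_Q [measurable]: "Measurable.pred Q \<phi>" by (rule sig_borel[OF V]) measurable
  have "(\<integral>\<^sup>+w. ennreal (of_bool (\<not> \<phi> w)) * ennreal (of_bool (\<not> Rv w)) \<partial>Q)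
      = (\<integral>\<^sup>+w. ennreal (of_bool (\<not> \<phi> w)) * ennreal (odds Q V w) * ennreal (of_bool (Rv w)) \<partial>Q)"
    by (intro nn_integral_odds V pos) measurable
  also have "\<dots> = (\<integral>\<^sup>+w. 0 \<partial>Q)" by (intro nn_integral_cong_AE, use R in eventually_elim) auto
  also have "\<dots> = 0" by simp
  finally have "AE w in Q. ennreal (of_bool (\<not> \<phi> w)) * ennreal (of_bool (\<not> Rv w)) = 0"
    by (subst (asm) nn_integral_0_iff_AE) auto
  with R show ?thesis by eventually_elim (auto split: if_splits simp: of_bool_def)
qed

text \<open>A sufficient condition for membership in the model that can be checked by integration. The same \<open>\<rho>\<close>
  appears for $(X,Y)$ and for $(X,Z)$, which is the restriction that defines the model.\<close>

lemma model_lawI: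
  assumes \<rho> [measurable]: "\<rho> \<in> borel_measurable (sig XYv)" and nonneg: "\<And>w. 0 \<le> \<rho> w"
    and XY: "\<And>f. f \<in> borel_measurable (sig XYv) \<Longrightarrow>
      (\<integral>\<^sup>+w. f w * ennreal (of_bool (\<not> Rv w)) \<partial>Q)
       = (\<integral>\<^sup>+w. f w * ennreal (\<rho> w) * ennreal (of_bool (Rv w)) \<partial>Q)"
    and XZ: "\<And>f. f \<in> borel_measurable (sig XZv) \<Longrightarrow>
      (\<integral>\<^sup>+w. f w * ennreal (of_bool (\<not> Rv w)) \<partial>Q)
       = (\<integral>\<^sup>+w. f w * ennreal (\<rho> w) * ennreal (of_bool (Rv w)) \<partial>Q)"
  shows "M_np Q" "AE w in Q. odds Q XYv w = \<rho> w"
proof -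
  note posXY = odds_characterization(1)[OF measurable_XYv \<rho> nonneg XY]
  show odds: "AE w in Q. odds Q XYv w = \<rho> w"
    by (rule odds_characterization(2)[OF measurable_XYv \<rho> nonneg XY])
  note p0 = resp_pos[OF measurable_XYv posXY]
  interpret G: full_law "given_R1 Q" by (rule full_law_given_R1[OF p0])
  have rho_Q [measurable]: "\<rho> \<in> borel_measurable Q" by (rule sig_borel[OF measurable_XYv \<rho>])
  have rho_G [measurable]: "\<rho> \<in> borel_measurable (given_R1 Q)" by (simp add: measurable_given_R1)
  have "ennreal resp * (\<integral>\<^sup>+w. ennreal (\<rho> w) \<partial>given_R1 Q)
      = (\<integral>\<^sup>+w. 1 * ennreal (\<rho> w) * ennreal (of_bool (Rv w)) \<partial>Q)"
    by (subst nn_integral_given_R1[OF p0, symmetric]) auto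
  also have "\<dots> = (\<integral>\<^sup>+w. 1 * ennreal (of_bool (\<not> Rv w)) \<partial>Q)" by (rule XY[symmetric]) simp
  also have "\<dots> \<le> (\<integral>\<^sup>+w. 1 \<partial>Q)" by (intro nn_integral_mono) (auto simp: of_bool_def)
  also have "\<dots> < \<infinity>" using emeasure_space_1 by simp
  finally have "(\<integral>\<^sup>+w. ennreal (\<rho> w) \<partial>given_R1 Q) < \<infinity>"
    using p0 by (auto simp: ennreal_mult_less_top)
  then have i: "integrable (given_R1 Q) \<rho>" using nonneg by (auto intro!: integrableI_nonneg)
  \<comment> \<open>The mean of \<open>\<rho>\<close> given $(X,Z)$ among the respondents satisfies the characterisation of the odds given $(X,Z)$.\<close>
  define B where "B w = max 0 (cexp (given_R1 Q) XZv \<rho> w)" for w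
  have B [measurable]: "B \<in> borel_measurable (sig XZv)" unfolding B_def by measurable
  have B_G [measurable]: "B \<in> borel_measurable (given_R1 Q)" by (rule G.sig_borel[OF measurable_XZv B])
  interpret S: sigma_finite_subalgebra "given_R1 Q" "sig XZv" by (rule G.sigma_finite_sig[OF measurable_XZv])
  have B_AE: "AE w in given_R1 Q. cexp (given_R1 Q) XZv \<rho> w = B w"
  proof -
    have "AE w in given_R1 Q. 0 \<le> cexp (given_R1 Q) XZv \<rho> w"
      unfolding G.cexp_eq using nonneg by (intro S.real_cond_exp_pos) auto
    then show ?thesis by eventually_elim (simp add: B_def)
  qed
  have charB: "(\<integral>\<^sup>+w. f w * ennreal (of_bool (\<not> Rv w)) \<partial>Q)
       = (\<integral>\<^sup>+w. f w * ennreal (B w) * ennreal (of_bool (Rv w)) \<partial>Q)"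
    if f [measurable]: "f \<in> borel_measurable (sig XZv)" for f
  proof -
    have fQ: "f \<in> borel_measurable Q" and BQ: "B \<in> borel_measurable Q"
      by (auto intro: sig_borel[OF measurable_XZv])
    have prod: "(\<lambda>w. f w * ennreal (\<rho> w)) \<in> borel_measurable Q"
      using fQ rho_Q by measurable
    have prodB: "(\<lambda>w. f w * ennreal (B w)) \<in> borel_measurable Q"
      using fQ BQ by measurable
    have "(\<integral>\<^sup>+w. f w * ennreal (of_bool (\<not> Rv w)) \<partial>Q)
        = (\<integral>\<^sup>+w. f w * ennreal (\<rho> w) * ennreal (of_bool (Rv w)) \<partial>Q)" by (rule XZ) measurable
    also have "\<dots> = ennreal resp * (\<integral>\<^sup>+w. f w * ennreal (\<rho> w) \<partial>given_R1 Q)"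
      by (rule nn_integral_given_R1[OF p0 prod])
    also have "(\<integral>\<^sup>+w. f w * ennreal (\<rho> w) \<partial>given_R1 Q)
        = (\<integral>\<^sup>+w. f w * ennreal (cexp (given_R1 Q) XZv \<rho> w) \<partial>given_R1 Q)"
      by (rule G.nn_integral_cexp[symmetric, OF measurable_XZv f i nonneg])
    also have "\<dots> = (\<integral>\<^sup>+w. f w * ennreal (B w) \<partial>given_R1 Q)"
      by (intro nn_integral_cong_AE, use B_AE in eventually_elim) simp
    also have "ennreal resp * \<dots> = (\<integral>\<^sup>+w. f w * ennreal (B w) * ennreal (of_bool (Rv w)) \<partial>Q)"
      by (rule nn_integral_given_R1[OF p0 prodB, symmetric])
    finally show ?thesis .
  qed
  have B0: "\<And>w. 0 \<le> B w" by (simp add: B_def)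
  note posXZ = odds_characterization(1)[OF measurable_XZv B B0 charB]
  have oddsXZ: "AE w in given_R1 Q. odds Q XZv w = B w"
    by (rule AE_given_R1_I[OF p0 odds_characterization(2)[OF measurable_XZv B B0 charB]])
  have "AE w in given_R1 Q. cexp (given_R1 Q) XZv (odds Q XYv) w = cexp (given_R1 Q) XZv \<rho> w"
    unfolding G.cexp_eq
    by (intro S.real_cond_exp_cong AE_given_R1_I[OF p0 odds]) (auto simp: measurable_given_R1)
  with B_AE oddsXZ
  have "AE w in given_R1 Q. cexp (given_R1 Q) XZv (odds Q XYv) w = odds Q XZv w"
    by eventually_elim simp
  then show "M_np Q"
    unfolding M_np_def using posXY posXZ prob_space_axioms sets_Q by auto
qed

end

section \<open>Laws assembled from respondents and nonrespondents\<close>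

text \<open>The reference measure \<open>G\<close> is copied into both strata. A density with respect to the law at hand would
  not do, since odds that vanish on part of the sample space have to be raised there.\<close>

definition stratified_law :: "('d::finite) full measure \<Rightarrow> ('d full \<Rightarrow> real) \<Rightarrow> ('d full \<Rightarrow> real) \<Rightarrow> 'd full measure"
  where "stratified_law G a b =
    distr (density (count_space UNIV \<Otimes>\<^sub>M G) (\<lambda>(r, w). ennreal (if r then a w else b w)))
      full_space (\<lambda>(r, w). (r, snd w))"

lemma Rv_pair [simp]: "Rv (r, v) = r"
  by (simp add: Rv_def split: prod.split)

lemma XYv_pair: "XYv (r, snd w) = XYv w" and XZv_pair: "XZv (r, snd w) = XZv w"
  by (auto simp: XYv_def XZv_def Xv_def Yv_def Zv_def split: prod.split)

lemma measurable_set_response [measurable]: "(\<lambda>w. (r, snd w)) \<in> measurable full_space full_space"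
  unfolding full_space_def by measurable

context full_law
begin

lemma nn_integral_stratified_law:
  assumes [measurable]: "a \<in> borel_measurable Q" "b \<in> borel_measurable Q" "f \<in> borel_measurable full_space"
  shows "(\<integral>\<^sup>+w. f w \<partial>stratified_law Q a b)
    = (\<integral>\<^sup>+w. ennreal (a w) * f (True, snd w) + ennreal (b w) * f (False, snd w) \<partial>Q)"
proof -
  have [measurable]: "(\<lambda>(r, w). (r, snd w)) \<in> measurable (count_space UNIV \<Otimes>\<^sub>M Q) full_space"
    unfolding full_space_def split_beta
    using measurable_snd_full measurable_Q by (intro measurable_Pair) (auto intro: measurable_compose[OF measurable_snd])
  have [measurable]: "(\<lambda>(r, w). ennreal (if r then a w else b w)) \<in> borel_measurable (count_space UNIV \<Otimes>\<^sub>M Q)"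
    by measurable
  have [measurable]: "(\<lambda>w. f (r, snd w)) \<in> borel_measurable Q" for r
    using measurable_compose[OF measurable_set_response assms(3)] measurable_Q by simp
  have "(\<integral>\<^sup>+w. f w \<partial>stratified_law Q a b)
      = (\<integral>\<^sup>+p. (case p of (r, w) \<Rightarrow> ennreal (if r then a w else b w)) * f (case p of (r, w) \<Rightarrow> (r, snd w))
           \<partial>(count_space UNIV \<Otimes>\<^sub>M Q))"
    unfolding stratified_law_def
    by (subst nn_integral_distr, simp, simp, subst nn_integral_density) auto
  also have "\<dots> = (\<integral>\<^sup>+r. \<integral>\<^sup>+w. ennreal (if r then a w else b w) * f (r, snd w) \<partial>Q \<partial>count_space UNIV)"
    by (subst nn_integral_fst[symmetric]) (auto simp: split_beta)
  also have "\<dots> = (\<integral>\<^sup>+w. ennreal (b w) * f (False, snd w) \<partial>Q) + (\<integral>\<^sup>+w. ennreal (a w) * f (True, snd w) \<partial>Q)"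
    by (subst nn_integral_count_space_finite) (auto simp: UNIV_bool)
  also have "\<dots> = (\<integral>\<^sup>+w. ennreal (a w) * f (True, snd w) + ennreal (b w) * f (False, snd w) \<partial>Q)"
    by (subst nn_integral_add) (auto simp: add.commute)
  finally show ?thesis .
qed

text \<open>If the ratio of the densities of the two strata depends on $(X,Y)$ alone, then $R$ is independent of \<open>Z\<close>
  given $(X,Y)$, which implies the restriction of the model.\<close>

lemma stratified_law_in_model:
  assumes [measurable]: "a \<in> borel_measurable Q" "b \<in> borel_measurable Q"
    and total: "(\<integral>\<^sup>+w. ennreal (a w) + ennreal (b w) \<partial>Q) = 1"
    and \<rho> [measurable]: "\<rho> \<in> borel_measurable (sig XYv)" and nonneg: "\<And>w. 0 \<le> \<rho> w"
    and b: "AE w in Q. b w = \<rho> w * a w" and a: "AE w in Q. 0 \<le> a w"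
  shows "full_law (stratified_law Q a b)" "M_np (stratified_law Q a b)"
    "AE w in stratified_law Q a b. odds (stratified_law Q a b) XYv w = \<rho> w"
proof -
  let ?L = "stratified_law Q a b"
  have sets_L: "sets ?L = sets full_space" by (simp add: stratified_law_def)
  have "emeasure ?L (space ?L) = (\<integral>\<^sup>+w. 1 \<partial>?L)" by simp
  also have "\<dots> = 1" using total by (subst nn_integral_stratified_law) auto
  finally have "prob_space ?L" by (intro prob_spaceI)
  then show L: "full_law ?L" by (intro full_law.intro full_law_axioms.intro sets_L)
  have rho_Q: "\<rho> \<in> borel_measurable Q" by (rule sig_borel[OF measurable_XYv \<rho>])
  then have rho_full [measurable]: "\<rho> \<in> borel_measurable full_space" by (simp add: measurable_Q)
  have char: "(\<integral>\<^sup>+w. f w * ennreal (of_bool (\<not> Rv w)) \<partial>?L)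
       = (\<integral>\<^sup>+w. f w * ennreal (\<rho> w) * ennreal (of_bool (Rv w)) \<partial>?L)"
    if V: "V \<in> borel_measurable full_space" and f: "f \<in> borel_measurable (sig V)"
      and fib: "\<And>r w. V (r, snd w) = V w" for V :: "'d full \<Rightarrow> (real ^ 'd) \<times> real" and f
  proof -
    have "f \<in> borel_measurable Q" by (rule sig_borel[OF V f])
    then have [measurable]: "f \<in> borel_measurable full_space" by (simp add: measurable_Q)
    have f_fib: "f (r, snd w) = f w" for r w
      by (rule sig_measurable_const_on_fibres[OF f fib])
    have rho_fib: "\<rho> (r, snd w) = \<rho> w" for r w
      by (rule sig_measurable_const_on_fibres[OF \<rho> XYv_pair])
    have "(\<integral>\<^sup>+w. f w * ennreal (of_bool (\<not> Rv w)) \<partial>?L) = (\<integral>\<^sup>+w. ennreal (b w) * f w \<partial>Q)"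
      by (subst nn_integral_stratified_law) (auto simp: f_fib)
    also have "\<dots> = (\<integral>\<^sup>+w. ennreal (a w) * (f w * ennreal (\<rho> w)) \<partial>Q)"
      by (intro nn_integral_cong_AE, use b a in eventually_elim) (simp add: ennreal_mult nonneg mult_ac)
    also have "\<dots> = (\<integral>\<^sup>+w. f w * ennreal (\<rho> w) * ennreal (of_bool (Rv w)) \<partial>?L)"
      by (subst nn_integral_stratified_law) (auto simp: f_fib rho_fib)
    finally show ?thesis .
  qed
  show "M_np ?L" "AE w in ?L. odds ?L XYv w = \<rho> w"
    by (rule full_law.model_lawI[OF L \<rho> nonneg]; erule char[rotated], simp_all add: XYv_pair XZv_pair)+
qed

end

section \<open>Observed data\<close>

text \<open>A right inverse of \<open>obs\<close>, up to the outcome of a nonrespondent, which it sets to $0$. Functions of the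
  observed data can thus be kept as functions on the full space.\<close>

definition unobs :: "('d::finite) obs \<Rightarrow> 'd full" where
  "unobs = (\<lambda>(r, x, z, y). (r, x, y, z))"

definition observable :: "('d::finite full \<Rightarrow> 'c) \<Rightarrow> bool" where
  "observable f \<longleftrightarrow> (\<forall>w. f (unobs (obs w)) = f w)"

lemma observableD: "observable f \<Longrightarrow> f (unobs (obs w)) = f w"
  by (simp only: observable_def)

lemma observableI:
  assumes "\<And>w. \<not> Rv w \<Longrightarrow> f (unobs (obs w)) = f w"
  shows "observable f"
  unfolding observable_def
proof
  fix w
  show "f (unobs (obs w)) = f w"
  proof (cases "Rv w")
    case True
    then have "unobs (obs w) = w"
      by (cases w) (simp add: unobs_def obs_def Rv_def Xv_def Yv_def Zv_def)
    then show ?thesis by simp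
  qed (rule assms)
qed

lemma unobs_obs_simps [simp]: "Rv (unobs (obs w)) = Rv w" "XZv (unobs (obs w)) = XZv w"
  by (cases w; simp add: unobs_def obs_def Rv_def XZv_def Xv_def Yv_def Zv_def)+

lemma measurable_unobs [measurable]: "unobs \<in> measurable full_space full_space"
proof -
  have eq: "unobs = (\<lambda>w. (Rv w, Xv w, Zv w, Yv w))"
    by (auto simp: unobs_def Rv_def Xv_def Yv_def Zv_def)
  show ?thesis unfolding eq by (intro measurable_full_tuple) measurable
qed

context full_law
begin

lemma sets_obs_law [measurable_cong]: "sets (obs_law Q) = sets full_space"
  by (simp add: obs_law_def)

lemma measurable_obs_Q [measurable]: "obs \<in> measurable Q full_space"
  by (simp add: measurable_Q)

lemma prob_space_obs_law: "prob_space (obs_law Q)"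
  unfolding obs_law_def by (rule prob_space_distr) measurable

lemma integral_obs_law:
  fixes f :: "'d obs \<Rightarrow> real"
  assumes "f \<in> borel_measurable full_space"
  shows "integrable (obs_law Q) f \<longleftrightarrow> integrable Q (\<lambda>w. f (obs w))"
    "(\<integral>w. f w \<partial>obs_law Q) = (\<integral>w. f (obs w) \<partial>Q)"
  unfolding obs_law_def using assms by (auto intro!: integrable_distr_eq integral_distr)

lemma nn_integral_obs_law:
  assumes "f \<in> borel_measurable full_space"
  shows "(\<integral>\<^sup>+w. f w \<partial>obs_law Q) = (\<integral>\<^sup>+w. f (obs w) \<partial>Q)"
  unfolding obs_law_def using assms by (intro nn_integral_distr) auto

lemma sq_int_obs_law:
  assumes "f \<in> borel_measurable full_space"
  shows "sq_int (obs_law Q) f \<longleftrightarrow> sq_int Q (\<lambda>w. f (obs w))"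
proof -
  have "f \<in> borel_measurable (obs_law Q)"
    using assms measurable_cong_sets[OF sets_obs_law refl] by auto
  then show ?thesis unfolding sq_int_def
    using assms integral_obs_law(1)[of "\<lambda>w. (f w)\<^sup>2"] by auto
qed

end

definition obs_density :: "('d::finite) full measure \<Rightarrow> 'd full measure \<Rightarrow> 'd full \<Rightarrow> real" where
  "obs_density P Q w = enn2real (RN_deriv (obs_law P) (obs_law Q) (obs w))"

lemma (in full_law) obs_density_measurable [measurable]: "obs_density Q N \<in> borel_measurable Q"
proof -
  have "RN_deriv (obs_law Q) (obs_law N) \<in> borel_measurable full_space"
    using borel_measurable_RN_deriv[of "obs_law Q" "obs_law N"] measurable_cong_sets[OF sets_obs_law refl] by auto
  from measurable_compose[OF measurable_obs_Q this] show ?thesis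
    unfolding obs_density_def[abs_def] by measurable
qed

text \<open>Domination is only assumed for the observed data, as the outcomes of the nonrespondents may follow any
  law.\<close>

locale dominated_law = P: full_law P + Q: full_law Q for P Q :: "('d::finite) full measure" +
  assumes ac: "absolutely_continuous (obs_law P) (obs_law Q)"
begin

lemma AE_observable:
  assumes "observable \<phi>" and [measurable]: "Measurable.pred full_space \<phi>" and "AE w in P. \<phi> w"
  shows "AE w in Q. \<phi> w"
proof -
  have "AE w in P. \<phi> (unobs (obs w))" using assms(3) by (simp only: observableD[OF assms(1)])
  then have "AE v in obs_law P. \<phi> (unobs v)"
    unfolding obs_law_def by (subst AE_distr_iff) measurable
  then have "AE v in obs_law Q. \<phi> (unobs v)"
    by (intro absolutely_continuous_AE[OF _ ac]) (simp_all add: P.sets_obs_law Q.sets_obs_law)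
  then have "AE w in Q. \<phi> (unobs (obs w))"
    unfolding obs_law_def by (rule AE_distrD[rotated]) measurable
  then show ?thesis by (simp only: observableD[OF assms(1)])
qed

lemma integral_observable:
  fixes f :: "'d full \<Rightarrow> real"
  assumes "observable f" and [measurable]: "f \<in> borel_measurable full_space"
  shows "integrable Q f \<longleftrightarrow> integrable P (\<lambda>w. obs_density P Q w * f w)"
    "(\<integral>w. f w \<partial>Q) = (\<integral>w. obs_density P Q w * f w \<partial>P)"
proof -
  interpret OP: prob_space "obs_law P" by (rule P.prob_space_obs_law)
  interpret OQ: prob_space "obs_law Q" by (rule Q.prob_space_obs_law)
  define q where "q v = enn2real (RN_deriv (obs_law P) (obs_law Q) v)" for v
  have RN [measurable]: "RN_deriv (obs_law P) (obs_law Q) \<in> borel_measurable full_space"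
    using borel_measurable_RN_deriv[of "obs_law P" "obs_law Q"] measurable_cong_sets[OF P.sets_obs_law refl] by auto
  have q [measurable]: "q \<in> borel_measurable full_space" unfolding q_def by measurable
  have fu [measurable]: "(\<lambda>v. f (unobs v)) \<in> borel_measurable full_space" by measurable
  have sets: "sets (obs_law Q) = sets (obs_law P)" by (simp add: P.sets_obs_law Q.sets_obs_law)
  have fin: "AE v in obs_law P. RN_deriv (obs_law P) (obs_law Q) v \<noteq> \<infinity>"
    by (rule OP.RN_deriv_finite[OF _ ac sets]) (rule OQ.sigma_finite_measure_axioms)
  have "obs_law Q = density (obs_law P) (RN_deriv (obs_law P) (obs_law Q))"
    by (rule OP.density_RN_deriv[OF ac sets, symmetric])
  also have "\<dots> = density (obs_law P) (\<lambda>v. ennreal (q v))"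
  proof (rule density_cong)
    show "AE v in obs_law P. RN_deriv (obs_law P) (obs_law Q) v = ennreal (q v)"
      using fin by eventually_elim (simp add: q_def less_top)
  qed measurable
  finally have dens: "obs_law Q = density (obs_law P) (\<lambda>v. ennreal (q v))" .
  have fobs: "f (unobs (obs w)) = f w" for w by (rule observableD[OF assms(1)])
  have pq: "q (obs w) = obs_density P Q w" for w by (simp add: q_def obs_density_def)
  have "integrable Q f \<longleftrightarrow> integrable (obs_law Q) (\<lambda>v. f (unobs v))"
    by (simp add: Q.integral_obs_law fobs)
  also have "\<dots> \<longleftrightarrow> integrable (obs_law P) (\<lambda>v. q v * f (unobs v))"
    unfolding dens by (subst integrable_real_density) (auto simp: q_def)
  also have "\<dots> \<longleftrightarrow> integrable P (\<lambda>w. obs_density P Q w * f w)"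
    by (subst P.integral_obs_law) (auto simp: fobs pq)
  finally show "integrable Q f \<longleftrightarrow> integrable P (\<lambda>w. obs_density P Q w * f w)" .
  have "(\<integral>w. f w \<partial>Q) = (\<integral>v. f (unobs v) \<partial>obs_law Q)"
    by (simp add: Q.integral_obs_law fobs)
  also have "\<dots> = (\<integral>v. q v * f (unobs v) \<partial>obs_law P)"
    unfolding dens by (subst integral_real_density) (auto simp: q_def)
  also have "\<dots> = (\<integral>w. obs_density P Q w * f w \<partial>P)"
    by (subst P.integral_obs_law) (auto simp: fobs pq)
  finally show "(\<integral>w. f w \<partial>Q) = (\<integral>w. obs_density P Q w * f w \<partial>P)" .
qed

end

section \<open>The target functional on the model\<close>

lemma model_lawD:
  assumes "M_np Q"
  shows "full_law Q" "AE w in Q. propensity Q XYv w > 0" "AE w in Q. propensity Q XZv w > 0"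
    "AE w in given_R1 Q. cexp (given_R1 Q) XZv (odds Q XYv) w = odds Q XZv w"
  using assms by (auto simp: M_np_def full_law_def full_law_axioms_def)

text \<open>The mean over the nonrespondents of $\tau(X,Y)$ is rewritten with the odds given $(X,Y)$; for a
  function of $(X,Z)$ the model restriction allows the same odds to be used.\<close>

lemma (in full_law) mu_representation:
  assumes M: "M_np Q" and [measurable]: "\<tau> \<in> borel_measurable borel" "\<delta> \<in> borel_measurable borel"
    and i: "integrable Q (\<lambda>w. \<tau> (XYv w))" and K: "\<And>v. \<bar>\<delta> v\<bar> \<le> K"
  defines "F \<equiv> \<lambda>w. of_bool (\<not> Rv w) * \<delta> (XZv w)
    + of_bool (Rv w) * (\<tau> (XYv w) + odds Q XYv w * (\<tau> (XYv w) - \<delta> (XZv w)))"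
  shows "integrable Q F" "mu \<tau> Q = (\<integral>w. F w \<partial>Q)"
proof -
  note D = model_lawD[OF M]
  note p0 = resp_pos[OF measurable_XYv D(2)]
  interpret G: full_law "given_R1 Q" by (rule full_law_given_R1[OF p0])
  interpret S: sigma_finite_subalgebra "given_R1 Q" "sig XZv" by (rule G.sigma_finite_sig[OF measurable_XZv])
  have \<delta>s [measurable]: "(\<lambda>w. \<delta> (XZv w)) \<in> borel_measurable (sig XZv)" by (rule sig_measurable_comp) simp
  have \<tau>s [measurable]: "(\<lambda>w. \<tau> (XYv w)) \<in> borel_measurable (sig XYv)" by (rule sig_measurable_comp) simp
  have \<delta>Q [measurable]: "(\<lambda>w. \<delta> (XZv w)) \<in> borel_measurable Q" by (rule sig_borel[OF measurable_XZv \<delta>s])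
  have \<tau>Q [measurable]: "(\<lambda>w. \<tau> (XYv w)) \<in> borel_measurable Q" by (rule sig_borel[OF measurable_XYv \<tau>s])
  have mG: "f \<in> borel_measurable (given_R1 Q)" if "f \<in> borel_measurable Q" for f :: "'d full \<Rightarrow> real"
    using that measurable_given_R1 by auto
  have mult_R: "integrable Q (\<lambda>w. f w * of_bool (A w))"
    if "integrable Q f" "Measurable.pred Q A" for f :: "'d full \<Rightarrow> real" and A
    by (rule Bochner_Integration.integrable_bound[OF that(1)]) (use that in \<open>auto simp: of_bool_def\<close>)
  note iT = integral_odds[OF measurable_XYv D(2) \<tau>s mult_R[OF i]]
  have iT0: "integrable Q (\<lambda>w. \<tau> (XYv w) * odds Q XYv w * of_bool (Rv w))"
    and T: "(\<integral>w. \<tau> (XYv w) * odds Q XYv w * of_bool (Rv w) \<partial>Q) = (\<integral>w. \<tau> (XYv w) * of_bool (\<not> Rv w) \<partial>Q)"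
    using iT by auto
  have id: "integrable Q (\<lambda>w. \<delta> (XZv w))"
    by (rule integrable_const_bound[where B = K]) (use K in auto)
  have "integrable Q (\<lambda>w. 1 * odds Q XYv w * of_bool (Rv w))"
    by (rule integral_odds(1)[OF measurable_XYv D(2)]) auto
  then have io: "integrable (given_R1 Q) (odds Q XYv)"
    by (subst integral_given_R1(1)[OF p0]) auto
  have ido: "integrable (given_R1 Q) (\<lambda>w. \<delta> (XZv w) * odds Q XYv w)"
  proof (rule Bochner_Integration.integrable_bound[OF integrable_mult_right[OF io, of K]])
    show "AE w in given_R1 Q. norm (\<delta> (XZv w) * odds Q XYv w) \<le> norm (K * odds Q XYv w)"
    proof (intro AE_I2)
      fix w
      show "norm (\<delta> (XZv w) * odds Q XYv w) \<le> norm (K * odds Q XYv w)"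
        using mult_right_mono[OF K[of "XZv w"] abs_ge_zero[of "odds Q XYv w"]] order_trans[OF abs_ge_zero K]
        by (simp add: abs_mult)
    qed
  qed (auto intro: mG)
  have iD: "integrable Q (\<lambda>w. \<delta> (XZv w) * odds Q XYv w * of_bool (Rv w))"
    using ido by (subst (asm) integral_given_R1(1)[OF p0]) auto
  have "(\<integral>w. \<delta> (XZv w) * of_bool (\<not> Rv w) \<partial>Q) = (\<integral>w. \<delta> (XZv w) * odds Q XZv w * of_bool (Rv w) \<partial>Q)"
    by (rule integral_odds(2)[symmetric, OF measurable_XZv D(3) \<delta>s mult_R[OF id]]) measurable
  also have "\<dots> = resp * (\<integral>w. \<delta> (XZv w) * odds Q XZv w \<partial>given_R1 Q)"
    by (rule integral_given_R1(2)[OF p0]) measurable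
  also have "(\<integral>w. \<delta> (XZv w) * odds Q XZv w \<partial>given_R1 Q)
      = (\<integral>w. \<delta> (XZv w) * cexp (given_R1 Q) XZv (odds Q XYv) w \<partial>given_R1 Q)"
    using D(4) by (intro integral_cong_AE) (auto intro!: mG)
  also have "\<dots> = (\<integral>w. \<delta> (XZv w) * odds Q XYv w \<partial>given_R1 Q)"
    unfolding G.cexp_eq by (rule S.real_cond_exp_intg(2)[OF ido \<delta>s]) (auto intro: mG)
  also have "resp * \<dots> = (\<integral>w. \<delta> (XZv w) * odds Q XYv w * of_bool (Rv w) \<partial>Q)"
    by (rule integral_given_R1(2)[symmetric, OF p0]) measurable
  finally have Dl: "(\<integral>w. \<delta> (XZv w) * of_bool (\<not> Rv w) \<partial>Q)
    = (\<integral>w. \<delta> (XZv w) * odds Q XYv w * of_bool (Rv w) \<partial>Q)" .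
  have F: "F = (\<lambda>w. (\<delta> (XZv w) * of_bool (\<not> Rv w) - \<delta> (XZv w) * odds Q XYv w * of_bool (Rv w))
    + (\<tau> (XYv w) * of_bool (Rv w) + \<tau> (XYv w) * odds Q XYv w * of_bool (Rv w)))"
    unfolding F_def by (auto simp: fun_eq_iff algebra_simps)
  have i1: "integrable Q (\<lambda>w. \<delta> (XZv w) * of_bool (\<not> Rv w))" by (rule mult_R[OF id]) measurable
  have i2: "integrable Q (\<lambda>w. \<tau> (XYv w) * of_bool (Rv w))" by (rule mult_R[OF i]) measurable
  have i3: "integrable Q (\<lambda>w. \<tau> (XYv w) * of_bool (\<not> Rv w))" by (rule mult_R[OF i]) measurable
  show "integrable Q F" unfolding F using i1 i2 iT0 iD by auto
  have "(\<integral>w. F w \<partial>Q) = (\<integral>w. \<tau> (XYv w) * of_bool (Rv w) \<partial>Q) + (\<integral>w. \<tau> (XYv w) * of_bool (\<not> Rv w) \<partial>Q)"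
    unfolding F using i1 i2 iT0 iD by (simp add: Dl T)
  also have "\<dots> = (\<integral>w. \<tau> (XYv w) * of_bool (Rv w) + \<tau> (XYv w) * of_bool (\<not> Rv w) \<partial>Q)"
    using i2 i3 by simp
  also have "\<dots> = mu \<tau> Q"
    unfolding mu_def by (intro Bochner_Integration.integral_cong) auto
  finally show "mu \<tau> Q = (\<integral>w. F w \<partial>Q)" ..
qed

section \<open>The derivative along a regular submodel\<close>

text \<open>\<open>\<gamma>\<close> is a version of the odds given $(X,Y)$ that is bounded everywhere, and \<open>\<delta>\<close> a bounded solution of the
  representer equation.\<close>

locale represented_model = full_law P for P :: "('d::finite) full measure" +
  fixes \<tau> \<delta> :: "(real ^ 'd) \<times> real \<Rightarrow> real" and \<gamma> :: "'d full \<Rightarrow> real" and K :: real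
  assumes model: "M_np P"
    and tau [measurable]: "\<tau> \<in> borel_measurable borel"
    and delta [measurable]: "\<delta> \<in> borel_measurable borel"
    and delta_bounded: "\<And>v. \<bar>\<delta> v\<bar> \<le> K"
    and gamma: "\<gamma> \<in> borel_measurable (sig XYv)"
    and gamma_nonneg: "\<And>w. 0 \<le> \<gamma> w" and gamma_le: "\<And>w. \<gamma> w \<le> K"
    and gamma_odds: "AE w in P. odds P XYv w = \<gamma> w"
    and representer: "AE w in given_R1 P. cexp (given_R1 P) XYv (\<lambda>w. \<delta> (XZv w)) w = \<tau> (XYv w)"
begin

abbreviation "G \<equiv> given_R1 P"

definition gap :: "'d full \<Rightarrow> real" where
  "gap w = \<tau> (XYv w) - \<delta> (XZv w)"

text \<open>The efficient influence function before centring at $\mu$.\<close>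

definition uncentred_infl :: "'d full \<Rightarrow> real" where
  "uncentred_infl w = of_bool (\<not> Rv w) * \<delta> (XZv w) + of_bool (Rv w) * (\<tau> (XYv w) + \<gamma> w * gap w)"

lemma K_nonneg: "0 \<le> K"
  using order_trans[OF abs_ge_zero delta_bounded] .

lemma resp_gt_0: "0 < resp"
  by (rule resp_pos[OF measurable_XYv model_lawD(2)[OF model]])

lemma full_law_G: "full_law G"
  by (rule full_law_given_R1[OF resp_gt_0])

sublocale G: full_law G
  by (rule full_law_G)

lemma to_G: "f \<in> borel_measurable full_space \<Longrightarrow> f \<in> borel_measurable G"
  using G.measurable_Q by auto

lemma to_P: "f \<in> borel_measurable full_space \<Longrightarrow> f \<in> borel_measurable P"
  using measurable_Q by auto

lemma sig_XY_full: "f \<in> measurable (sig XYv) N \<Longrightarrow> f \<in> measurable full_space N" for f :: "'d full \<Rightarrow> 'c"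
  using sig_borel[OF measurable_XYv] measurable_Q by blast

lemma sig_XZ_full: "f \<in> measurable (sig XZv) N \<Longrightarrow> f \<in> measurable full_space N" for f :: "'d full \<Rightarrow> 'c"
  using sig_borel[OF measurable_XZv] measurable_Q by blast

lemma gamma_full [measurable]: "\<gamma> \<in> borel_measurable full_space"
  by (rule sig_XY_full[OF gamma])

lemma gap_full [measurable]: "gap \<in> borel_measurable full_space"
  unfolding gap_def[abs_def] by measurable

lemma uncentred_infl_full [measurable]: "uncentred_infl \<in> borel_measurable full_space"
  unfolding uncentred_infl_def[abs_def] by measurable

lemma tau_bounded: "AE w in G. \<bar>\<tau> (XYv w)\<bar> \<le> K"
proof -
  have "AE w in G. \<bar>cexp G XYv (\<lambda>w. \<delta> (XZv w)) w\<bar> \<le> K"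
    by (rule G.cexp_bounded[OF measurable_XYv _ delta_bounded]) measurable
  then show ?thesis using representer by eventually_elim simp
qed

lemma gap_bounded: "AE w in G. \<bar>gap w\<bar> \<le> 2 * K"
  using tau_bounded
proof eventually_elim
  case (elim w)
  then show ?case using delta_bounded[of "XZv w"] unfolding gap_def by linarith
qed

text \<open>Since \<open>\<delta>\<close> represents \<open>\<tau>\<close>, the gap is orthogonal to every function of $(X,Y)$.\<close>

lemma gap_orthogonal:
  assumes F: "F \<in> borel_measurable (sig XYv)" and i: "integrable G (\<lambda>w. F w * gap w)"
  shows "(\<integral>w. F w * gap w \<partial>G) = 0"
proof -
  interpret S: sigma_finite_subalgebra G "sig XYv" by (rule G.sigma_finite_sig[OF measurable_XYv])
  have it: "integrable G (\<lambda>w. \<tau> (XYv w))"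
    by (rule G.integrable_const_bound[where B = K]) (use tau_bounded in \<open>auto intro: to_G\<close>)
  have id: "integrable G (\<lambda>w. \<delta> (XZv w))"
    by (rule G.integrable_const_bound[where B = K]) (auto simp: delta_bounded intro: to_G)
  have "AE w in G. real_cond_exp G (sig XYv) (\<lambda>w. \<tau> (XYv w) - \<delta> (XZv w)) w
      = real_cond_exp G (sig XYv) (\<lambda>w. \<tau> (XYv w)) w - real_cond_exp G (sig XYv) (\<lambda>w. \<delta> (XZv w)) w"
    by (rule S.real_cond_exp_diff[OF it id])
  moreover have "AE w in G. real_cond_exp G (sig XYv) (\<lambda>w. \<tau> (XYv w)) w = \<tau> (XYv w)"
    by (rule S.real_cond_exp_F_meas[OF it sig_measurable_comp[OF tau]])
  ultimately have zero: "AE w in G. real_cond_exp G (sig XYv) gap w = 0"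
    using representer unfolding G.cexp_eq gap_def[abs_def] by eventually_elim simp
  have "(\<integral>w. F w * gap w \<partial>G) = (\<integral>w. F w * real_cond_exp G (sig XYv) gap w \<partial>G)"
    by (rule S.real_cond_exp_intg(2)[symmetric, OF i F to_G[OF gap_full]])
  also have "\<dots> = 0"
    by (rule integral_eq_zero_AE) (use zero in eventually_elim, simp)
  finally show ?thesis .
qed

lemma uncentred_infl_bounded: "AE w in P. \<bar>uncentred_infl w\<bar> \<le> K + K * (2 * K)"
proof -
  have "AE w in P. Rv w \<longrightarrow> \<bar>\<tau> (XYv w)\<bar> \<le> K" "AE w in P. Rv w \<longrightarrow> \<bar>gap w\<bar> \<le> 2 * K"
    using tau_bounded gap_bounded AE_given_R1[OF resp_gt_0] by auto
  then show ?thesis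
  proof eventually_elim
    case (elim w)
    show ?case
    proof (cases "Rv w")
      case True
      have "\<bar>\<gamma> w * gap w\<bar> \<le> K * (2 * K)"
        unfolding abs_mult using elim True gamma_nonneg[of w] gamma_le[of w] K_nonneg
        by (intro mult_mono) auto
      then show ?thesis using elim True unfolding uncentred_infl_def
        by simp
    next
      case False
      have "0 \<le> K * (2 * K)" using K_nonneg by simp
      then have "\<bar>\<delta> (XZv w)\<bar> \<le> K + K * (2 * K)" using delta_bounded[of "XZv w"] by linarith
      then show ?thesis using False unfolding uncentred_infl_def by simp
    qed
  qed
qed

lemma observable_uncentred_infl: "observable uncentred_infl"
  by (rule observableI) (simp add: uncentred_infl_def)

lemma mu_eq: 
  assumes "integrable P (\<lambda>w. \<tau> (XYv w))"
  shows "mu \<tau> P = (\<integral>w. uncentred_infl w \<partial>P)"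
proof -
  have "mu \<tau> P = (\<integral>w. of_bool (\<not> Rv w) * \<delta> (XZv w)
      + of_bool (Rv w) * (\<tau> (XYv w) + odds P XYv w * (\<tau> (XYv w) - \<delta> (XZv w))) \<partial>P)"
    by (rule mu_representation(2)[OF model tau delta assms delta_bounded])
  also have "\<dots> = (\<integral>w. uncentred_infl w \<partial>P)"
    unfolding uncentred_infl_def gap_def using gamma_odds
    by (intro integral_cong_AE) (auto intro!: to_P borel_measurable_times borel_measurable_add)
  finally show ?thesis .
qed

lemma l2_norm_G_le:
  assumes "sq_int P h"
  shows "sq_int G h" "l2_norm G h \<le> sqrt (1 / resp) * l2_norm P h"
proof -
  have hm: "h \<in> borel_measurable P" and i: "integrable P (\<lambda>w. (h w)\<^sup>2)"
    using assms by (auto simp: sq_int_def)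
  have iR: "integrable P (\<lambda>w. (h w)\<^sup>2 * of_bool (Rv w))"
    by (rule Bochner_Integration.integrable_bound[OF i]) (use hm in \<open>auto simp: of_bool_def\<close>)
  have hG: "h \<in> borel_measurable G" using hm measurable_given_R1 by auto
  have "integrable G (\<lambda>w. (h w)\<^sup>2)"
    using iR hm by (subst integral_given_R1(1)[OF resp_gt_0]) auto
  then show "sq_int G h" using hG by (simp add: sq_int_def)
  have "resp * (\<integral>w. (h w)\<^sup>2 \<partial>G) = (\<integral>w. (h w)\<^sup>2 * of_bool (Rv w) \<partial>P)"
    using hm by (subst integral_given_R1(2)[OF resp_gt_0]) auto
  also have "\<dots> \<le> (\<integral>w. (h w)\<^sup>2 \<partial>P)"
    by (intro integral_mono iR i) (auto simp: of_bool_def)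
  finally have "(\<integral>w. (h w)\<^sup>2 \<partial>G) \<le> (1 / resp) * (\<integral>w. (h w)\<^sup>2 \<partial>P)"
    using resp_gt_0 by (simp add: field_simps)
  then show "l2_norm G h \<le> sqrt (1 / resp) * l2_norm P h"
    unfolding l2_norm_def real_sqrt_mult[symmetric] by (rule real_sqrt_le_mono)
qed

text \<open>The remainder caused by the perturbation \<open>\<rho>\<close> of the odds. With $p$ the density of the observed
  data and $a=E(\sqrt p\mid R=1,X,Y)$, the gap annihilates $a^2\rho$, so that only
  $(p-a^2)\rho=(\sqrt p-a)(\sqrt p+a)\rho$ is left. The first factor is of the order of the
  parameter, and the second is bounded by the mean square of \<open>\<rho>\<close> under the perturbed law, by Jensen's
  inequality. Subtracting $\rho$ itself instead would need the mean square of \<open>\<rho>\<close> under \<open>P\<close>, about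
  which nothing is known.\<close>

lemma remainder_bound:
  assumes p [measurable]: "p \<in> borel_measurable G" and p0: "\<And>w. 0 \<le> p w"
    and r: "sq_int G (\<lambda>w. sqrt (p w) - 1)"
    and \<rho>: "\<rho> \<in> borel_measurable (sig XYv)"
    and pr: "sq_int G (\<lambda>w. sqrt (p w) * \<rho> w)"
  shows "\<bar>\<integral>w. p w * \<rho> w * gap w \<partial>G\<bar>
    \<le> 8 * K * l2_norm G (\<lambda>w. sqrt (p w) - 1) * l2_norm G (\<lambda>w. sqrt (p w) * \<rho> w)"
proof -
  interpret S: sigma_finite_subalgebra G "sig XYv" by (rule G.sigma_finite_sig[OF measurable_XYv])
  define s where "s w = sqrt (p w)" for w
  define a where "a = cexp G XYv s"
  have s_meas [measurable]: "s \<in> borel_measurable G" unfolding s_def by measurable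
  have a_sig: "a \<in> borel_measurable (sig XYv)" unfolding a_def by measurable
  have a_meas [measurable]: "a \<in> borel_measurable G" unfolding a_def by measurable
  have rho_meas [measurable]: "\<rho> \<in> borel_measurable G" by (rule to_G[OF sig_XY_full[OF \<rho>]])
  have gap_meas [measurable]: "gap \<in> borel_measurable G" by (rule to_G) measurable
  have one: "sq_int G (\<lambda>_. 1)" by (rule G.sq_int_bounded[where K = 1]) auto
  have r': "sq_int G (\<lambda>w. s w - 1)" using r by (simp add: s_def)
  have ss: "sq_int G s" using sq_int_add[OF r' one] by simp
  have is1: "integrable G s" by (rule G.sq_int_integrable[OF ss])
  have a_minus: "AE w in G. cexp G XYv (\<lambda>w. s w - 1) w = a w - 1"
  proof -
    have "AE w in G. real_cond_exp G (sig XYv) (\<lambda>w. s w - 1) w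
        = real_cond_exp G (sig XYv) s w - real_cond_exp G (sig XYv) (\<lambda>_. 1) w"
      by (rule S.real_cond_exp_diff[OF is1]) simp
    moreover have "AE w in G. real_cond_exp G (sig XYv) (\<lambda>_. 1) w = 1"
      by (rule S.real_cond_exp_F_meas) auto
    ultimately show ?thesis unfolding a_def G.cexp_eq by eventually_elim simp
  qed
  have a1: "sq_int G (\<lambda>w. a w - 1)" and a1_le: "l2_norm G (\<lambda>w. a w - 1) \<le> l2_norm G (\<lambda>w. s w - 1)"
  proof -
    note c = G.cexp_contraction[OF measurable_XYv r']
    have eq: "(\<integral>w. (cexp G XYv (\<lambda>w. s w - 1) w)\<^sup>2 \<partial>G) = (\<integral>w. (a w - 1)\<^sup>2 \<partial>G)"
      by (rule integral_cong_AE) (use a_minus in auto)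
    have "integrable G (\<lambda>w. (cexp G XYv (\<lambda>w. s w - 1) w)\<^sup>2) \<longleftrightarrow> integrable G (\<lambda>w. (a w - 1)\<^sup>2)"
      by (rule integrable_cong_AE) (use a_minus in auto)
    then show "sq_int G (\<lambda>w. a w - 1)" using c(1) by (auto simp: sq_int_def)
    show "l2_norm G (\<lambda>w. a w - 1) \<le> l2_norm G (\<lambda>w. s w - 1)" using c(2) eq by (simp add: l2_norm_def)
  qed
  have sa: "sq_int G a" using sq_int_add[OF a1 one] by simp
  have sma: "sq_int G (\<lambda>w. s w - a w)" by (rule sq_int_diff[OF ss sa])
  have sma_le: "l2_norm G (\<lambda>w. s w - a w) \<le> 2 * l2_norm G (\<lambda>w. s w - 1)"
    using l2_norm_triangle_diff[OF r' a1] a1_le by simp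
  have sr: "sq_int G (\<lambda>w. s w * \<rho> w)" using pr by (simp add: s_def)
  have ar: "sq_int G (\<lambda>w. a w * \<rho> w)" and ar_le: "l2_norm G (\<lambda>w. a w * \<rho> w) \<le> l2_norm G (\<lambda>w. s w * \<rho> w)"
  proof -
    note c = G.cexp_contraction[OF measurable_XYv sr]
    have "integrable G (\<lambda>w. \<rho> w * s w)" using G.sq_int_integrable[OF sr] by (simp add: mult.commute)
    then have "AE w in G. real_cond_exp G (sig XYv) (\<lambda>w. \<rho> w * s w) w = \<rho> w * real_cond_exp G (sig XYv) s w"
      by (intro S.real_cond_exp_mult \<rho>) auto
    then have ae: "AE w in G. cexp G XYv (\<lambda>w. s w * \<rho> w) w = a w * \<rho> w"
      unfolding a_def G.cexp_eq by (simp add: mult.commute)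
    have eq: "(\<integral>w. (cexp G XYv (\<lambda>w. s w * \<rho> w) w)\<^sup>2 \<partial>G) = (\<integral>w. (a w * \<rho> w)\<^sup>2 \<partial>G)"
      by (rule integral_cong_AE) (use ae in auto)
    have "integrable G (\<lambda>w. (cexp G XYv (\<lambda>w. s w * \<rho> w) w)\<^sup>2) \<longleftrightarrow> integrable G (\<lambda>w. (a w * \<rho> w)\<^sup>2)"
      by (rule integrable_cong_AE) (use ae in auto)
    then show "sq_int G (\<lambda>w. a w * \<rho> w)" using c(1) by (auto simp: sq_int_def)
    show "l2_norm G (\<lambda>w. a w * \<rho> w) \<le> l2_norm G (\<lambda>w. s w * \<rho> w)" using c(2) eq by (simp add: l2_norm_def)
  qed
  have K2: "0 \<le> 2 * K" using K_nonneg by simp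
  have sg: "sq_int G (\<lambda>w. (s w * \<rho> w + a w * \<rho> w) * gap w)"
    and sg_le: "l2_norm G (\<lambda>w. (s w * \<rho> w + a w * \<rho> w) * gap w)
      \<le> 2 * K * l2_norm G (\<lambda>w. s w * \<rho> w + a w * \<rho> w)"
    by (rule sq_int_mult_bounded[OF sq_int_add[OF sr ar] gap_meas gap_bounded K2])+
  have "integrable G (\<lambda>w. a w * (a w * \<rho> w * gap w))"
    by (rule sq_int_mult_integrable[OF sa sq_int_mult_bounded(1)[OF ar gap_meas gap_bounded K2]])
  then have ia: "integrable G (\<lambda>w. (a w * a w * \<rho> w) * gap w)" by (simp add: mult.assoc)
  have "(\<lambda>w. a w * a w * \<rho> w) \<in> borel_measurable (sig XYv)" using a_sig \<rho> by measurable
  from gap_orthogonal[OF this ia] have zero: "(\<integral>w. (a w * a w * \<rho> w) * gap w \<partial>G) = 0" .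
  have "integrable G (\<lambda>w. s w * (s w * \<rho> w * gap w))"
    by (rule sq_int_mult_integrable[OF ss sq_int_mult_bounded(1)[OF sr gap_meas gap_bounded K2]])
  then have ip: "integrable G (\<lambda>w. s w * s w * \<rho> w * gap w)" by (simp add: mult.assoc)
  have "(\<integral>w. p w * \<rho> w * gap w \<partial>G) = (\<integral>w. s w * s w * \<rho> w * gap w \<partial>G) - (\<integral>w. (a w * a w * \<rho> w) * gap w \<partial>G)"
    unfolding zero by (simp add: s_def p0)
  also have "\<dots> = (\<integral>w. s w * s w * \<rho> w * gap w - (a w * a w * \<rho> w) * gap w \<partial>G)"
    by (rule Bochner_Integration.integral_diff[OF ip ia, symmetric])
  also have "\<dots> = (\<integral>w. (s w - a w) * ((s w * \<rho> w + a w * \<rho> w) * gap w) \<partial>G)"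
    by (intro Bochner_Integration.integral_cong) (auto simp: algebra_simps)
  finally have "\<bar>\<integral>w. p w * \<rho> w * gap w \<partial>G\<bar>
      \<le> l2_norm G (\<lambda>w. s w - a w) * l2_norm G (\<lambda>w. (s w * \<rho> w + a w * \<rho> w) * gap w)"
    using abs_integral_cauchy_schwarz[OF sma sg] by simp
  also have "\<dots> \<le> (2 * l2_norm G (\<lambda>w. s w - 1)) * (2 * K * (2 * l2_norm G (\<lambda>w. s w * \<rho> w)))"
  proof (intro mult_mono sma_le)
    have "2 * K * l2_norm G (\<lambda>w. s w * \<rho> w + a w * \<rho> w) \<le> 2 * K * (2 * l2_norm G (\<lambda>w. s w * \<rho> w))"
      using l2_norm_triangle[OF sr ar] ar_le by (intro mult_left_mono K2) linarith
    then show "l2_norm G (\<lambda>w. (s w * \<rho> w + a w * \<rho> w) * gap w) \<le> 2 * K * (2 * l2_norm G (\<lambda>w. s w * \<rho> w))"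
      using sg_le by linarith
  qed auto
  also have "\<dots> = 8 * K * l2_norm G (\<lambda>w. sqrt (p w) - 1) * l2_norm G (\<lambda>w. sqrt (p w) * \<rho> w)"
    by (simp add: s_def)
  finally show ?thesis .
qed

text \<open>The mean of the influence function under the other law accounts for $\mu$ up to a multiple of the product of the
  Hellinger distance of the observed data and the distance of the odds.\<close>

lemma mu_along_submodel:
  assumes M: "M_np Q" and i: "integrable Q (\<lambda>w. \<tau> (XYv w))"
    and ac: "absolutely_continuous (obs_law P) (obs_law Q)"
    and r: "sq_int P (\<lambda>w. sqrt (obs_density P Q w) - 1)"
    and fin: "(\<integral>\<^sup>+w. ennreal (of_bool (Rv w) * (odds Q XYv w - odds P XYv w)\<^sup>2) \<partial>Q) < \<infinity>"
  shows "\<bar>mu \<tau> Q - (\<integral>w. obs_density P Q w * uncentred_infl w \<partial>P)\<bar>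
    \<le> 8 * K * l2_norm P (\<lambda>w. sqrt (obs_density P Q w) - 1)
      * sqrt (enn2real (\<integral>\<^sup>+w. ennreal (of_bool (Rv w) * (odds Q XYv w - odds P XYv w)\<^sup>2) \<partial>Q))"
proof -
  interpret Q: full_law Q by (rule model_lawD(1)[OF M])
  interpret D: dominated_law P Q
    by (intro dominated_law.intro dominated_law_axioms.intro full_law_axioms Q.full_law_axioms ac)
  define p where "p = obs_density P Q"
  define \<rho> where "\<rho> w = odds Q XYv w - \<gamma> w" for w
  have p0: "0 \<le> p w" for w by (simp add: p_def obs_density_def)
  have p_meas [measurable]: "p \<in> borel_measurable P" unfolding p_def by measurable
  have rho_sig: "\<rho> \<in> borel_measurable (sig XYv)" unfolding \<rho>_def using gamma by measurable
  have rho_full [measurable]: "\<rho> \<in> borel_measurable full_space" by (rule sig_XY_full[OF rho_sig])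
  have oddsP [measurable]: "odds P XYv \<in> borel_measurable full_space"
    using odds_measurable measurable_Q by auto
  have oddsQ [measurable]: "odds Q XYv \<in> borel_measurable full_space"
    using Q.odds_measurable Q.measurable_Q by auto
  have ae: "AE w in Q. Rv w \<longrightarrow> odds P XYv w = \<gamma> w"
  proof (rule D.AE_observable)
    show "observable (\<lambda>w. Rv w \<longrightarrow> odds P XYv w = \<gamma> w)" by (rule observableI) simp
    show "AE w in P. Rv w \<longrightarrow> odds P XYv w = \<gamma> w" using gamma_odds by eventually_elim simp
  qed measurable
  have N: "(\<integral>\<^sup>+w. ennreal (of_bool (Rv w) * (odds Q XYv w - odds P XYv w)\<^sup>2) \<partial>Q)
      = (\<integral>\<^sup>+w. ennreal (of_bool (Rv w) * (\<rho> w)\<^sup>2) \<partial>Q)"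
    by (intro nn_integral_cong_AE, use ae in eventually_elim) (auto simp: \<rho>_def)
  have toQ: "f \<in> borel_measurable full_space \<Longrightarrow> f \<in> borel_measurable Q" for f :: "'d full \<Rightarrow> real"
    using Q.measurable_Q by auto
  have iQ: "integrable Q (\<lambda>w. of_bool (Rv w) * (\<rho> w)\<^sup>2)"
  proof (rule integrableI_bounded)
    show "(\<lambda>w. of_bool (Rv w) * (\<rho> w)\<^sup>2) \<in> borel_measurable Q" by (rule toQ) measurable
    show "(\<integral>\<^sup>+w. ennreal (norm (of_bool (Rv w) * (\<rho> w)\<^sup>2)) \<partial>Q) < \<infinity>"
      using fin unfolding N by simp
  qed
  have Nreal: "enn2real (\<integral>\<^sup>+w. ennreal (of_bool (Rv w) * (\<rho> w)\<^sup>2) \<partial>Q) = (\<integral>w. of_bool (Rv w) * (\<rho> w)\<^sup>2 \<partial>Q)"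
    by (subst nn_integral_eq_integral[OF iQ]) auto
  have obs_rho: "observable (\<lambda>w. of_bool (Rv w) * (\<rho> w)\<^sup>2)" by (rule observableI) simp
  have iP: "integrable P (\<lambda>w. (p w * (\<rho> w)\<^sup>2) * of_bool (Rv w))"
    using D.integral_observable(1)[OF obs_rho] iQ by (simp add: p_def mult_ac)
  have [measurable]: "\<rho> \<in> borel_measurable P" by (rule to_P) measurable
  have pG: "p \<in> borel_measurable G" using p_meas measurable_given_R1 by auto
  have pr_int: "integrable G (\<lambda>w. p w * (\<rho> w)\<^sup>2)"
    using iP by (subst integral_given_R1(1)[OF resp_gt_0]) auto
  have pr_val: "resp * (\<integral>w. p w * (\<rho> w)\<^sup>2 \<partial>G) = (\<integral>w. of_bool (Rv w) * (\<rho> w)\<^sup>2 \<partial>Q)"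
    using D.integral_observable(2)[OF obs_rho] integral_given_R1(2)[OF resp_gt_0, of "\<lambda>w. p w * (\<rho> w)\<^sup>2"]
    by (simp add: p_def mult_ac)
  have rho_G: "\<rho> \<in> borel_measurable G" by (rule to_G) measurable
  have sq_eq: "(sqrt (p w) * \<rho> w)\<^sup>2 = p w * (\<rho> w)\<^sup>2" for w
    using p0[of w] by (simp add: power_mult_distrib)
  have pr: "sq_int G (\<lambda>w. sqrt (p w) * \<rho> w)"
    unfolding sq_int_def sq_eq using pr_int pG rho_G by auto
  have pr_norm: "l2_norm G (\<lambda>w. sqrt (p w) * \<rho> w) = sqrt (1 / resp) * sqrt (\<integral>w. of_bool (Rv w) * (\<rho> w)\<^sup>2 \<partial>Q)"
    unfolding l2_norm_def sq_eq pr_val[symmetric] real_sqrt_mult[symmetric] using resp_gt_0 by simp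
  have rP: "sq_int P (\<lambda>w. sqrt (p w) - 1)" using r by (simp add: p_def)
  note rG = l2_norm_G_le[OF rP]
  define F where "F w = of_bool (\<not> Rv w) * \<delta> (XZv w)
    + of_bool (Rv w) * (\<tau> (XYv w) + odds Q XYv w * (\<tau> (XYv w) - \<delta> (XZv w)))" for w
  have iF: "integrable Q F" and muF: "mu \<tau> Q = (\<integral>w. F w \<partial>Q)"
    using Q.mu_representation[OF M tau delta i delta_bounded] unfolding F_def[abs_def] by auto
  have iU: "integrable Q uncentred_infl"
  proof (rule Q.integrable_const_bound[OF _ toQ[OF uncentred_infl_full]])
    have "AE w in Q. \<bar>uncentred_infl w\<bar> \<le> K + K * (2 * K)"
    proof (rule D.AE_observable[OF _ _ uncentred_infl_bounded])
      show "observable (\<lambda>w. \<bar>uncentred_infl w\<bar> \<le> K + K * (2 * K))"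
        unfolding observable_def by (simp only: observableD[OF observable_uncentred_infl]) simp
    qed measurable
    then show "AE w in Q. norm (uncentred_infl w) \<le> K + K * (2 * K)" by simp
  qed
  have FU: "F w = uncentred_infl w + of_bool (Rv w) * (\<rho> w * gap w)" for w
    by (auto simp: F_def uncentred_infl_def gap_def \<rho>_def algebra_simps)
  have "integrable Q (\<lambda>w. F w - uncentred_infl w)" by (rule Bochner_Integration.integrable_diff[OF iF iU])
  then have iR: "integrable Q (\<lambda>w. of_bool (Rv w) * (\<rho> w * gap w))" by (simp add: FU)
  have obs_R: "observable (\<lambda>w. of_bool (Rv w) * (\<rho> w * gap w))" by (rule observableI) simp
  have gapP: "gap \<in> borel_measurable P" by (rule to_P) measurable
  have "mu \<tau> Q = (\<integral>w. uncentred_infl w \<partial>Q) + (\<integral>w. of_bool (Rv w) * (\<rho> w * gap w) \<partial>Q)"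
    unfolding muF FU by (rule Bochner_Integration.integral_add[OF iU iR])
  also have "(\<integral>w. uncentred_infl w \<partial>Q) = (\<integral>w. obs_density P Q w * uncentred_infl w \<partial>P)"
    by (rule D.integral_observable(2)[OF observable_uncentred_infl uncentred_infl_full])
  also have "(\<integral>w. of_bool (Rv w) * (\<rho> w * gap w) \<partial>Q) = (\<integral>w. (p w * \<rho> w * gap w) * of_bool (Rv w) \<partial>P)"
    using D.integral_observable(2)[OF obs_R] by (simp add: p_def mult_ac)
  also have "\<dots> = resp * (\<integral>w. p w * \<rho> w * gap w \<partial>G)"
    using gapP by (intro integral_given_R1(2)[OF resp_gt_0]) measurable
  finally have "\<bar>mu \<tau> Q - (\<integral>w. obs_density P Q w * uncentred_infl w \<partial>P)\<bar> = resp * \<bar>\<integral>w. p w * \<rho> w * gap w \<partial>G\<bar>"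
    using resp_gt_0 by (simp add: abs_mult)
  also have "\<dots> \<le> resp * (8 * K * l2_norm G (\<lambda>w. sqrt (p w) - 1) * l2_norm G (\<lambda>w. sqrt (p w) * \<rho> w))"
    using remainder_bound[OF pG p0 rG(1) rho_sig pr] resp_gt_0 by simp
  also have "\<dots> \<le> resp * (8 * K * (sqrt (1 / resp) * l2_norm P (\<lambda>w. sqrt (p w) - 1))
      * l2_norm G (\<lambda>w. sqrt (p w) * \<rho> w))"
    using resp_gt_0 K_nonneg rG(2) by (intro mult_left_mono mult_right_mono) auto
  also have "\<dots> = (resp * sqrt (1 / resp) * sqrt (1 / resp)) * (8 * K * l2_norm P (\<lambda>w. sqrt (p w) - 1)
      * sqrt (\<integral>w. of_bool (Rv w) * (\<rho> w)\<^sup>2 \<partial>Q))"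
    unfolding pr_norm by (simp only: mult_ac)
  also have "resp * sqrt (1 / resp) * sqrt (1 / resp) = 1"
    using resp_gt_0 by (simp add: mult.assoc)
  also have "1 * (8 * K * l2_norm P (\<lambda>w. sqrt (p w) - 1) * sqrt (\<integral>w. of_bool (Rv w) * (\<rho> w)\<^sup>2 \<partial>Q))
     = 8 * K * l2_norm P (\<lambda>w. sqrt (obs_density P Q w) - 1)
      * sqrt (enn2real (\<integral>\<^sup>+w. ennreal (of_bool (Rv w) * (odds Q XYv w - odds P XYv w)\<^sup>2) \<partial>Q))"
    unfolding N Nreal p_def by simp
  finally show ?thesis .
qed

text \<open>The existence of the derivative is a conclusion here, since the paths constructed below are only known to
  satisfy the other conditions.\<close>

lemma path_derivative:
  assumes Q0: "Q 0 = P" and Qt: "\<And>t. 0 \<le> t \<Longrightarrow> M_np (Q t)"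
    and Qi: "\<And>t. 0 \<le> t \<Longrightarrow> integrable (Q t) (\<lambda>w. \<tau> (XYv w))"
    and q: "qmd (obs_law P) (\<lambda>t. obs_law (Q t)) S"
    and lim: "((\<lambda>t. \<integral>\<^sup>+w. ennreal (of_bool (Rv w) * (odds (Q t) XYv w - odds P XYv w)\<^sup>2) \<partial>Q t) \<longlongrightarrow> 0) (at_right 0)"
  shows "sq_int P (\<lambda>w. S (obs w))" "(\<integral>w. S (obs w) \<partial>P) = 0"
    "((\<lambda>t. mu \<tau> (Q t)) has_real_derivative (\<integral>w. S (obs w) * (uncentred_infl w - mu \<tau> P) \<partial>P))
      (at 0 within {0..})"
proof -
  have ac: "absolutely_continuous (obs_law P) (obs_law (Q t))" if "0 \<le> t" for t
    using q that unfolding qmd_def by auto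
  have "S \<in> borel_measurable (obs_law P)" "integrable (obs_law P) (\<lambda>w. (S w)\<^sup>2)"
    and qlim: "((\<lambda>t. \<integral>\<^sup>+w. ennreal (((sqrt (enn2real (RN_deriv (obs_law P) (obs_law (Q t)) w)) - 1) / t - S w / 2)\<^sup>2) \<partial>obs_law P)
          \<longlongrightarrow> 0) (at_right 0)"
    using q unfolding qmd_def by auto
  then have S_obs: "sq_int (obs_law P) S" by (simp add: sq_int_def)
  have bm_eq: "borel_measurable (obs_law P) = borel_measurable full_space"
    by (rule measurable_cong_sets[OF sets_obs_law refl])
  have S_meas [measurable]: "S \<in> borel_measurable full_space" using S_obs by (simp add: sq_int_def bm_eq)
  show sqS: "sq_int P (\<lambda>w. S (obs w))" using S_obs sq_int_obs_law[OF S_meas] by simp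
  define p where "p t = obs_density P (Q t)" for t
  have "((\<lambda>t. \<integral>\<^sup>+w. ennreal (((sqrt (p t w) - 1) / t - S (obs w) / 2)\<^sup>2) \<partial>P) \<longlongrightarrow> 0) (at_right 0)"
  proof -
    have "(\<integral>\<^sup>+w. ennreal (((sqrt (p t w) - 1) / t - S (obs w) / 2)\<^sup>2) \<partial>P)
       = (\<integral>\<^sup>+w. ennreal (((sqrt (enn2real (RN_deriv (obs_law P) (obs_law (Q t)) w)) - 1) / t - S w / 2)\<^sup>2) \<partial>obs_law P)" for t
    proof -
      have [measurable]: "RN_deriv (obs_law P) (obs_law (Q t)) \<in> borel_measurable full_space"
        using borel_measurable_RN_deriv[of "obs_law P" "obs_law (Q t)"] bm_eq by auto
      show ?thesis by (subst nn_integral_obs_law) (simp_all add: p_def obs_density_def)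
    qed
    then show ?thesis using qlim by simp
  qed
  then interpret path: qmd_path P p "\<lambda>w. S (obs w)"
    by unfold_locales (auto simp: p_def obs_density_def[of P] sqS intro: obs_density_measurable)
  have pos: "\<forall>\<^sub>F t::real in at_right 0. 0 < t" by (simp add: eventually_at_right_less)
  have dom: "dominated_law P (Q t)" if "0 \<le> t" for t
    by (intro dominated_law.intro dominated_law_axioms.intro full_law_axioms model_lawD(1)[OF Qt] ac that)
  have "((\<lambda>t. ((\<integral>w. p t w * 1 \<partial>P) - (\<integral>w. 1 \<partial>P)) / t) \<longlongrightarrow> (\<integral>w. S (obs w) * 1 \<partial>P)) (at_right 0)"
    by (rule path.integral_derivative[where K = 1]) auto
  moreover have "\<forall>\<^sub>F t in at_right 0. ((\<integral>w. p t w * 1 \<partial>P) - (\<integral>w. 1 \<partial>P)) / t = 0"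
    using pos
  proof eventually_elim
    case (elim t)
    then interpret D: dominated_law P "Q t" by (intro dom) simp
    have "(\<integral>w. p t w * 1 \<partial>P) = (\<integral>w. 1 \<partial>Q t)"
      unfolding p_def by (rule D.integral_observable(2)[symmetric]) (auto simp: observable_def)
    then show ?case using D.Q.prob_space prob_space by simp
  qed
  ultimately have "((\<lambda>t::real. 0) \<longlongrightarrow> (\<integral>w. S (obs w) * 1 \<partial>P)) (at_right 0)"
    by (rule Lim_transform_eventually)
  then show mean: "(\<integral>w. S (obs w) \<partial>P) = 0"
    using tendsto_unique[OF trivial_limit_at_right_real _ tendsto_const] by fastforce
  define N where "N t = enn2real (\<integral>\<^sup>+w. ennreal (of_bool (Rv w) * (odds (Q t) XYv w - odds P XYv w)\<^sup>2) \<partial>Q t)" for t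
  define C where "C = 8 * K * (1 + l2_norm P (\<lambda>w. S (obs w)))"
  have "(N \<longlongrightarrow> enn2real 0) (at_right 0)"
    unfolding N_def using lim by (intro tendsto_enn2real) auto
  then have Nlim: "((\<lambda>t. C * sqrt (N t)) \<longlongrightarrow> C * sqrt 0) (at_right 0)"
    by (intro tendsto_intros) simp
  have fin: "\<forall>\<^sub>F t in at_right 0. (\<integral>\<^sup>+w. ennreal (of_bool (Rv w) * (odds (Q t) XYv w - odds P XYv w)\<^sup>2) \<partial>Q t) < 1"
    using order_tendstoD(2)[OF lim, of 1] by simp
  define r where "r t = (mu \<tau> (Q t) - (\<integral>w. p t w * uncentred_infl w \<partial>P)) / t" for t
  have "\<forall>\<^sub>F t in at_right 0. norm (r t) \<le> C * sqrt (N t)"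
    using pos fin path.root_bound
  proof eventually_elim
    case (elim t)
    have sq: "sq_int P (\<lambda>w. sqrt (obs_density P (Q t) w) - 1)"
      and le: "l2_norm P (\<lambda>w. sqrt (obs_density P (Q t) w) - 1) \<le> t * (1 + l2_norm P (\<lambda>w. S (obs w)))"
      using elim(3) by (auto simp: p_def)
    have t0: "0 \<le> t" using elim(1) by simp
    have finite: "(\<integral>\<^sup>+w. ennreal (of_bool (Rv w) * (odds (Q t) XYv w - odds P XYv w)\<^sup>2) \<partial>Q t) < \<infinity>"
      by (rule order.strict_trans[OF elim(2)]) simp
    have "\<bar>mu \<tau> (Q t) - (\<integral>w. p t w * uncentred_infl w \<partial>P)\<bar>
        \<le> 8 * K * l2_norm P (\<lambda>w. sqrt (obs_density P (Q t) w) - 1) * sqrt (N t)"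
      unfolding p_def N_def by (rule mu_along_submodel[OF Qt[OF t0] Qi[OF t0] ac[OF t0] sq finite])
    also have "\<dots> \<le> 8 * K * (t * (1 + l2_norm P (\<lambda>w. S (obs w)))) * sqrt (N t)"
      using K_nonneg by (intro mult_right_mono mult_left_mono le) (auto simp: N_def)
    finally show ?case using elim(1) by (simp add: r_def C_def field_simps)
  qed
  moreover have "((\<lambda>t. C * sqrt (N t)) \<longlongrightarrow> 0) (at_right 0)" using Nlim by simp
  ultimately have r0: "(r \<longlongrightarrow> 0) (at_right 0)" by (rule Lim_null_comparison)
  have U_P: "uncentred_infl \<in> borel_measurable P" by (rule to_P) measurable
  have "((\<lambda>t. ((\<integral>w. p t w * uncentred_infl w \<partial>P) - (\<integral>w. uncentred_infl w \<partial>P)) / t + r t)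
      \<longlongrightarrow> (\<integral>w. S (obs w) * uncentred_infl w \<partial>P) + 0) (at_right 0)"
    by (intro tendsto_add r0 path.integral_derivative[OF U_P uncentred_infl_bounded])
  moreover have "((\<integral>w. p t w * uncentred_infl w \<partial>P) - (\<integral>w. uncentred_infl w \<partial>P)) / t + r t
      = (mu \<tau> (Q t) - mu \<tau> (Q 0)) / (t - 0)" for t
    using mu_eq Qi[of 0] unfolding Q0 r_def by (simp add: diff_divide_distrib)
  ultimately have "((\<lambda>t. (mu \<tau> (Q t) - mu \<tau> (Q 0)) / (t - 0)) \<longlongrightarrow> (\<integral>w. S (obs w) * uncentred_infl w \<partial>P)) (at_right 0)"
    by simp
  then have der: "((\<lambda>t. mu \<tau> (Q t)) has_real_derivative (\<integral>w. S (obs w) * uncentred_infl w \<partial>P)) (at 0 within {0..})"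
    unfolding has_field_derivative_iff by (simp add: at_within_Ici_at_right)
  have iSU: "integrable P (\<lambda>w. S (obs w) * uncentred_infl w)"
    by (rule sq_int_mult_integrable[OF sqS sq_int_bounded[OF U_P uncentred_infl_bounded]])
  have "(\<integral>w. S (obs w) * (uncentred_infl w - mu \<tau> P) \<partial>P)
      = (\<integral>w. S (obs w) * uncentred_infl w - mu \<tau> P * S (obs w) \<partial>P)"
    by (simp add: algebra_simps)
  also have "\<dots> = (\<integral>w. S (obs w) * uncentred_infl w \<partial>P)"
    using iSU sq_int_integrable[OF sqS] by (simp add: mean)
  finally show "((\<lambda>t. mu \<tau> (Q t)) has_real_derivative (\<integral>w. S (obs w) * (uncentred_infl w - mu \<tau> P) \<partial>P))
      (at 0 within {0..})" using der by simp
qed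

text \<open>The influence function is a gradient.\<close>

theorem submodel_derivative:
  assumes sub: "regular_submodel \<tau> P Q S D"
  shows "sq_int P (\<lambda>w. S (obs w))" "(\<integral>w. S (obs w) \<partial>P) = 0"
    "D = (\<integral>w. S (obs w) * (uncentred_infl w - mu \<tau> P) \<partial>P)"
proof -
  note R = sub[unfolded regular_submodel_def]
  have D: "((\<lambda>t. (mu \<tau> (Q t) - mu \<tau> (Q 0)) / (t - 0)) \<longlongrightarrow> D) (at_right 0)"
    using conjunct2[OF conjunct2[OF conjunct2[OF conjunct2[OF R]]]]
    unfolding has_field_derivative_iff by (simp add: at_within_Ici_at_right)
  have Q0: "Q 0 = P" and q: "qmd (obs_law P) (\<lambda>t. obs_law (Q t)) S"
    and Qt: "M_np (Q t)" and Qi: "integrable (Q t) (\<lambda>w. \<tau> (XYv w))" if "0 \<le> t" for t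
    using R that by blast+
  have lim: "((\<lambda>t. \<integral>\<^sup>+w. ennreal (of_bool (Rv w) * (odds (Q t) XYv w - odds P XYv w)\<^sup>2) \<partial>Q t) \<longlongrightarrow> 0) (at_right 0)"
    using R by blast
  note p = path_derivative[OF Q0[OF order_refl] Qt Qi q[OF order_refl] lim]
  show "sq_int P (\<lambda>w. S (obs w))" by (rule p(1))
  show "(\<integral>w. S (obs w) \<partial>P) = 0" by (rule p(2))
  note p(3)
  then have "((\<lambda>t. (mu \<tau> (Q t) - mu \<tau> (Q 0)) / (t - 0))
      \<longlongrightarrow> (\<integral>w. S (obs w) * (uncentred_infl w - mu \<tau> P) \<partial>P)) (at_right 0)"
    unfolding has_field_derivative_iff by (simp add: at_within_Ici_at_right)
  with D show "D = (\<integral>w. S (obs w) * (uncentred_infl w - mu \<tau> P) \<partial>P)"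
    using tendsto_unique[OF trivial_limit_at_right_real] by blast
qed

end

section \<open>Linear paths\<close>

text \<open>The absolute difference is exactly $(\sqrt{1+x}-1)^2/2$, and $|\sqrt{1+x}-1|\le|x|$.\<close>

lemma sqrt_first_order:
  fixes x :: real
  assumes "- 1 \<le> x"
  shows "\<bar>sqrt (1 + x) - 1 - x / 2\<bar> \<le> x\<^sup>2 / 2"
proof -
  define s where "s = sqrt (1 + x)"
  have s0: "0 \<le> s" and ss: "s * s = 1 + x" using assms by (auto simp: s_def)
  have "(s - 1)\<^sup>2 = 2 + x - 2 * s" using ss by (simp add: power2_eq_square algebra_simps)
  then have eq: "s - 1 - x / 2 = - ((s - 1)\<^sup>2 / 2)" by linarith
  have "x = (s - 1) * (s + 1)" using ss by (simp add: algebra_simps)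
  then have "x\<^sup>2 = (s - 1)\<^sup>2 * (s + 1)\<^sup>2" by (simp add: power_mult_distrib)
  moreover have "(s - 1)\<^sup>2 * 1 \<le> (s - 1)\<^sup>2 * (s + 1)\<^sup>2"
    using s0 by (intro mult_left_mono) auto
  ultimately show ?thesis unfolding s_def[symmetric] eq by simp
qed

context represented_model
begin

lemma gamma_G [measurable]: "\<gamma> \<in> borel_measurable G"
  by (rule to_G) measurable

lemma gamma_integrable: "integrable G \<gamma>"
  by (rule G.integrable_const_bound[where B = K]) (auto simp: gamma_nonneg gamma_le)

text \<open>For functions of $(X,Z)$ the odds given $(X,Z)$ appear first, and the model restriction replaces them by
  \<open>\<gamma>\<close>.\<close>

lemma nonrespondents_nn_integral:
  assumes V: "V \<in> {XYv, XZv}" and f: "f \<in> borel_measurable (sig V)"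
  shows "(\<integral>\<^sup>+w. f w * ennreal (of_bool (\<not> Rv w)) \<partial>P) = ennreal resp * (\<integral>\<^sup>+w. f w * ennreal (\<gamma> w) \<partial>G)"
proof -
  note D = model_lawD[OF model]
  have Vm: "V \<in> borel_measurable full_space" and pos: "AE w in P. propensity P V w > 0"
    using V D by auto
  have fP: "f \<in> borel_measurable P" by (rule sig_borel[OF Vm f])
  have prod: "(\<lambda>w. f w * ennreal (odds P V w)) \<in> borel_measurable P"
    using fP by measurable
  have "(\<integral>\<^sup>+w. f w * ennreal (of_bool (\<not> Rv w)) \<partial>P) = ennreal resp * (\<integral>\<^sup>+w. f w * ennreal (odds P V w) \<partial>G)"
    unfolding nn_integral_odds[OF Vm pos f] by (rule nn_integral_given_R1[OF resp_gt_0 prod])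
  also have "(\<integral>\<^sup>+w. f w * ennreal (odds P V w) \<partial>G) = (\<integral>\<^sup>+w. f w * ennreal (\<gamma> w) \<partial>G)"
  proof (cases "V = XYv")
    case True
    have "AE w in G. odds P XYv w = \<gamma> w" by (rule AE_given_R1_I[OF resp_gt_0 gamma_odds])
    then show ?thesis unfolding True by (intro nn_integral_cong_AE) auto
  next
    case False
    then have VZ: "V = XZv" using V by auto
    interpret S: sigma_finite_subalgebra G "sig XZv" by (rule G.sigma_finite_sig[OF measurable_XZv])
    have "AE w in G. cexp G XZv (odds P XYv) w = cexp G XZv \<gamma> w"
      unfolding G.cexp_eq
      by (intro S.real_cond_exp_cong AE_given_R1_I[OF resp_gt_0 gamma_odds]) (auto simp: measurable_given_R1)
    then have "AE w in G. odds P XZv w = cexp G XZv \<gamma> w" using D(4) by eventually_elim simp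
    then have "(\<integral>\<^sup>+w. f w * ennreal (odds P V w) \<partial>G) = (\<integral>\<^sup>+w. f w * ennreal (cexp G XZv \<gamma> w) \<partial>G)"
      unfolding VZ by (intro nn_integral_cong_AE) auto
    also have "\<dots> = (\<integral>\<^sup>+w. f w * ennreal (\<gamma> w) \<partial>G)"
      using f unfolding VZ by (rule G.nn_integral_cexp[OF measurable_XZv _ gamma_integrable gamma_nonneg])
    finally show ?thesis .
  qed
  finally show ?thesis .
qed

lemma total_mass: "resp * (1 + (\<integral>w. \<gamma> w \<partial>G)) = 1"
proof -
  have "ennreal (resp * (\<integral>w. \<gamma> w \<partial>G)) = ennreal resp * (\<integral>\<^sup>+w. 1 * ennreal (\<gamma> w) \<partial>G)"
    using resp_gt_0 by (simp add: nn_integral_eq_integral[OF gamma_integrable] gamma_nonneg ennreal_mult)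
  also have "\<dots> = (\<integral>\<^sup>+w. 1 * ennreal (of_bool (\<not> Rv w)) \<partial>P)"
    by (rule nonrespondents_nn_integral[symmetric, of XYv]) auto
  also have "\<dots> = ennreal (\<integral>w. of_bool (\<not> Rv w) \<partial>P)"
    by (simp, intro nn_integral_eq_integral integrable_of_bool) auto
  finally have "resp * (\<integral>w. \<gamma> w \<partial>G) = (\<integral>w. of_bool (\<not> Rv w) \<partial>P)"
    using resp_gt_0 gamma_nonneg by simp
  moreover have "resp = (\<integral>w. of_bool (Rv w) \<partial>P)"
  proof -
    have "resp = (\<integral>w. indicator {w. Rv w} w \<partial>P)" by (simp add: resp_def)
    also have "\<dots> = (\<integral>w. of_bool (Rv w) \<partial>P)"
      by (intro Bochner_Integration.integral_cong) (auto split: split_indicator)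
    finally show ?thesis .
  qed
  ultimately have "resp * (1 + (\<integral>w. \<gamma> w \<partial>G)) = (\<integral>w. of_bool (Rv w) \<partial>P) + (\<integral>w. of_bool (\<not> Rv w) \<partial>P)"
    by (simp add: distrib_left)
  also have "\<dots> = (\<integral>w. of_bool (Rv w) + of_bool (\<not> Rv w) \<partial>P)"
    by (rule Bochner_Integration.integral_add[symmetric]; rule integrable_of_bool) measurable
  also have "(\<lambda>w. of_bool (Rv w) + of_bool (\<not> Rv w) :: real) = (\<lambda>_. 1)" by (auto simp: of_bool_def)
  finally show ?thesis by (simp add: prob_space)
qed

lemma AE_G_respondents: "AE w in G. Rv w"
  unfolding AE_given_R1[OF resp_gt_0] by simp

text \<open>The bound on \<open>\<tau>\<close> holds among the respondents of \<open>P\<close>, hence among those of a law with dominated observed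
  data, hence for all of that law, where every value of $(X,Y)$ has respondents.\<close>

lemma tau_integrable_dominated:
  assumes M: "M_np Q" and ac: "absolutely_continuous (obs_law P) (obs_law Q)"
  shows "integrable Q (\<lambda>w. \<tau> (XYv w))"
proof -
  interpret Q: full_law Q by (rule model_lawD(1)[OF M])
  interpret D: dominated_law P Q
    by (intro dominated_law.intro dominated_law_axioms.intro full_law_axioms Q.full_law_axioms ac)
  show ?thesis
  proof (rule Q.integrable_const_bound[where B = K])
    show "AE w in Q. norm (\<tau> (XYv w)) \<le> K"
    proof (rule Q.AE_of_AE_given_R1[OF measurable_XYv model_lawD(2)[OF M]])
      have "(\<lambda>w. \<tau> (XYv w)) \<in> borel_measurable (sig XYv)" by (rule sig_measurable_comp) simp
      then show "Measurable.pred (sig XYv) (\<lambda>w. norm (\<tau> (XYv w)) \<le> K)" by measurable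
      have "AE w in Q. Rv w \<longrightarrow> norm (\<tau> (XYv w)) \<le> K"
      proof (rule D.AE_observable)
        show "observable (\<lambda>w. Rv w \<longrightarrow> norm (\<tau> (XYv w)) \<le> K)" by (rule observableI) simp
        show "AE w in P. Rv w \<longrightarrow> norm (\<tau> (XYv w)) \<le> K"
          using tau_bounded unfolding AE_given_R1[OF resp_gt_0] by simp
      qed measurable
      then show "AE w in given_R1 Q. norm (\<tau> (XYv w)) \<le> K"
        using Q.AE_given_R1[OF Q.resp_pos[OF measurable_XYv model_lawD(2)[OF M]]] by simp
    qed
  qed (auto simp: Q.measurable_Q)
qed

lemma tau_integrable: "integrable P (\<lambda>w. \<tau> (XYv w))"
  by (rule tau_integrable_dominated[OF model]) (simp add: absolutely_continuous_def)

definition obs_score :: "('d full \<Rightarrow> real) \<Rightarrow> ('d full \<Rightarrow> real) \<Rightarrow> 'd obs \<Rightarrow> real" where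
  "obs_score s \<eta> v = (if Rv v then s (unobs v) else \<eta> (unobs v))"

lemma Rv_obs [simp]: "Rv (obs w) = Rv w"
  by (simp add: obs_def Rv_def split: prod.split)

lemma obs_score_obs:
  assumes "\<eta> \<in> borel_measurable (sig XZv)"
  shows "obs_score s \<eta> (obs w) = (if Rv w then s w else \<eta> w)"
proof -
  have "observable (\<lambda>w. if Rv w then s w else \<eta> w)"
    by (rule observableI) (simp add: sig_measurable_const_on_fibres[OF assms, of "unobs (obs w)" w for w])
  from observableD[OF this, of w] show ?thesis by (simp add: obs_score_def split: if_splits)
qed

text \<open>The observed data see the density $\gamma+uk$ of the nonrespondents only through its mean given
  $(X,Z)$, which is that of $\gamma(1+u\eta)$.\<close>

lemma obs_law_stratified:
  assumes s [measurable]: "s \<in> borel_measurable full_space"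
    and k [measurable]: "k \<in> borel_measurable full_space"
    and \<eta>: "\<eta> \<in> borel_measurable (sig XZv)"
    and bk: "\<And>w. \<bar>k w\<bar> \<le> c" and be: "\<And>w. \<bar>\<eta> w\<bar> \<le> c"
    and proj: "\<And>H. H \<in> borel_measurable (sig XZv) \<Longrightarrow> (\<And>w. \<bar>H w\<bar> \<le> 1)
      \<Longrightarrow> (\<integral>w. k w * H w \<partial>G) = (\<integral>w. \<eta> w * \<gamma> w * H w \<partial>G)"
    and ez: "\<And>w. 0 \<le> 1 + u * \<eta> w" and b_pos: "AE w in G. 0 \<le> \<gamma> w + u * k w"
    and law: "full_law (stratified_law G (\<lambda>w. resp * (1 + u * s w)) (\<lambda>w. resp * (\<gamma> w + u * k w)))"
  shows "obs_law (stratified_law G (\<lambda>w. resp * (1 + u * s w)) (\<lambda>w. resp * (\<gamma> w + u * k w)))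
    = density (obs_law P) (\<lambda>v. ennreal (1 + u * obs_score s \<eta> v))"
proof -
  define L where "L = stratified_law G (\<lambda>w. resp * (1 + u * s w)) (\<lambda>w. resp * (\<gamma> w + u * k w))"
  define S where "S = obs_score s \<eta>"
  interpret L: full_law L unfolding L_def by (rule law)
  have c: "0 \<le> c" using order_trans[OF abs_ge_zero be] .
  have eta_full [measurable]: "\<eta> \<in> borel_measurable full_space" by (rule sig_XZ_full[OF \<eta>])
  have S_full [measurable]: "S \<in> borel_measurable full_space" unfolding S_def obs_score_def[abs_def] by measurable
  have S_obs: "S (obs w) = (if Rv w then s w else \<eta> w)" for w unfolding S_def by (rule obs_score_obs[OF \<eta>])
  have sG [measurable]: "s \<in> borel_measurable G" and kG [measurable]: "k \<in> borel_measurable G"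
    and eG [measurable]: "\<eta> \<in> borel_measurable G" by (auto intro: to_G)
  have ik: "integrable G k" by (rule G.integrable_const_bound[where B = c]) (auto simp: bk)
  show ?thesis unfolding L_def[symmetric] S_def[symmetric]
  proof (rule measure_eqI)
    show "sets (obs_law L) = sets (density (obs_law P) (\<lambda>v. ennreal (1 + u * S v)))"
      by (simp add: L.sets_obs_law sets_obs_law)
    fix A assume "A \<in> sets (obs_law L)"
    then have A [measurable]: "A \<in> sets full_space" by (simp add: L.sets_obs_law)
    define H where "H w = (indicator A (obs (False, snd w)) :: real)" for w :: "'d full"
    have H_sig: "H \<in> borel_measurable (sig XZv)"
    proof -
      have "(\<lambda>v. (False, fst v, snd v, 0)) \<in> measurable borel full_space"
        unfolding borel_prod[symmetric] by (intro measurable_full_tuple) measurable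
      then have "(\<lambda>v. indicator A (False, fst v, snd v, 0) :: real) \<in> borel_measurable borel"
        by (rule measurable_compose) measurable
      from sig_measurable_comp[OF this, of XZv] show ?thesis
        by (rule measurable_cong[THEN iffD1, rotated])
           (auto simp: H_def obs_def Rv_def XZv_def Xv_def Zv_def)
    qed
    have H_full [measurable]: "H \<in> borel_measurable full_space" by (rule sig_XZ_full[OF H_sig])
    have HG [measurable]: "H \<in> borel_measurable G" by (rule to_G) measurable
    have H01: "0 \<le> H w" "H w \<le> 1" for w by (auto simp: H_def split: split_indicator)
    have obsA [measurable]: "(\<lambda>w. indicator A (obs w) :: ennreal) \<in> borel_measurable full_space" by measurable
    have obsAG [measurable]: "(\<lambda>w. indicator A (obs w) :: ennreal) \<in> borel_measurable G"
      using obsA G.measurable_Q by auto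
    have obsAP [measurable]: "(\<lambda>w. indicator A (obs w) :: ennreal) \<in> borel_measurable P"
      using obsA measurable_Q by auto
    have SP [measurable]: "(\<lambda>w. S (obs w)) \<in> borel_measurable P" "(\<lambda>w. s w) \<in> borel_measurable P"
      "\<eta> \<in> borel_measurable P" "H \<in> borel_measurable P"
      by (auto intro: to_P)
    have aG: "(\<lambda>w. resp * (1 + u * s w)) \<in> borel_measurable G"
      and bG: "(\<lambda>w. resp * (\<gamma> w + u * k w)) \<in> borel_measurable G" by measurable
    have nn: "ennreal resp * (\<integral>\<^sup>+w. ennreal (f w) \<partial>G) = (\<integral>\<^sup>+w. ennreal (resp * f w) \<partial>G)"
      if "f \<in> borel_measurable G" for f
      using that resp_gt_0 by (simp add: ennreal_mult' nn_integral_cmult)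
    have one: "(\<integral>\<^sup>+w. (ennreal (1 + u * s w) * indicator A (obs w)) * ennreal (of_bool (Rv w)) \<partial>P)
        = (\<integral>\<^sup>+w. ennreal (resp * (1 + u * s w)) * indicator A (obs (True, snd w)) \<partial>G)"
    proof -
      have "(\<integral>\<^sup>+w. (ennreal (1 + u * s w) * indicator A (obs w)) * ennreal (of_bool (Rv w)) \<partial>P)
          = ennreal resp * (\<integral>\<^sup>+w. ennreal (1 + u * s w) * indicator A (obs w) \<partial>G)"
        by (rule nn_integral_given_R1[OF resp_gt_0]) measurable
      also have "\<dots> = (\<integral>\<^sup>+w. ennreal resp * (ennreal (1 + u * s w) * indicator A (obs w)) \<partial>G)"
        by (rule nn_integral_cmult[symmetric]) measurable
      also have "\<dots> = (\<integral>\<^sup>+w. ennreal (resp * (1 + u * s w)) * indicator A (obs (True, snd w)) \<partial>G)"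
      proof (intro nn_integral_cong_AE, use AE_G_respondents in eventually_elim)
        case (elim w)
        then have "(True, snd w) = w" by (cases w) (simp add: Rv_def)
        then show ?case using resp_gt_0 by (simp add: ennreal_mult' mult.assoc)
      qed
      finally show ?thesis .
    qed
    have two: "(\<integral>\<^sup>+w. ennreal ((1 + u * \<eta> w) * H w) * ennreal (of_bool (\<not> Rv w)) \<partial>P)
        = (\<integral>\<^sup>+w. ennreal (resp * (\<gamma> w + u * k w)) * indicator A (obs (False, snd w)) \<partial>G)"
    proof -
      have fs: "(\<lambda>w. ennreal ((1 + u * \<eta> w) * H w)) \<in> borel_measurable (sig XZv)" using \<eta> H_sig by measurable
      have bd: "integrable G (\<lambda>w. f w * H w)" if "integrable G f" for f
      proof (rule Bochner_Integration.integrable_bound[OF that])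
        show "AE w in G. norm (f w * H w) \<le> norm (f w)"
          using H01 by (auto simp: abs_mult abs_of_nonneg intro!: mult_left_le)
      qed (use that in measurable)
      have ige: "integrable G (\<lambda>w. \<eta> w * \<gamma> w)"
      proof (rule Bochner_Integration.integrable_bound[OF integrable_mult_right[OF gamma_integrable, of c]])
        show "AE w in G. norm (\<eta> w * \<gamma> w) \<le> norm (c * \<gamma> w)"
          using be c gamma_nonneg by (auto simp: abs_mult intro!: mult_right_mono)
      qed measurable
      have i1: "integrable G (\<lambda>w. ((1 + u * \<eta> w) * H w) * \<gamma> w)"
        using bd[OF gamma_integrable] integrable_mult_right[OF bd[OF ige], of u] by (simp add: algebra_simps)
      have i2: "integrable G (\<lambda>w. (\<gamma> w + u * k w) * H w)"
        using bd[of "\<lambda>w. \<gamma> w + u * k w"] gamma_integrable ik by auto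
      have "(\<integral>\<^sup>+w. ennreal ((1 + u * \<eta> w) * H w) * ennreal (of_bool (\<not> Rv w)) \<partial>P)
          = ennreal resp * (\<integral>\<^sup>+w. ennreal ((1 + u * \<eta> w) * H w) * ennreal (\<gamma> w) \<partial>G)"
        by (rule nonrespondents_nn_integral[OF _ fs]) simp
      also have "(\<integral>\<^sup>+w. ennreal ((1 + u * \<eta> w) * H w) * ennreal (\<gamma> w) \<partial>G)
          = (\<integral>\<^sup>+w. ennreal (((1 + u * \<eta> w) * H w) * \<gamma> w) \<partial>G)"
        by (intro nn_integral_cong) (simp add: ennreal_mult'' gamma_nonneg)
      also have "\<dots> = ennreal (\<integral>w. ((1 + u * \<eta> w) * H w) * \<gamma> w \<partial>G)"
        by (rule nn_integral_eq_integral[OF i1]) (simp add: ez H01 gamma_nonneg)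
      also have "(\<integral>w. ((1 + u * \<eta> w) * H w) * \<gamma> w \<partial>G) = (\<integral>w. \<gamma> w * H w \<partial>G) + u * (\<integral>w. \<eta> w * \<gamma> w * H w \<partial>G)"
        using bd[OF gamma_integrable] bd[OF ige] by (simp add: algebra_simps)
      also have "(\<integral>w. \<eta> w * \<gamma> w * H w \<partial>G) = (\<integral>w. k w * H w \<partial>G)"
        using H01 by (intro proj[OF H_sig, symmetric]) auto
      also have "(\<integral>w. \<gamma> w * H w \<partial>G) + u * (\<integral>w. k w * H w \<partial>G) = (\<integral>w. (\<gamma> w + u * k w) * H w \<partial>G)"
        using bd[OF gamma_integrable] bd[OF ik] by (simp add: algebra_simps)
      also have "ennreal (\<integral>w. (\<gamma> w + u * k w) * H w \<partial>G) = (\<integral>\<^sup>+w. ennreal ((\<gamma> w + u * k w) * H w) \<partial>G)"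
        by (rule nn_integral_eq_integral[OF i2, symmetric], use b_pos in eventually_elim) (simp add: H01)
      also have "ennreal resp * \<dots> = (\<integral>\<^sup>+w. ennreal (resp * ((\<gamma> w + u * k w) * H w)) \<partial>G)"
        by (rule nn) measurable
      also have "\<dots> = (\<integral>\<^sup>+w. ennreal (resp * (\<gamma> w + u * k w)) * indicator A (obs (False, snd w)) \<partial>G)"
        by (intro nn_integral_cong) (auto simp: H_def split: split_indicator)
      finally show ?thesis .
    qed
    have obsTF [measurable]: "(\<lambda>w. indicator A (obs (r, snd w)) :: ennreal) \<in> borel_measurable G" for r
      using measurable_compose[OF measurable_set_response obsA] G.measurable_Q by auto
    have "emeasure (obs_law L) A = (\<integral>\<^sup>+v. indicator A v \<partial>obs_law L)"
      by (simp add: L.sets_obs_law)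
    also have "\<dots> = (\<integral>\<^sup>+w. indicator A (obs w) \<partial>L)" by (rule L.nn_integral_obs_law) measurable
    also have "\<dots> = (\<integral>\<^sup>+w. ennreal (resp * (1 + u * s w)) * indicator A (obs (True, snd w))
        + ennreal (resp * (\<gamma> w + u * k w)) * indicator A (obs (False, snd w)) \<partial>G)"
      unfolding L_def by (rule G.nn_integral_stratified_law[OF aG bG obsA])
    also have "\<dots> = (\<integral>\<^sup>+w. ennreal (resp * (1 + u * s w)) * indicator A (obs (True, snd w)) \<partial>G)
        + (\<integral>\<^sup>+w. ennreal (resp * (\<gamma> w + u * k w)) * indicator A (obs (False, snd w)) \<partial>G)"
      by (rule nn_integral_add) measurable
    also have "\<dots> = (\<integral>\<^sup>+w. (ennreal (1 + u * s w) * indicator A (obs w)) * ennreal (of_bool (Rv w)) \<partial>P)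
        + (\<integral>\<^sup>+w. ennreal ((1 + u * \<eta> w) * H w) * ennreal (of_bool (\<not> Rv w)) \<partial>P)"
      unfolding one two ..
    also have "\<dots> = (\<integral>\<^sup>+w. (ennreal (1 + u * s w) * indicator A (obs w)) * ennreal (of_bool (Rv w))
        + ennreal ((1 + u * \<eta> w) * H w) * ennreal (of_bool (\<not> Rv w)) \<partial>P)"
      by (rule nn_integral_add[symmetric]) measurable
    also have "\<dots> = (\<integral>\<^sup>+w. ennreal (1 + u * S (obs w)) * indicator A (obs w) \<partial>P)"
    proof (intro nn_integral_cong)
      fix w :: "'d full"
      have "obs (False, snd w) = obs w" if "\<not> Rv w"
        using that by (cases w) (simp add: Rv_def)
      then show "(ennreal (1 + u * s w) * indicator A (obs w)) * ennreal (of_bool (Rv w))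
        + ennreal ((1 + u * \<eta> w) * H w) * ennreal (of_bool (\<not> Rv w))
        = ennreal (1 + u * S (obs w)) * indicator A (obs w)"
        by (auto simp: S_obs H_def split: split_indicator)
    qed
    also have "\<dots> = (\<integral>\<^sup>+v. ennreal (1 + u * S v) * indicator A v \<partial>obs_law P)"
      by (rule nn_integral_obs_law[symmetric]) measurable
    also have "\<dots> = emeasure (density (obs_law P) (\<lambda>v. ennreal (1 + u * S v))) A"
      using A by (subst emeasure_density) (auto simp: sets_obs_law measurable_cong_sets[OF sets_obs_law refl])
    finally show "emeasure (obs_law L) A = emeasure (density (obs_law P) (\<lambda>v. ennreal (1 + u * S v))) A" .
  qed
qed

text \<open>A path along which the observed density is exactly affine in the parameter. The nonrespondents
  have density $\gamma+tk$ against the law of the respondents, which the observed data only see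
  through its mean given $(X,Z)$. The path starts at \<open>P\<close>, but its other members are assembled from the
  respondents of \<open>P\<close>; the two fit together because \<open>P\<close> and the law assembled from \<open>P\<close> itself give the
  same observed data.\<close>

lemma linear_path:
  assumes s [measurable]: "s \<in> borel_measurable full_space"
    and k [measurable]: "k \<in> borel_measurable full_space"
    and \<eta>: "\<eta> \<in> borel_measurable (sig XZv)"
    and bs: "\<And>w. \<bar>s w\<bar> \<le> c" and bk: "\<And>w. \<bar>k w\<bar> \<le> c" and be: "\<And>w. \<bar>\<eta> w\<bar> \<le> c" and c: "0 < c"
    and centred: "(\<integral>w. s w + k w \<partial>G) = 0"
    and proj: "\<And>H. H \<in> borel_measurable (sig XZv) \<Longrightarrow> (\<And>w. \<bar>H w\<bar> \<le> 1)
      \<Longrightarrow> (\<integral>w. k w * H w \<partial>G) = (\<integral>w. \<eta> w * \<gamma> w * H w \<partial>G)"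
    and path: "\<And>t. 0 < t \<Longrightarrow> t \<le> 1 / (2 * c) \<Longrightarrow> \<exists>\<rho>. \<rho> \<in> borel_measurable (sig XYv) \<and> (\<forall>w. 0 \<le> \<rho> w)
      \<and> (AE w in G. \<gamma> w + t * k w = \<rho> w * (1 + t * s w)) \<and> (AE w in G. \<bar>\<rho> w - \<gamma> w\<bar> \<le> C * t)"
  shows "\<exists>Q D. regular_submodel \<tau> P Q (obs_score s \<eta>) D"
proof -
  \<comment> \<open>Up to \<open>t0\<close> the density of the observed data is at least $1/2$; later the path is kept constant.\<close>
  define t0 where "t0 = 1 / (2 * c)"
  define S where "S = obs_score s \<eta>"
  define L where "L u = stratified_law G (\<lambda>w. resp * (1 + u * s w)) (\<lambda>w. resp * (\<gamma> w + u * k w))" for u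
  define Q where "Q t = (if t \<le> 0 then P else L (min t t0))" for t
  have t0: "0 < t0" using c by (simp add: t0_def)
  have small: "\<bar>u * x\<bar> \<le> 1 / 2" if "0 < u" "u \<le> t0" "\<bar>x\<bar> \<le> c" for u x
  proof -
    have "\<bar>u * x\<bar> \<le> t0 * c" unfolding abs_mult using that t0 by (intro mult_mono) auto
    then show ?thesis using c by (simp add: t0_def)
  qed
  have eta_full [measurable]: "\<eta> \<in> borel_measurable full_space" by (rule sig_XZ_full[OF \<eta>])
  have S_full [measurable]: "S \<in> borel_measurable full_space" unfolding S_def obs_score_def[abs_def] by measurable
  have bS: "\<bar>S v\<bar> \<le> c" for v unfolding S_def obs_score_def using bs be by auto
  have sG [measurable]: "s \<in> borel_measurable G" and kG [measurable]: "k \<in> borel_measurable G"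
    and eG [measurable]: "\<eta> \<in> borel_measurable G" by (auto intro: to_G)
  have is1: "integrable G s" and ik: "integrable G k"
    by (auto intro!: G.integrable_const_bound[where B = c] simp: bs bk)
  have law: "\<exists>\<rho>. \<rho> \<in> borel_measurable (sig XYv) \<and> (AE w in G. \<bar>\<rho> w - \<gamma> w\<bar> \<le> C * u)
      \<and> (AE w in G. 0 \<le> \<gamma> w + u * k w)
      \<and> full_law (L u) \<and> M_np (L u) \<and> (AE w in L u. odds (L u) XYv w = \<rho> w)"
    if u: "0 < u" "u \<le> t0" for u
  proof -
    obtain \<rho> where \<rho>: "\<rho> \<in> borel_measurable (sig XYv)" "\<And>w. 0 \<le> \<rho> w"
      "AE w in G. \<gamma> w + u * k w = \<rho> w * (1 + u * s w)" "AE w in G. \<bar>\<rho> w - \<gamma> w\<bar> \<le> C * u"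
      using path[of u] u unfolding t0_def by blast
    have a_pos: "0 \<le> 1 + u * s w" for w using small[OF u bs[of w]] by linarith
    have b_pos: "AE w in G. 0 \<le> \<gamma> w + u * k w"
      using \<rho>(3) by eventually_elim (simp add: \<rho>(2) a_pos)
    have aG: "(\<lambda>w. resp * (1 + u * s w)) \<in> borel_measurable G"
      and bG: "(\<lambda>w. resp * (\<gamma> w + u * k w)) \<in> borel_measurable G" by measurable
    have iab: "integrable G (\<lambda>w. resp * (1 + u * s w) + resp * (\<gamma> w + u * k w))"
      using is1 ik gamma_integrable by auto
    have "(\<integral>\<^sup>+w. ennreal (resp * (1 + u * s w)) + ennreal (resp * (\<gamma> w + u * k w)) \<partial>G)
        = (\<integral>\<^sup>+w. ennreal (resp * (1 + u * s w) + resp * (\<gamma> w + u * k w)) \<partial>G)"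
      by (intro nn_integral_cong_AE, use b_pos in eventually_elim)
         (simp add: a_pos resp_gt_0[THEN less_imp_le] ennreal_plus[symmetric] del: ennreal_plus)
    also have "\<dots> = ennreal (\<integral>w. resp * (1 + u * s w) + resp * (\<gamma> w + u * k w) \<partial>G)"
      by (rule nn_integral_eq_integral[OF iab], use b_pos in eventually_elim)
         (simp add: a_pos resp_gt_0[THEN less_imp_le])
    also have "(\<integral>w. resp * (1 + u * s w) + resp * (\<gamma> w + u * k w) \<partial>G)
        = (\<integral>w. resp * (1 + \<gamma> w) + resp * u * (s w + k w) \<partial>G)"
      by (intro Bochner_Integration.integral_cong) (auto simp: algebra_simps)
    also have "\<dots> = 1"
      using is1 ik gamma_integrable centred total_mass by (simp add: G.prob_space)
    finally have total: "(\<integral>\<^sup>+w. ennreal (resp * (1 + u * s w)) + ennreal (resp * (\<gamma> w + u * k w)) \<partial>G) = 1"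
      by simp
    have prop_b: "AE w in G. resp * (\<gamma> w + u * k w) = \<rho> w * (resp * (1 + u * s w))"
      using \<rho>(3) by eventually_elim simp
    have pos_a: "AE w in G. 0 \<le> resp * (1 + u * s w)"
      using a_pos resp_gt_0 by simp
    note G.stratified_law_in_model[OF aG bG total \<rho>(1,2) prop_b pos_a]
    then show ?thesis using \<rho>(1,4) b_pos unfolding L_def by blast
  qed
  have dens: "obs_law (L u) = density (obs_law P) (\<lambda>v. ennreal (1 + u * S v))" if u: "0 < u" "u \<le> t0" for u
  proof -
    have ez: "0 \<le> 1 + u * \<eta> w" for w using small[OF u be[of w]] by linarith
    obtain \<rho> where "full_law (L u)" and b_pos: "AE w in G. 0 \<le> \<gamma> w + u * k w" using law[OF u] by blast
    then show ?thesis unfolding S_def L_def by (intro obs_law_stratified[OF s k \<eta> bk be proj ez b_pos])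
  qed
  have bm_eq: "borel_measurable (obs_law P) = borel_measurable full_space"
    by (rule measurable_cong_sets[OF sets_obs_law refl])
  have acL: "absolutely_continuous (obs_law P) (obs_law (L u))" if u: "0 < u" "u \<le> t0" for u
    unfolding dens[OF u] by (rule absolutely_continuousI_density) (simp add: bm_eq)
  have Q0: "Q 0 = P" by (simp add: Q_def)
  have Qpos: "\<exists>u. 0 < u \<and> u \<le> t0 \<and> Q t = L u" if "0 < t" for t
  proof (intro exI conjI)
    show "0 < min t t0" "min t t0 \<le> t0" using that t0 by auto
    show "Q t = L (min t t0)" using that by (simp add: Q_def)
  qed
  have Qt: "M_np (Q t)" and Qi: "integrable (Q t) (\<lambda>w. \<tau> (XYv w))" if "0 \<le> t" for t
  proof -
    have "M_np (Q t) \<and> integrable (Q t) (\<lambda>w. \<tau> (XYv w))"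
    proof (cases "t = 0")
      case True
      then show ?thesis using Q0 model tau_integrable by simp
    next
      case False
      then have "0 < t" using that by simp
      then obtain u where u: "0 < u" "u \<le> t0" "Q t = L u" using Qpos by blast
      obtain \<rho> where "M_np (L u)" using law[OF u(1,2)] by blast
      then show ?thesis unfolding u(3) using tau_integrable_dominated[OF _ acL[OF u(1,2)]] by simp
    qed
    then show "M_np (Q t)" "integrable (Q t) (\<lambda>w. \<tau> (XYv w))" by simp_all
  qed
  have near: "\<forall>\<^sub>F t in at_right 0. 0 < t \<and> t \<le> t0"
    unfolding eventually_at_right_field using t0 by (intro exI[of _ t0]) auto
  have q: "qmd (obs_law P) (\<lambda>t. obs_law (Q t)) S"
    unfolding qmd_def
  proof (intro conjI allI impI)
    show "obs_law (Q 0) = obs_law P" by (simp add: Q0)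
    show "S \<in> borel_measurable (obs_law P)" by (simp add: bm_eq)
    interpret O: prob_space "obs_law P" by (rule prob_space_obs_law)
    show "integrable (obs_law P) (\<lambda>v. (S v)\<^sup>2)"
      using O.sq_int_bounded[of S c] bS by (simp add: sq_int_def bm_eq)
    fix t :: real assume "0 \<le> t"
    show "sets (obs_law (Q t)) = sets (obs_law P)" by (simp add: obs_law_def)
    show "absolutely_continuous (obs_law P) (obs_law (Q t))"
    proof (cases "t = 0")
      case True
      then show ?thesis by (simp add: Q0 absolutely_continuous_def)
    next
      case False
      then have "0 < t" using \<open>0 \<le> t\<close> by simp
      then obtain u where u: "0 < u" "u \<le> t0" "Q t = L u" using Qpos by blast
      show ?thesis unfolding u(3) by (rule acL[OF u(1,2)])
    qed
  next
    interpret O: prob_space "obs_law P" by (rule prob_space_obs_law)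
    have bound: "(\<integral>\<^sup>+v. ennreal (((sqrt (enn2real (RN_deriv (obs_law P) (obs_law (Q t)) v)) - 1) / t - S v / 2)\<^sup>2) \<partial>obs_law P)
        \<le> ennreal ((t * c\<^sup>2 / 2)\<^sup>2)" if t: "0 < t \<and> t \<le> t0" for t
    proof -
      have Qt: "Q t = L t" using t by (simp add: Q_def)
      have ae: "AE v in obs_law P. ennreal (1 + t * S v) = RN_deriv (obs_law P) (obs_law (Q t)) v"
        unfolding Qt using t by (intro O.RN_deriv_unique dens[symmetric]) (auto simp: bm_eq)
      have "(\<integral>\<^sup>+v. ennreal (((sqrt (enn2real (RN_deriv (obs_law P) (obs_law (Q t)) v)) - 1) / t - S v / 2)\<^sup>2) \<partial>obs_law P)
        \<le> (\<integral>\<^sup>+v. ennreal ((t * c\<^sup>2 / 2)\<^sup>2) \<partial>obs_law P)"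
      proof (intro nn_integral_mono_AE, use ae in eventually_elim)
        case (elim v)
        have sm: "\<bar>t * S v\<bar> \<le> 1 / 2" using small[of t "S v"] t bS by simp
        have RN: "enn2real (RN_deriv (obs_law P) (obs_law (Q t)) v) = 1 + t * S v"
          unfolding elim[symmetric] using sm by simp
        have "\<bar>sqrt (1 + t * S v) - 1 - t * S v / 2\<bar> \<le> (t * S v)\<^sup>2 / 2"
          using sm by (intro sqrt_first_order) linarith
        also have "\<dots> \<le> (t * c)\<^sup>2 / 2"
          using t bS[of v] c by (simp add: power_mult_distrib abs_le_square_iff[symmetric] mult_left_mono)
        finally have "\<bar>sqrt (1 + t * S v) - 1 - t * S v / 2\<bar> / t \<le> (t * c)\<^sup>2 / 2 / t"
          using t by (intro divide_right_mono) auto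
        moreover have eq: "(sqrt (1 + t * S v) - 1) / t - S v / 2 = (sqrt (1 + t * S v) - 1 - t * S v / 2) / t"
          using t by (simp add: field_simps)
        have "\<bar>(sqrt (1 + t * S v) - 1) / t - S v / 2\<bar> = \<bar>sqrt (1 + t * S v) - 1 - t * S v / 2\<bar> / t"
          unfolding eq abs_divide using t by simp
        moreover have "(t * c)\<^sup>2 / 2 / t = t * c\<^sup>2 / 2" using t by (simp add: power2_eq_square)
        ultimately have "\<bar>(sqrt (1 + t * S v) - 1) / t - S v / 2\<bar> \<le> t * c\<^sup>2 / 2"
          by linarith
        then show ?case unfolding RN
          by (intro ennreal_leI) (metis abs_ge_zero power2_abs power_mono)
      qed
      also have "\<dots> = ennreal ((t * c\<^sup>2 / 2)\<^sup>2)" by (simp add: O.emeasure_space_1)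
      finally show ?thesis .
    qed
    have up: "((\<lambda>t. ennreal ((t * c\<^sup>2 / 2)\<^sup>2)) \<longlongrightarrow> ennreal ((0 * c\<^sup>2 / 2)\<^sup>2)) (at_right 0)"
      by (intro tendsto_ennrealI tendsto_intros) auto
    show "((\<lambda>t. \<integral>\<^sup>+v. ennreal (((sqrt (enn2real (RN_deriv (obs_law P) (obs_law (Q t)) v)) - 1) / t - S v / 2)\<^sup>2) \<partial>obs_law P)
          \<longlongrightarrow> 0) (at_right 0)"
    proof (rule tendsto_sandwich[OF _ _ tendsto_const])
      show "\<forall>\<^sub>F t in at_right 0. (\<integral>\<^sup>+v. ennreal (((sqrt (enn2real (RN_deriv (obs_law P) (obs_law (Q t)) v)) - 1) / t - S v / 2)\<^sup>2) \<partial>obs_law P)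
        \<le> ennreal ((t * c\<^sup>2 / 2)\<^sup>2)"
        using near by eventually_elim (rule bound)
      show "((\<lambda>t. ennreal ((t * c\<^sup>2 / 2)\<^sup>2)) \<longlongrightarrow> 0) (at_right 0)" using up by simp
    qed simp
  qed
  have lim: "((\<lambda>t. \<integral>\<^sup>+w. ennreal (of_bool (Rv w) * (odds (Q t) XYv w - odds P XYv w)\<^sup>2) \<partial>Q t) \<longlongrightarrow> 0) (at_right 0)"
  proof (rule tendsto_sandwich[OF _ _ tendsto_const])
    show "\<forall>\<^sub>F t in at_right 0. (\<integral>\<^sup>+w. ennreal (of_bool (Rv w) * (odds (Q t) XYv w - odds P XYv w)\<^sup>2) \<partial>Q t)
        \<le> ennreal ((C * t)\<^sup>2)"
      using near
    proof eventually_elim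
      case (elim t)
      then have QL: "Q t = L t" by (simp add: Q_def)
      obtain \<rho> where \<rho>: "\<rho> \<in> borel_measurable (sig XYv)" "AE w in G. \<bar>\<rho> w - \<gamma> w\<bar> \<le> C * t"
        "full_law (L t)" "AE w in L t. odds (L t) XYv w = \<rho> w" using law[of t] elim by blast
      interpret L: full_law "L t" by (rule \<rho>(3))
      interpret D: dominated_law P "L t"
        by (intro dominated_law.intro dominated_law_axioms.intro full_law_axioms L.full_law_axioms acL)
           (use elim in auto)
      have [measurable]: "\<rho> \<in> borel_measurable full_space" by (rule sig_XY_full[OF \<rho>(1)])
      have [measurable]: "odds P XYv \<in> borel_measurable full_space" using odds_measurable measurable_Q by auto
      have ae: "AE w in L t. Rv w \<longrightarrow> \<bar>\<rho> w - odds P XYv w\<bar> \<le> C * t"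
      proof (rule D.AE_observable)
        show "observable (\<lambda>w. Rv w \<longrightarrow> \<bar>\<rho> w - odds P XYv w\<bar> \<le> C * t)" by (rule observableI) simp
        show "AE w in P. Rv w \<longrightarrow> \<bar>\<rho> w - odds P XYv w\<bar> \<le> C * t"
          using \<rho>(2) gamma_odds unfolding AE_given_R1[OF resp_gt_0] by eventually_elim simp
      qed measurable
      have "(\<integral>\<^sup>+w. ennreal (of_bool (Rv w) * (odds (L t) XYv w - odds P XYv w)\<^sup>2) \<partial>L t)
          \<le> (\<integral>\<^sup>+w. ennreal ((C * t)\<^sup>2) \<partial>L t)"
      proof (intro nn_integral_mono_AE, use \<rho>(4) ae in eventually_elim)
        case (elim w)
        have "of_bool (Rv w) * (\<rho> w - odds P XYv w)\<^sup>2 \<le> (C * t)\<^sup>2"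
        proof (cases "Rv w")
          case True
          then have "\<bar>\<rho> w - odds P XYv w\<bar>\<^sup>2 \<le> (C * t)\<^sup>2" using elim by (intro power_mono) auto
          then show ?thesis using True by simp
        qed simp
        then show ?case unfolding elim(1) by (rule ennreal_leI)
      qed
      also have "\<dots> = ennreal ((C * t)\<^sup>2)" using L.emeasure_space_1 by simp
      finally show ?case unfolding QL .
    qed
    have "((\<lambda>t. ennreal ((C * t)\<^sup>2)) \<longlongrightarrow> ennreal ((C * 0)\<^sup>2)) (at_right 0)"
      by (intro tendsto_ennrealI tendsto_intros)
    then show "((\<lambda>t. ennreal ((C * t)\<^sup>2)) \<longlongrightarrow> 0) (at_right 0)" by simp
  qed simp
  have "((\<lambda>t. mu \<tau> (Q t)) has_real_derivative (\<integral>w. S (obs w) * (uncentred_infl w - mu \<tau> P) \<partial>P)) (at 0 within {0..})"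
    by (rule path_derivative(3)[OF Q0 Qt Qi q lim])
  then have "regular_submodel \<tau> P Q S (\<integral>w. S (obs w) * (uncentred_infl w - mu \<tau> P) \<partial>P)"
    unfolding regular_submodel_def using Q0 Qt Qi q lim by auto
  then show ?thesis unfolding S_def by blast
qed

end

section \<open>The scores approximate the influence function\<close>

definition clamp :: "real \<Rightarrow> real \<Rightarrow> real" where
  "clamp c x = max (- c) (min c x)"

lemma clamp_bounded: "0 \<le> c \<Longrightarrow> \<bar>clamp c x\<bar> \<le> c"
  and clamp_id: "\<bar>x\<bar> \<le> c \<Longrightarrow> clamp c x = x"
  by (auto simp: clamp_def)

lemma measurable_clamp [measurable]: "f \<in> borel_measurable M \<Longrightarrow> (\<lambda>x. clamp c (f x)) \<in> borel_measurable M"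
  unfolding clamp_def by (intro borel_measurable_max borel_measurable_min) auto

locale complete_model = represented_model P \<tau> \<delta> \<gamma> K
  for P :: "('d::finite) full measure" and \<tau> \<delta> \<gamma> K +
  fixes \<beta> :: "'d full \<Rightarrow> real" and b :: real
  assumes beta: "\<beta> \<in> borel_measurable (sig XZv)" and b_pos: "0 < b" and beta_ge: "\<And>w. b \<le> \<beta> w"
    and beta_eq: "AE w in given_R1 P. cexp (given_R1 P) XZv \<gamma> w = \<beta> w"
    and complete: "\<And>g. g \<in> L2 P XZv \<Longrightarrow> (AE w in given_R1 P. Tadj P g w = 0)
      \<Longrightarrow> (AE w in given_R1 P. g (XZv w) = 0)"
begin

sublocale XZ: sigma_finite_subalgebra G "sig XZv"
  by (rule G.sigma_finite_sig[OF measurable_XZv])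

sublocale XY: sigma_finite_subalgebra G "sig XYv"
  by (rule G.sigma_finite_sig[OF measurable_XYv])

text \<open>A version of $E(f\mid R=1,X,Z)/\beta$ that is bounded everywhere when \<open>c\<close> bounds \<open>f\<close>: the score of the
  nonrespondents when their density moves in the direction \<open>f\<close>.\<close>

definition ratio :: "real \<Rightarrow> ('d full \<Rightarrow> real) \<Rightarrow> 'd full \<Rightarrow> real" where
  "ratio c f w = clamp (c / b) (cexp G XZv f w / \<beta> w)"

lemma beta_pos: "0 < \<beta> w"
  using b_pos beta_ge[of w] by linarith

lemma ratio_sig: "ratio c f \<in> borel_measurable (sig XZv)"
  unfolding ratio_def[abs_def] using beta by measurable

lemma ratio_bounded: "0 \<le> c \<Longrightarrow> \<bar>ratio c f w\<bar> \<le> c / b"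
  unfolding ratio_def using b_pos by (intro clamp_bounded) simp

lemma ratio_eq:
  assumes f: "f \<in> borel_measurable full_space" "\<And>w. \<bar>f w\<bar> \<le> c"
  shows "AE w in G. ratio c f w = cexp G XZv f w / \<beta> w"
  using G.cexp_bounded[OF measurable_XZv f]
proof eventually_elim
  case (elim w)
  have "0 \<le> c" using order_trans[OF abs_ge_zero f(2)] .
  then have "\<bar>cexp G XZv f w / \<beta> w\<bar> \<le> c / b"
    using elim beta_ge[of w] b_pos beta_pos[of w] by (auto simp: abs_divide intro!: frac_le)
  then show ?case by (simp add: ratio_def clamp_id)
qed

lemma ratio_projection:
  assumes f: "f \<in> borel_measurable full_space" "\<And>w. \<bar>f w\<bar> \<le> c"
    and H: "H \<in> borel_measurable (sig XZv)" "\<And>w. \<bar>H w\<bar> \<le> 1"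
  shows "(\<integral>w. f w * H w \<partial>G) = (\<integral>w. ratio c f w * \<gamma> w * H w \<partial>G)"
    and "integrable G (\<lambda>w. f w * H w)" "integrable G (\<lambda>w. ratio c f w * \<gamma> w * H w)"
proof -
  have c: "0 \<le> c" using order_trans[OF abs_ge_zero f(2)] .
  have Hf [measurable]: "H \<in> borel_measurable full_space" by (rule sig_XZ_full[OF H(1)])
  have rf [measurable]: "ratio c f \<in> borel_measurable full_space" by (rule sig_XZ_full[OF ratio_sig])
  have [measurable]: "f \<in> borel_measurable full_space" by (rule f)
  have [measurable]: "H \<in> borel_measurable G" "ratio c f \<in> borel_measurable G" "f \<in> borel_measurable G"
    "\<beta> \<in> borel_measurable G"
    by (auto intro: to_G f sig_XZ_full[OF beta])
  have "\<bar>f w * H w\<bar> \<le> c * 1" for w unfolding abs_mult using f(2) H(2) c by (intro mult_mono) auto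
  then show i1: "integrable G (\<lambda>w. f w * H w)"
    by (intro G.integrable_bounded[where c = c]) auto
  have "\<bar>ratio c f w * \<gamma> w * H w\<bar> \<le> (c / b) * K * 1" for w
    unfolding abs_mult using ratio_bounded[OF c] gamma_nonneg[of w] gamma_le[of w] H(2) c b_pos K_nonneg
    by (intro mult_mono) auto
  then show i2: "integrable G (\<lambda>w. ratio c f w * \<gamma> w * H w)"
    by (intro G.integrable_bounded[where c = "(c / b) * K * 1"]) measurable
  have i2': "integrable G (\<lambda>w. (ratio c f w * H w) * \<gamma> w)" using i2 by (simp add: mult_ac)
  have i1': "integrable G (\<lambda>w. H w * f w)" using i1 by (simp add: mult_ac)
  have "(\<integral>w. ratio c f w * \<gamma> w * H w \<partial>G) = (\<integral>w. (ratio c f w * H w) * \<gamma> w \<partial>G)" by (simp add: mult_ac)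
  also have "\<dots> = (\<integral>w. (ratio c f w * H w) * real_cond_exp G (sig XZv) \<gamma> w \<partial>G)"
    by (rule XZ.real_cond_exp_intg(2)[symmetric, OF i2']) (use ratio_sig H in measurable)
  also have "\<dots> = (\<integral>w. H w * real_cond_exp G (sig XZv) f w \<partial>G)"
  proof (rule integral_cong_AE)
    show "AE w in G. (ratio c f w * H w) * real_cond_exp G (sig XZv) \<gamma> w = H w * real_cond_exp G (sig XZv) f w"
      using ratio_eq[OF f] beta_eq unfolding G.cexp_eq
    proof eventually_elim
      case (elim w)
      show ?case unfolding elim using beta_pos[of w] by simp
    qed
  qed measurable
  also have "\<dots> = (\<integral>w. H w * f w \<partial>G)"
    by (rule XZ.real_cond_exp_intg(2)[OF i1' H(1)]) measurable
  finally show "(\<integral>w. f w * H w \<partial>G) = (\<integral>w. ratio c f w * \<gamma> w * H w \<partial>G)" by (simp add: mult.commute)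
qed

text \<open>Tilting the law of the respondents and leaving the odds alone.\<close>

lemma tilting_submodel:
  assumes s [measurable]: "s \<in> borel_measurable full_space" and bs: "\<And>w. \<bar>s w\<bar> \<le> c"
    and centred: "(\<integral>w. s w + \<gamma> w * s w \<partial>G) = 0"
  shows "\<exists>Q D. regular_submodel \<tau> P Q (obs_score s (ratio (K * c) (\<lambda>w. \<gamma> w * s w))) D"
proof -
  have c: "0 \<le> c" using order_trans[OF abs_ge_zero bs] .
  define c' where "c' = 1 + c + K * c + K * c / b"
  have Kc: "0 \<le> K * c" "0 \<le> K * c / b" using c K_nonneg b_pos by auto
  have bk: "\<bar>\<gamma> w * s w\<bar> \<le> K * c" for w
    unfolding abs_mult using bs[of w] gamma_nonneg[of w] gamma_le[of w] c K_nonneg by (intro mult_mono) auto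
  have km [measurable]: "(\<lambda>w. \<gamma> w * s w) \<in> borel_measurable full_space" by measurable
  show ?thesis
  proof (rule linear_path[where c = c' and C = 0 and k = "\<lambda>w. \<gamma> w * s w"])
    show "\<bar>s w\<bar> \<le> c'" "\<bar>\<gamma> w * s w\<bar> \<le> c'" "\<bar>ratio (K * c) (\<lambda>w. \<gamma> w * s w) w\<bar> \<le> c'" for w
      using bs[of w] bk[of w] ratio_bounded[OF Kc(1), of "\<lambda>w. \<gamma> w * s w" w] c Kc by (auto simp: c'_def)
    show "0 < c'" using c Kc by (simp add: c'_def)
    fix t :: real assume "0 < t"
    show "\<exists>\<rho>. \<rho> \<in> borel_measurable (sig XYv) \<and> (\<forall>w. 0 \<le> \<rho> w)
      \<and> (AE w in G. \<gamma> w + t * (\<gamma> w * s w) = \<rho> w * (1 + t * s w)) \<and> (AE w in G. \<bar>\<rho> w - \<gamma> w\<bar> \<le> 0 * t)"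
      by (rule exI[of _ \<gamma>]) (auto simp: gamma gamma_nonneg algebra_simps)
  next
    fix H :: "'d full \<Rightarrow> real" assume H: "H \<in> borel_measurable (sig XZv)" "\<And>w. \<bar>H w\<bar> \<le> 1"
    show "(\<integral>w. \<gamma> w * s w * H w \<partial>G) = (\<integral>w. ratio (K * c) (\<lambda>w. \<gamma> w * s w) w * \<gamma> w * H w \<partial>G)"
      by (rule ratio_projection(1)[OF km bk H])
  qed (use centred in \<open>auto simp: ratio_sig s\<close>)
qed

text \<open>Raising the odds in the direction \<open>g\<close>, with the respondents made uniformly rarer to keep the total mass.\<close>

lemma odds_submodel:
  assumes g: "g \<in> borel_measurable (sig XYv)" and g0: "\<And>w. 0 \<le> g w" and gc: "\<And>w. g w \<le> c"
  defines "\<kappa> \<equiv> resp * (\<integral>w. g w \<partial>G)"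
  shows "\<exists>Q D. regular_submodel \<tau> P Q (obs_score (\<lambda>_. - \<kappa>) (\<lambda>w. ratio c g w - \<kappa>)) D"
proof -
  have gf [measurable]: "g \<in> borel_measurable full_space" by (rule sig_XY_full[OF g])
  have bg: "\<bar>g w\<bar> \<le> c" for w using g0[of w] gc[of w] by simp
  have c: "0 \<le> c" using order_trans[OF abs_ge_zero bg] .
  have ig: "integrable G g" by (rule G.integrable_bounded[OF gf bg])
  have "(\<integral>w. g w \<partial>G) \<le> (\<integral>w. c \<partial>G)" by (intro integral_mono ig) (auto simp: gc)
  then have gle: "(\<integral>w. g w \<partial>G) \<le> c" by simp
  have gge: "0 \<le> (\<integral>w. g w \<partial>G)" by (rule integral_nonneg_AE) (simp add: g0)
  have resp1: "resp \<le> 1" by (simp add: resp_def)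
  have k0: "0 \<le> \<kappa>" and kc: "\<kappa> \<le> c"
    using gle gge resp1 resp_gt_0 mult_mono[OF resp1 gle] by (auto simp: \<kappa>_def)
  define c' where "c' = 1 + c + c * K + c / b"
  have pos: "0 \<le> c * K" "0 \<le> c / b" using c K_nonneg b_pos by auto
  show ?thesis
  proof (rule linear_path[where c = c' and C = "2 * c" and k = "\<lambda>w. g w - \<kappa> * \<gamma> w"])
    have "\<bar>\<kappa> * \<gamma> w\<bar> \<le> c * K" for w
      unfolding abs_mult using k0 kc gamma_nonneg[of w] gamma_le[of w] c by (intro mult_mono) auto
    then have bk: "\<bar>g w - \<kappa> * \<gamma> w\<bar> \<le> c + c * K" for w
      using abs_triangle_ineq4[of "g w" "\<kappa> * \<gamma> w"] bg[of w] by (meson add_mono order_trans)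
    then show "\<bar>g w - \<kappa> * \<gamma> w\<bar> \<le> c'" for w using bk[of w] c pos unfolding c'_def by linarith
    show "\<bar>- \<kappa>\<bar> \<le> c'" for w :: "'d full" using k0 kc c pos by (simp add: c'_def)
    show "\<bar>ratio c g w - \<kappa>\<bar> \<le> c'" for w
      using ratio_bounded[OF c, of g w] k0 kc c pos unfolding c'_def by linarith
    show c'0: "0 < c'" using c pos by (simp add: c'_def)
    show "(\<lambda>w. ratio c g w - \<kappa>) \<in> borel_measurable (sig XZv)" using ratio_sig by measurable
    have "(\<integral>w. - \<kappa> + (g w - \<kappa> * \<gamma> w) \<partial>G) = - \<kappa> + ((\<integral>w. g w \<partial>G) - \<kappa> * (\<integral>w. \<gamma> w \<partial>G))"
      using ig gamma_integrable by simp
    also have "\<dots> = (\<integral>w. g w \<partial>G) - (resp * (1 + (\<integral>w. \<gamma> w \<partial>G))) * (\<integral>w. g w \<partial>G)"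
      by (simp add: \<kappa>_def algebra_simps)
    also have "\<dots> = 0" by (simp add: total_mass)
    finally show "(\<integral>w. - \<kappa> + (g w - \<kappa> * \<gamma> w) \<partial>G) = 0" .
  next
    fix H :: "'d full \<Rightarrow> real" assume H: "H \<in> borel_measurable (sig XZv)" "\<And>w. \<bar>H w\<bar> \<le> 1"
    have gHi: "integrable G (\<lambda>w. \<gamma> w * H w)"
    proof (rule G.integrable_bounded[where c = K])
      show "(\<lambda>w. \<gamma> w * H w) \<in> borel_measurable full_space" using sig_XZ_full[OF H(1)] by measurable
      show "\<bar>\<gamma> w * H w\<bar> \<le> K" for w
        using mult_mono[OF gamma_le[of w] H(2)[of w] K_nonneg] gamma_nonneg[of w] by (simp add: abs_mult)
    qed
    note p = ratio_projection[OF gf bg H]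
    have "(\<integral>w. (g w - \<kappa> * \<gamma> w) * H w \<partial>G) = (\<integral>w. g w * H w - \<kappa> * (\<gamma> w * H w) \<partial>G)"
      by (simp add: algebra_simps)
    also have "\<dots> = (\<integral>w. ratio c g w * \<gamma> w * H w \<partial>G) - \<kappa> * (\<integral>w. \<gamma> w * H w \<partial>G)"
      using p gHi by simp
    also have "\<dots> = (\<integral>w. ratio c g w * \<gamma> w * H w - \<kappa> * (\<gamma> w * H w) \<partial>G)"
      using p gHi by simp
    also have "\<dots> = (\<integral>w. (ratio c g w - \<kappa>) * \<gamma> w * H w \<partial>G)"
      by (simp add: algebra_simps)
    finally show "(\<integral>w. (g w - \<kappa> * \<gamma> w) * H w \<partial>G) = (\<integral>w. (ratio c g w - \<kappa>) * \<gamma> w * H w \<partial>G)" .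
  next
    fix t :: real assume t: "0 < t" "t \<le> 1 / (2 * c')"
    have "t * \<kappa> \<le> 1 / (2 * c') * c'"
      using t k0 kc c pos by (intro mult_mono) (auto simp: c'_def)
    moreover have "0 < c'" using c pos by (simp add: c'_def)
    ultimately have half: "1 / 2 \<le> 1 - t * \<kappa>" by simp
    define \<rho> where "\<rho> w = \<gamma> w + t * g w / (1 - t * \<kappa>)" for w
    have "t * g w / (1 - t * \<kappa>) \<le> t * c / (1 / 2)" for w
      using half t c g0 gc by (intro frac_le mult_left_mono) auto
    then have "\<bar>\<rho> w - \<gamma> w\<bar> \<le> 2 * c * t" for w
      using half t g0[of w] by (simp add: \<rho>_def abs_of_nonneg mult_ac)
    moreover have "\<gamma> w + t * (g w - \<kappa> * \<gamma> w) = \<rho> w * (1 + t * - \<kappa>)" for w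
      using half by (simp add: \<rho>_def field_simps)
    moreover have "\<rho> \<in> borel_measurable (sig XYv)" unfolding \<rho>_def using gamma g by measurable
    moreover have "0 \<le> \<rho> w" for w using half t g0[of w] gamma_nonneg[of w] by (simp add: \<rho>_def)
    ultimately show "\<exists>\<rho>. \<rho> \<in> borel_measurable (sig XYv) \<and> (\<forall>w. 0 \<le> \<rho> w)
      \<and> (AE w in G. \<gamma> w + t * (g w - \<kappa> * \<gamma> w) = \<rho> w * (1 + t * - \<kappa>)) \<and> (AE w in G. \<bar>\<rho> w - \<gamma> w\<bar> \<le> 2 * c * t)"
      by (intro exI[of _ \<rho>]) auto
  qed auto
qed

text \<open>Completeness says that $T'$ is injective, so that its adjoint \<open>T\<close> has dense range.\<close>

lemma range_dense:
  assumes u: "u \<in> borel_measurable (sig XZv)" "sq_int G u" and e: "0 < e"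
  obtains g c where "g \<in> borel_measurable (sig XYv)" "\<And>w. \<bar>g w\<bar> \<le> c"
    "l2_norm G (\<lambda>w. cexp G XZv g w - u w) < e"
proof -
  define N where "N = restr_to_subalg G (sig XZv)"
  note sub = XZ.subalg
  interpret N: prob_space N
    unfolding N_def by (rule prob_space_restr_to_subalg[OF sub G.prob_space_axioms])
  have bmN: "f \<in> borel_measurable N \<longleftrightarrow> f \<in> borel_measurable (sig XZv)" for f :: "'d full \<Rightarrow> real"
    unfolding N_def using measurable_in_subalg[OF sub] measurable_in_subalg'[OF sub] by blast
  have sqN: "sq_int N f \<longleftrightarrow> sq_int G f" if f: "f \<in> borel_measurable (sig XZv)" for f
  proof -
    have "(\<lambda>w. (f w)\<^sup>2) \<in> borel_measurable (sig XZv)" using f by measurable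
    then have "integrable N (\<lambda>w. (f w)\<^sup>2) \<longleftrightarrow> integrable G (\<lambda>w. (f w)\<^sup>2)"
      unfolding N_def using integrable_in_subalg[OF sub] integrable_from_subalg[OF sub] by blast
    then show ?thesis using f bmN[of f] G.sig_borel[OF measurable_XZv f] by (simp add: sq_int_def)
  qed
  have intN: "(\<integral>w. f w \<partial>N) = (\<integral>w. f w \<partial>G)" if "f \<in> borel_measurable (sig XZv)" for f :: "'d full \<Rightarrow> real"
    unfolding N_def by (rule integral_subalgebra2[OF sub that])
  define L where "L = {f \<in> borel_measurable (sig XZv). \<exists>g c. g \<in> borel_measurable (sig XYv)
    \<and> (\<forall>w. \<bar>g w\<bar> \<le> c) \<and> (AE w in G. f w = cexp G XZv g w)}"
  have intg: "integrable G g" if "g \<in> borel_measurable (sig XYv)" "\<And>w. \<bar>g w\<bar> \<le> c" for g :: "'d full \<Rightarrow> real" and c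
    using G.integrable_bounded[OF sig_XY_full[OF that(1)] that(2)] .
  obtain F where F: "\<And>n. F n \<in> L" "(\<lambda>n. l2_norm N (\<lambda>x. F n x - u x)) \<longlonglongrightarrow> 0"
  proof (rule N.dense_if_orthogonal_complement_trivial[of L u])
    show "sq_int N f" if fL: "f \<in> L" for f
    proof -
      obtain g c where f: "f \<in> borel_measurable (sig XZv)" "g \<in> borel_measurable (sig XYv)"
        "\<And>w. \<bar>g w\<bar> \<le> c" "AE w in G. f w = cexp G XZv g w" using fL unfolding L_def by blast
      have "AE w in G. \<bar>f w\<bar> \<le> c"
        using f(4) G.cexp_bounded[OF measurable_XZv sig_XY_full[OF f(2)] f(3)] by eventually_elim simp
      then show ?thesis unfolding sqN[OF f(1)]
        by (rule G.sq_int_bounded[rotated]) (rule G.sig_borel[OF measurable_XZv f(1)])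
    qed
    have "AE w in G. real_cond_exp G (sig XZv) (\<lambda>_. 0) w = 0" by (rule XZ.real_cond_exp_F_meas) auto
    then have "AE w in G. 0 = cexp G XZv (\<lambda>_. 0) w" unfolding G.cexp_eq by eventually_elim simp
    then show "(\<lambda>_. 0) \<in> L" unfolding L_def by (auto intro!: exI[of _ "\<lambda>_. 0"] exI[of _ 0])
    show "(\<lambda>x. f x + a * h x) \<in> L" if fL: "f \<in> L" and hL: "h \<in> L" for f h a
    proof -
      obtain g1 c1 where 1: "f \<in> borel_measurable (sig XZv)" "g1 \<in> borel_measurable (sig XYv)"
        "\<And>w. \<bar>g1 w\<bar> \<le> c1" "AE w in G. f w = cexp G XZv g1 w" using fL unfolding L_def by blast
      obtain g2 c2 where 2: "h \<in> borel_measurable (sig XZv)" "g2 \<in> borel_measurable (sig XYv)"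
        "\<And>w. \<bar>g2 w\<bar> \<le> c2" "AE w in G. h w = cexp G XZv g2 w" using hL unfolding L_def by blast
      note i1 = intg[OF 1(2,3)] and i2 = intg[OF 2(2,3)]
      have "AE w in G. real_cond_exp G (sig XZv) (\<lambda>w. g1 w + a * g2 w) w
          = real_cond_exp G (sig XZv) g1 w + real_cond_exp G (sig XZv) (\<lambda>w. a * g2 w) w"
        using i1 i2 by (intro XZ.real_cond_exp_add) auto
      moreover have "AE w in G. real_cond_exp G (sig XZv) (\<lambda>w. a * g2 w) w = a * real_cond_exp G (sig XZv) g2 w"
        using i2 by (rule XZ.real_cond_exp_cmult)
      ultimately have ae: "AE w in G. f w + a * h w = cexp G XZv (\<lambda>w. g1 w + a * g2 w) w"
        using 1(4) 2(4) unfolding G.cexp_eq by eventually_elim simp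
      have "\<bar>g1 w + a * g2 w\<bar> \<le> c1 + \<bar>a\<bar> * c2" for w
        using abs_triangle_ineq[of "g1 w" "a * g2 w"] 1(3)[of w] mult_left_mono[OF 2(3)[of w] abs_ge_zero[of a]]
        by (simp add: abs_mult)
      moreover have "(\<lambda>w. g1 w + a * g2 w) \<in> borel_measurable (sig XYv)" using 1 2 by measurable
      moreover have "(\<lambda>w. f w + a * h w) \<in> borel_measurable (sig XZv)" using 1 2 by measurable
      ultimately show ?thesis using ae unfolding L_def by blast
    qed
    show "sq_int N u" using u sqN by blast
    fix v assume v: "sq_int N v" and orth: "\<And>f. f \<in> L \<Longrightarrow> (\<integral>x. v x * f x \<partial>N) = 0"
    have v_sig: "v \<in> borel_measurable (sig XZv)" using v bmN by (auto simp: sq_int_def)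
    have v_sq: "sq_int G v" using v sqN[OF v_sig] by simp
    have v_full [measurable]: "v \<in> borel_measurable full_space" by (rule sig_XZ_full[OF v_sig])
    have v_G: "v \<in> borel_measurable G" by (rule to_G) measurable
    have iv: "integrable G v" by (rule G.sq_int_integrable[OF v_sq])
    \<comment> \<open>Testing against the sign of $T'v$ gives the $L_1$ norm of $T'v$.\<close>
    define g where "g w = sgn (cexp G XYv v w)" for w
    have g_sig: "g \<in> borel_measurable (sig XYv)" unfolding g_def by measurable
    have g_bd: "\<bar>g w\<bar> \<le> 1" for w by (auto simp: g_def sgn_if)
    have g_G: "g \<in> borel_measurable G" by (rule G.sig_borel[OF measurable_XYv g_sig])
    have ivg: "integrable G (\<lambda>w. v w * g w)"
    proof (rule Bochner_Integration.integrable_bound[OF iv])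
      show "AE w in G. norm (v w * g w) \<le> norm (v w)"
        using g_bd by (auto simp: abs_mult intro!: mult_left_le)
    qed (use v_G g_G in measurable)
    have igv: "integrable G (\<lambda>w. g w * v w)" using ivg by (simp add: mult.commute)
    have cg_sig: "cexp G XZv g \<in> borel_measurable (sig XZv)" by measurable
    have "cexp G XZv g \<in> L" unfolding L_def using g_sig g_bd by auto
    from orth[OF this] have "(\<integral>w. v w * cexp G XZv g w \<partial>G) = 0"
      using intN[of "\<lambda>w. v w * cexp G XZv g w"] v_sig cg_sig by simp
    moreover have "(\<integral>w. v w * cexp G XZv g w \<partial>G) = (\<integral>w. v w * g w \<partial>G)"
      unfolding G.cexp_eq by (rule XZ.real_cond_exp_intg(2)[OF ivg v_sig g_G])
    moreover have "(\<integral>w. v w * g w \<partial>G) = (\<integral>w. g w * cexp G XYv v w \<partial>G)"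
      unfolding G.cexp_eq using XY.real_cond_exp_intg(2)[OF igv g_sig v_G] by (simp add: mult.commute)
    moreover have "g w * cexp G XYv v w = \<bar>cexp G XYv v w\<bar>" for w by (simp add: g_def abs_sgn mult.commute)
    ultimately have "(\<integral>w. \<bar>cexp G XYv v w\<bar> \<partial>G) = 0" by simp
    moreover have "integrable G (\<lambda>w. \<bar>cexp G XYv v w\<bar>)"
      unfolding G.cexp_eq using XY.real_cond_exp_int(1)[OF iv] by simp
    ultimately have zero: "AE w in G. cexp G XYv v w = 0"
      using integral_nonneg_eq_0_iff_AE[of G "\<lambda>w. \<bar>cexp G XYv v w\<bar>"] by simp
    \<comment> \<open>\<open>v\<close> is constant on the fibres of $(X,Z)$, so it may be evaluated at any response and outcome.\<close>
    define h where "h p = v (True, fst p, 0, snd p)" for p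
    have h_v: "h (XZv w) = v w" for w
      unfolding h_def by (rule sig_measurable_const_on_fibres[OF v_sig]) (simp add: XZv_def Xv_def Zv_def)
    have h_meas: "h \<in> borel_measurable borel"
    proof -
      have "(\<lambda>p. (True, fst p, 0, snd p)) \<in> measurable borel full_space"
        unfolding borel_prod[symmetric] by (intro measurable_full_tuple) measurable
      from measurable_compose[OF this v_full] show ?thesis unfolding h_def[abs_def] .
    qed
    have "h \<in> L2 P XZv" unfolding L2_def using h_meas v_sq by (auto simp: h_v sq_int_def)
    moreover have "AE w in G. Tadj P h w = 0" using zero by (simp add: Tadj_def h_v)
    ultimately have "AE w in G. v w = 0" using complete[of h] by (simp add: h_v)
    moreover have "Measurable.pred (sig XZv) (\<lambda>w. v w = 0)" using v_sig by measurable
    ultimately show "AE w in N. v w = 0"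
      unfolding N_def by (rule AE_restr_to_subalg2[OF sub])
  qed blast
  obtain n where n: "l2_norm N (\<lambda>x. F n x - u x) < e"
    using order_tendstoD(2)[OF F(2) e] by (auto simp: eventually_sequentially)
  obtain g c where f: "F n \<in> borel_measurable (sig XZv)" "g \<in> borel_measurable (sig XYv)"
    "\<And>w. \<bar>g w\<bar> \<le> c" "AE w in G. F n w = cexp G XZv g w" using F(1)[of n] unfolding L_def by blast
  have "l2_norm N (\<lambda>x. F n x - u x) = l2_norm G (\<lambda>x. F n x - u x)"
    unfolding l2_norm_def by (subst intN) (use f u in measurable)
  also have "\<dots> = l2_norm G (\<lambda>w. cexp G XZv g w - u w)"
    unfolding l2_norm_def
  proof (intro arg_cong[where f = sqrt] integral_cong_AE)
    show "AE w in G. (F n w - u w)\<^sup>2 = (cexp G XZv g w - u w)\<^sup>2" using f(4) by eventually_elim simp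
  qed (use G.sig_borel[OF measurable_XZv f(1)] G.sig_borel[OF measurable_XZv u(1)] in measurable)
  finally show thesis using n f(2,3) by (intro that) auto
qed

end

context complete_model
begin

abbreviation infl_fn :: "'d full \<Rightarrow> real" where
  "infl_fn w \<equiv> uncentred_infl w - mu \<tau> P"

lemma infl_fn_sq_int: "sq_int P infl_fn"
  using sq_int_diff[OF sq_int_bounded[OF to_P[OF uncentred_infl_full] uncentred_infl_bounded]
      sq_int_bounded[of "\<lambda>_. mu \<tau> P" "\<bar>mu \<tau> P\<bar>"]] by simp

lemma infl_fn_mean: "(\<integral>w. infl_fn w \<partial>P) = 0"
proof -
  have "integrable P uncentred_infl"
    by (rule sq_int_integrable[OF sq_int_bounded[OF to_P[OF uncentred_infl_full] uncentred_infl_bounded]])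
  then show ?thesis by (simp add: mu_eq[OF tau_integrable])
qed

text \<open>Norms over the nonrespondents are controlled by norms over the respondents, since the odds are at most
  \<open>K\<close>.\<close>

lemma nonrespondents_l2_norm:
  assumes h: "h \<in> borel_measurable (sig XZv)" and d: "sq_int G d"
    and le: "AE w in G. \<bar>h w\<bar> \<le> \<bar>d w\<bar> / b"
  shows "sq_int P (\<lambda>w. of_bool (\<not> Rv w) * h w)"
    "l2_norm P (\<lambda>w. of_bool (\<not> Rv w) * h w) \<le> sqrt K / b * l2_norm G d"
proof -
  have hf: "h \<in> borel_measurable full_space" by (rule sig_XZ_full[OF h])
  have hP [measurable]: "h \<in> borel_measurable P" by (rule to_P[OF hf])
  have id: "integrable G (\<lambda>w. K / b\<^sup>2 * (d w)\<^sup>2)" using d by (auto simp: sq_int_def)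
  have h2: "(\<lambda>w. ennreal ((h w)\<^sup>2)) \<in> borel_measurable (sig XZv)" using h by measurable
  have "(\<integral>\<^sup>+w. ennreal ((of_bool (\<not> Rv w) * h w)\<^sup>2) \<partial>P) = (\<integral>\<^sup>+w. ennreal ((h w)\<^sup>2) * ennreal (of_bool (\<not> Rv w)) \<partial>P)"
    by (intro nn_integral_cong) (auto simp: of_bool_def)
  also have "\<dots> = ennreal resp * (\<integral>\<^sup>+w. ennreal ((h w)\<^sup>2) * ennreal (\<gamma> w) \<partial>G)"
    by (rule nonrespondents_nn_integral[OF _ h2]) simp
  also have "\<dots> \<le> 1 * (\<integral>\<^sup>+w. ennreal (K / b\<^sup>2 * (d w)\<^sup>2) \<partial>G)"
  proof (intro mult_mono nn_integral_mono_AE, goal_cases)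
    case 1
    show ?case by (simp add: resp_def)
  next
    case 2
    show ?case using le
    proof eventually_elim
      case (elim w)
      have "(h w)\<^sup>2 \<le> (\<bar>d w\<bar> / b)\<^sup>2" using power_mono[OF elim abs_ge_zero, of 2] by simp
      then have "(h w)\<^sup>2 * \<gamma> w \<le> (\<bar>d w\<bar> / b)\<^sup>2 * K"
        using gamma_nonneg[of w] gamma_le[of w] by (intro mult_mono) auto
      then show ?case
        by (simp add: ennreal_mult''[symmetric] gamma_nonneg power_divide mult.commute ennreal_leI)
    qed
  qed auto
  also have "\<dots> = ennreal (\<integral>w. K / b\<^sup>2 * (d w)\<^sup>2 \<partial>G)"
    using id K_nonneg by (simp add: nn_integral_eq_integral)
  finally have nn: "(\<integral>\<^sup>+w. ennreal ((of_bool (\<not> Rv w) * h w)\<^sup>2) \<partial>P) \<le> ennreal (K / b\<^sup>2 * (\<integral>w. (d w)\<^sup>2 \<partial>G))"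
    by simp
  then have "(\<integral>\<^sup>+w. ennreal ((of_bool (\<not> Rv w) * h w)\<^sup>2) \<partial>P) < \<infinity>"
    by (rule le_less_trans) simp
  then show sq: "sq_int P (\<lambda>w. of_bool (\<not> Rv w) * h w)"
    unfolding sq_int_def by (auto intro!: integrableI_bounded)
  have "ennreal (\<integral>w. (of_bool (\<not> Rv w) * h w)\<^sup>2 \<partial>P) \<le> ennreal (K / b\<^sup>2 * (\<integral>w. (d w)\<^sup>2 \<partial>G))"
    using nn by (subst nn_integral_eq_integral[symmetric]) (use sq in \<open>auto simp: sq_int_def\<close>)
  then have "(\<integral>w. (of_bool (\<not> Rv w) * h w)\<^sup>2 \<partial>P) \<le> K / b\<^sup>2 * (\<integral>w. (d w)\<^sup>2 \<partial>G)"
    using K_nonneg by (subst (asm) ennreal_le_iff) auto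
  then have "l2_norm P (\<lambda>w. of_bool (\<not> Rv w) * h w) \<le> sqrt (K / b\<^sup>2 * (\<integral>w. (d w)\<^sup>2 \<partial>G))"
    unfolding l2_norm_def by (rule real_sqrt_le_mono)
  also have "\<dots> = sqrt K / b * l2_norm G d"
    using b_pos by (simp add: l2_norm_def real_sqrt_mult real_sqrt_divide)
  finally show "l2_norm P (\<lambda>w. of_bool (\<not> Rv w) * h w) \<le> sqrt K / b * l2_norm G d" .
qed

text \<open>The respondents' part of the influence function is matched exactly by a tilt. What remains for the
  nonrespondents is a function of $(X,Z)$, and density of the range of \<open>T\<close> lets changes of the odds,
  split into their positive and negative parts, match it approximately. The constants take care of
  themselves, as scores and influence function have mean zero.\<close>

lemma score_approximation:
  assumes e: "0 < e"
  shows "\<exists>N a Q S D. (\<forall>j<N. regular_submodel \<tau> P (Q j) (S j) (D j))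
    \<and> sq_int P (\<lambda>w. \<Sum>j<(N::nat). a j * S j (obs w))
    \<and> l2_norm P (\<lambda>w. (\<Sum>j<N. a j * S j (obs w)) - infl_fn w) < e"
proof -
  define m where "m = mu \<tau> P"
  define K' where "K' = K + K * (2 * K)"
  \<comment> \<open>The respondents' part of the influence function, modified on a null set to be bounded.\<close>
  define U where "U w = clamp K' (\<tau> (XYv w) + \<gamma> w * gap w)" for w
  have K'0: "0 \<le> K'" using K_nonneg by (simp add: K'_def)
  have U_full [measurable]: "U \<in> borel_measurable full_space" unfolding U_def by measurable
  have bU: "\<bar>U w\<bar> \<le> K'" for w unfolding U_def by (rule clamp_bounded[OF K'0])
  have U_eq: "AE w in P. Rv w \<longrightarrow> uncentred_infl w = U w"
    using uncentred_infl_bounded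
    by eventually_elim (auto simp: uncentred_infl_def U_def K'_def clamp_id)
  \<comment> \<open>Centring under the law of $(X,Y,Z)$ in the whole population.\<close>
  define c1 where "c1 = resp * (\<integral>w. U w + \<gamma> w * U w \<partial>G)"
  define s where "s w = U w - c1" for w
  have s_full [measurable]: "s \<in> borel_measurable full_space" unfolding s_def by measurable
  have bgU: "\<bar>\<gamma> w * U w\<bar> \<le> K * K'" for w
    unfolding abs_mult using bU[of w] gamma_nonneg[of w] gamma_le[of w] K'0 K_nonneg by (intro mult_mono) auto
  have gU_full [measurable]: "(\<lambda>w. \<gamma> w * U w) \<in> borel_measurable full_space" by measurable
  have iU: "integrable G U" by (rule G.integrable_bounded[OF U_full bU])
  have igU: "integrable G (\<lambda>w. \<gamma> w * U w)" by (rule G.integrable_bounded[OF gU_full bgU])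
  define cs where "cs = K' + \<bar>c1\<bar>"
  have bs: "\<bar>s w\<bar> \<le> cs" for w
    using abs_triangle_ineq4[of "U w" c1] bU[of w] unfolding s_def cs_def by linarith
  have bgs: "\<bar>\<gamma> w * s w\<bar> \<le> K * cs" for w
    unfolding abs_mult using bs[of w] gamma_nonneg[of w] gamma_le[of w] K_nonneg order_trans[OF abs_ge_zero bs]
    by (intro mult_mono) auto
  have gs_full [measurable]: "(\<lambda>w. \<gamma> w * s w) \<in> borel_measurable full_space" by measurable
  have "(\<integral>w. s w + \<gamma> w * s w \<partial>G) = (\<integral>w. (U w + \<gamma> w * U w) - c1 * (1 + \<gamma> w) \<partial>G)"
    by (simp add: s_def algebra_simps)
  also have "\<dots> = (\<integral>w. U w + \<gamma> w * U w \<partial>G) - c1 * (1 + (\<integral>w. \<gamma> w \<partial>G))"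
    using iU igU gamma_integrable by simp
  also have "c1 * (1 + (\<integral>w. \<gamma> w \<partial>G)) = (resp * (1 + (\<integral>w. \<gamma> w \<partial>G))) * (\<integral>w. U w + \<gamma> w * U w \<partial>G)"
    by (simp add: c1_def mult_ac)
  finally have "(\<integral>w. s w + \<gamma> w * s w \<partial>G) = 0" unfolding total_mass by simp
  then obtain Q1 D1 where sub1: "regular_submodel \<tau> P Q1 (obs_score s (ratio (K * cs) (\<lambda>w. \<gamma> w * s w))) D1"
    using tilting_submodel[OF s_full bs] by blast
  \<comment> \<open>What the odds have to contribute, multiplied by \<open>\<beta>\<close>.\<close>
  define u where "u w = \<beta> w * \<delta> (XZv w) - cexp G XZv (\<lambda>w. \<gamma> w * U w) w" for w
  have d_sig: "(\<lambda>w. \<delta> (XZv w)) \<in> borel_measurable (sig XZv)" by (rule sig_measurable_comp) simp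
  have u_sig: "u \<in> borel_measurable (sig XZv)" unfolding u_def using beta d_sig by measurable
  have "AE w in G. \<bar>cexp G XZv \<gamma> w\<bar> \<le> K"
    by (rule G.cexp_bounded[OF measurable_XZv gamma_full]) (simp add: gamma_nonneg gamma_le)
  then have b_le: "AE w in G. \<beta> w \<le> K" using beta_eq by eventually_elim simp
  have "AE w in G. \<bar>u w\<bar> \<le> K * K + K * K'"
    using b_le G.cexp_bounded[OF measurable_XZv gU_full bgU]
  proof eventually_elim
    case (elim w)
    have "\<bar>\<beta> w * \<delta> (XZv w)\<bar> \<le> K * K"
      unfolding abs_mult using elim(1) beta_pos[of w] delta_bounded K_nonneg by (intro mult_mono) auto
    then show ?case using elim(2) unfolding u_def by linarith
  qed
  then have u_sq: "sq_int G u" by (rule G.sq_int_bounded[OF G.sig_borel[OF measurable_XZv u_sig]])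
  define e' where "e' = e * b / (2 * (sqrt K + 1))"
  have e'0: "0 < e'" using e b_pos K_nonneg by (simp add: e'_def add_nonneg_pos)
  obtain g c where g: "g \<in> borel_measurable (sig XYv)" "\<And>w. \<bar>g w\<bar> \<le> c"
    "l2_norm G (\<lambda>w. cexp G XZv g w - u w) < e'"
    using range_dense[OF u_sig u_sq e'0] by blast
  have g_full [measurable]: "g \<in> borel_measurable full_space" by (rule sig_XY_full[OF g(1)])
  define gp where "gp w = max 0 (g w)" for w
  define gm where "gm w = max 0 (- g w)" for w
  have gp: "gp \<in> borel_measurable (sig XYv)" "\<And>w. 0 \<le> gp w" "\<And>w. gp w \<le> c"
    and gm: "gm \<in> borel_measurable (sig XYv)" "\<And>w. 0 \<le> gm w" "\<And>w. gm w \<le> c"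
  proof -
    have c0: "0 \<le> c" using order_trans[OF abs_ge_zero g(2)] .
    have ab: "g w \<le> c" "- g w \<le> c" for w using g(2)[of w] by auto
    show "gp \<in> borel_measurable (sig XYv)" "gm \<in> borel_measurable (sig XYv)"
      unfolding gp_def gm_def using g(1) by measurable
    show "0 \<le> gp w" "gp w \<le> c" "0 \<le> gm w" "gm w \<le> c" for w
      using ab[of w] c0 by (auto simp: gp_def gm_def)
  qed
  define kp where "kp = resp * (\<integral>w. gp w \<partial>G)"
  define km where "km = resp * (\<integral>w. gm w \<partial>G)"
  obtain Q2 D2 where sub2: "regular_submodel \<tau> P Q2 (obs_score (\<lambda>_. - kp) (\<lambda>w. ratio c gp w - kp)) D2"
    unfolding kp_def using odds_submodel[OF gp] by blast
  obtain Q3 D3 where sub3: "regular_submodel \<tau> P Q3 (obs_score (\<lambda>_. - km) (\<lambda>w. ratio c gm w - km)) D3"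
    unfolding km_def using odds_submodel[OF gm] by blast
  define S1 where "S1 = obs_score s (ratio (K * cs) (\<lambda>w. \<gamma> w * s w))"
  define S2 where "S2 = obs_score (\<lambda>_. - kp) (\<lambda>w. ratio c gp w - kp)"
  define S3 where "S3 = obs_score (\<lambda>_. - km) (\<lambda>w. ratio c gm w - km)"
  have S1: "S1 (obs w) = (if Rv w then s w else ratio (K * cs) (\<lambda>w. \<gamma> w * s w) w)" for w
    unfolding S1_def by (rule obs_score_obs[OF ratio_sig])
  have rs: "(\<lambda>w. ratio c f w - x) \<in> borel_measurable (sig XZv)" for f x
    using ratio_sig by measurable
  have S2: "S2 (obs w) = (if Rv w then - kp else ratio c gp w - kp)" for w
    unfolding S2_def by (rule obs_score_obs[OF rs])
  have S3: "S3 (obs w) = (if Rv w then - km else ratio c gm w - km)" for w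
    unfolding S3_def by (rule obs_score_obs[OF rs])
  note d1 = submodel_derivative[OF sub1, folded S1_def] and d2 = submodel_derivative[OF sub2, folded S2_def]
    and d3 = submodel_derivative[OF sub3, folded S3_def]
  define c0 where "c0 = m - c1 - kp + km"
  define h where "h w = ratio (K * cs) (\<lambda>w. \<gamma> w * s w) w + ratio c gp w - ratio c gm w + c1 - \<delta> (XZv w)" for w
  have h_sig: "h \<in> borel_measurable (sig XZv)"
    unfolding h_def using ratio_sig[of "K * cs" "\<lambda>w. \<gamma> w * s w"] ratio_sig[of c gp] ratio_sig[of c gm] d_sig by measurable
  have gp_full: "gp \<in> borel_measurable full_space" and gm_full: "gm \<in> borel_measurable full_space"
    by (rule sig_XY_full[OF gp(1)], rule sig_XY_full[OF gm(1)])
  have gpb: "\<bar>gp w\<bar> \<le> c" and gmb: "\<bar>gm w\<bar> \<le> c" for w using gp gm by auto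
  have h_eq: "AE w in G. h w = (cexp G XZv g w - u w) / \<beta> w"
  proof -
    have gs: "(\<lambda>w. \<gamma> w * s w) = (\<lambda>w. \<gamma> w * U w - c1 * \<gamma> w)" by (simp add: s_def fun_eq_iff algebra_simps)
    have "AE w in G. real_cond_exp G (sig XZv) (\<lambda>w. \<gamma> w * U w - c1 * \<gamma> w) w
        = real_cond_exp G (sig XZv) (\<lambda>w. \<gamma> w * U w) w - real_cond_exp G (sig XZv) (\<lambda>w. c1 * \<gamma> w) w"
      using gamma_integrable by (intro XZ.real_cond_exp_diff igU) auto
    moreover have "AE w in G. real_cond_exp G (sig XZv) (\<lambda>w. c1 * \<gamma> w) w = c1 * real_cond_exp G (sig XZv) \<gamma> w"
      by (rule XZ.real_cond_exp_cmult[OF gamma_integrable])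
    moreover have "AE w in G. real_cond_exp G (sig XZv) g w
        = real_cond_exp G (sig XZv) gp w - real_cond_exp G (sig XZv) gm w"
    proof -
      have "(\<lambda>w. gp w - gm w) = g" by (auto simp: gp_def gm_def fun_eq_iff)
      then show ?thesis
        using XZ.real_cond_exp_diff[OF G.integrable_bounded[OF gp_full gpb] G.integrable_bounded[OF gm_full gmb]]
        by simp
    qed
    ultimately show ?thesis
      using ratio_eq[OF gs_full bgs] ratio_eq[OF gp_full gpb] ratio_eq[OF gm_full gmb] beta_eq
      unfolding gs G.cexp_eq u_def h_def
    proof eventually_elim
      case (elim w)
      show ?case using elim beta_pos[of w] by (simp add: field_simps)
    qed
  qed
  have d_sq: "sq_int G (\<lambda>w. cexp G XZv g w - u w)"
    by (intro sq_int_diff u_sq G.cexp_contraction(1)[OF measurable_XZv]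
        G.sq_int_bounded[OF to_G[OF g_full] AE_I2[OF g(2)]])
  have le: "AE w in G. \<bar>h w\<bar> \<le> \<bar>cexp G XZv g w - u w\<bar> / b"
    using h_eq
  proof eventually_elim
    case (elim w)
    show ?case unfolding elim abs_divide
      using beta_ge[of w] beta_pos[of w] b_pos by (intro frac_le) auto
  qed
  define Y where "Y w = of_bool (\<not> Rv w) * h w" for w
  note Y = nonrespondents_l2_norm[OF h_sig d_sq le, folded Y_def]
  define T where "T w = S1 (obs w) + S2 (obs w) - S3 (obs w)" for w
  have T_sq: "sq_int P T" unfolding T_def by (intro sq_int_diff sq_int_add d1(1) d2(1) d3(1))
  have X_eq: "AE w in P. T w - infl_fn w = Y w + c0"
    using U_eq
  proof eventually_elim
    case (elim w)
    then show ?case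
      by (cases "Rv w") (auto simp: T_def S1 S2 S3 Y_def h_def s_def c0_def m_def uncentred_infl_def)
  qed
  have X_sq: "sq_int P (\<lambda>w. T w - infl_fn w)" by (rule sq_int_diff[OF T_sq infl_fn_sq_int])
  have "(\<integral>w. T w - infl_fn w \<partial>P) = (\<integral>w. T w \<partial>P) - (\<integral>w. infl_fn w \<partial>P)"
    by (rule Bochner_Integration.integral_diff[OF sq_int_integrable[OF T_sq] sq_int_integrable[OF infl_fn_sq_int]])
  also have "(\<integral>w. T w \<partial>P) = 0"
    unfolding T_def using sq_int_integrable[OF d1(1)] sq_int_integrable[OF d2(1)] sq_int_integrable[OF d3(1)]
    by (simp add: d1(2) d2(2) d3(2))
  finally have "0 = (\<integral>w. Y w + c0 \<partial>P)"
    using infl_fn_mean integral_cong_AE[OF _ _ X_eq] X_sq Y(1) by (auto simp: sq_int_def)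
  also have "\<dots> = (\<integral>w. Y w \<partial>P) + c0" using sq_int_integrable[OF Y(1)] by simp
  finally have c0: "\<bar>c0\<bar> \<le> l2_norm P Y"
    using integral_abs_bound[of P Y] integral_abs_le_l2_norm[OF Y(1)] by linarith
  have "l2_norm P (\<lambda>w. T w - infl_fn w) = l2_norm P (\<lambda>w. Y w + c0)"
    unfolding l2_norm_def
  proof (intro arg_cong[where f = sqrt] integral_cong_AE)
    show "AE w in P. (T w - infl_fn w)\<^sup>2 = (Y w + c0)\<^sup>2" using X_eq by eventually_elim simp
  qed (use X_sq Y(1) in \<open>auto simp: sq_int_def\<close>)
  also have "\<dots> \<le> l2_norm P Y + l2_norm P (\<lambda>_. c0)"
    by (rule l2_norm_triangle[OF Y(1) sq_int_bounded[of "\<lambda>_. c0" "\<bar>c0\<bar>"]]) auto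
  also have "l2_norm P (\<lambda>_. c0) = \<bar>c0\<bar>" by (simp add: l2_norm_def)
  also have "l2_norm P Y + \<bar>c0\<bar> \<le> 2 * l2_norm P Y" using c0 by simp
  also have "\<dots> \<le> 2 * (sqrt K / b * l2_norm G (\<lambda>w. cexp G XZv g w - u w))" using Y(2) by simp
  also have "\<dots> \<le> 2 * (sqrt K / b * e')"
    using g(3) b_pos K_nonneg by (intro mult_left_mono) auto
  also have "\<dots> = e * (sqrt K / (sqrt K + 1))"
  proof -
    have "2 * (x / b * (e * b / (2 * y))) = e * (x / y)" for x y using b_pos by simp
    then show ?thesis unfolding e'_def .
  qed
  also have "\<dots> < e"
  proof -
    have "sqrt K / (sqrt K + 1) < 1" using K_nonneg by (simp add: add_nonneg_pos)
    then show ?thesis using mult_strict_left_mono[OF _ e, of "sqrt K / (sqrt K + 1)" 1] by simp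
  qed
  finally have close: "l2_norm P (\<lambda>w. T w - infl_fn w) < e" .
  define SS where "SS j = (if j = 0 then S1 else if j = 1 then S2 else S3)" for j :: nat
  define QQ where "QQ j = (if j = 0 then Q1 else if j = 1 then Q2 else Q3)" for j :: nat
  define DD where "DD j = (if j = 0 then D1 else if j = 1 then D2 else D3)" for j :: nat
  define aa where "aa j = (if j = 2 then - 1 else 1 :: real)" for j :: nat
  have sum: "(\<Sum>j<(3::nat). aa j * SS j (obs w)) = T w" for w
    by (simp add: numeral_3_eq_3 aa_def SS_def T_def)
  have reg: "\<forall>j<3. regular_submodel \<tau> P (QQ j) (SS j) (DD j)"
    using sub1 sub2 sub3 by (auto simp: QQ_def SS_def DD_def S1_def S2_def S3_def)
  have "(\<forall>j<3. regular_submodel \<tau> P (QQ j) (SS j) (DD j))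
    \<and> sq_int P (\<lambda>w. \<Sum>j<(3::nat). aa j * SS j (obs w))
    \<and> l2_norm P (\<lambda>w. (\<Sum>j<3. aa j * SS j (obs w)) - infl_fn w) < e"
    unfolding sum using reg T_sq close by simp
  then show ?thesis by blast
qed

lemma score_combination:
  assumes "\<forall>j<(N::nat). regular_submodel \<tau> P (Q j) (S j) (D j)"
  shows "sq_int P (\<lambda>w. \<Sum>j<N. a j * S j (obs w))"
    "(\<Sum>j<N. a j * D j) = (\<integral>w. (\<Sum>j<N. a j * S j (obs w)) * infl_fn w \<partial>P)"
    "(\<integral>v. (\<Sum>j<N. a j * S j v)\<^sup>2 \<partial>obs_law P) = (\<integral>w. (\<Sum>j<N. a j * S j (obs w))\<^sup>2 \<partial>P)"
proof -
  have d: "sq_int P (\<lambda>w. S j (obs w))" "D j = (\<integral>w. S j (obs w) * infl_fn w \<partial>P)" if "j < N" for j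
    using submodel_derivative[of "Q j" "S j" "D j"] assms that by auto
  have S_full: "S j \<in> borel_measurable full_space" if "j < N" for j
    using assms that measurable_cong_sets[OF sets_obs_law refl, of borel]
    unfolding regular_submodel_def qmd_def by auto
  show "sq_int P (\<lambda>w. \<Sum>j<N. a j * S j (obs w))"
    by (intro sq_int_sum sq_int_scale d) auto
  have "(\<integral>w. (\<Sum>j<N. a j * S j (obs w)) * infl_fn w \<partial>P) = (\<integral>w. (\<Sum>j<N. a j * (S j (obs w) * infl_fn w)) \<partial>P)"
    by (simp add: sum_distrib_right mult.assoc)
  also have "\<dots> = (\<Sum>j<N. \<integral>w. a j * (S j (obs w) * infl_fn w) \<partial>P)"
    by (intro Bochner_Integration.integral_sum integrable_mult_right sq_int_mult_integrable d infl_fn_sq_int) auto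
  also have "\<dots> = (\<Sum>j<N. a j * D j)" by (intro sum.cong refl) (simp add: d)
  finally show "(\<Sum>j<N. a j * D j) = (\<integral>w. (\<Sum>j<N. a j * S j (obs w)) * infl_fn w \<partial>P)" ..
  show "(\<integral>v. (\<Sum>j<N. a j * S j v)\<^sup>2 \<partial>obs_law P) = (\<integral>w. (\<Sum>j<N. a j * S j (obs w))\<^sup>2 \<partial>P)"
    using S_full by (intro integral_obs_law(2)) auto
qed

text \<open>Every quotient is at most the squared norm of the influence function by the Cauchy-Schwarz inequality,
  and it is continuous in the score near the influence function, where it takes that value.\<close>

theorem efficiency_bound_eq: "efficiency_bound \<tau> P = ennreal (\<integral>w. (infl_fn w)\<^sup>2 \<partial>P)"
proof (rule antisym)
  define B where "B = (\<integral>w. (infl_fn w)\<^sup>2 \<partial>P)"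
  have lB: "l2_norm P infl_fn = sqrt B" by (simp add: l2_norm_def B_def)
  have B0: "0 \<le> B" by (simp add: B_def)
  let ?A = "{ennreal ((\<Sum>j<N. c j * D j)\<^sup>2 / I) | N c Q S D I.
        (\<forall>j<N. regular_submodel \<tau> P (Q j) (S j) (D j))
        \<and> I = (\<integral>w. (\<Sum>j<(N::nat). c j * S j w)\<^sup>2 \<partial>obs_law P) \<and> I > 0}"
  show "efficiency_bound \<tau> P \<le> ennreal (\<integral>w. (infl_fn w)\<^sup>2 \<partial>P)"
    unfolding efficiency_bound_def
  proof (rule Sup_least)
    fix x assume "x \<in> ?A"
    then obtain N c Q S D I where x: "x = ennreal ((\<Sum>j<(N::nat). c j * D j)\<^sup>2 / I)"
      and reg: "\<forall>j<N. regular_submodel \<tau> P (Q j) (S j) (D j)"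
      and I: "I = (\<integral>w. (\<Sum>j<N. c j * S j w)\<^sup>2 \<partial>obs_law P)" and I0: "0 < I" by blast
    note sc = score_combination[OF reg, of c]
    define T where "T w = (\<Sum>j<N. c j * S j (obs w))" for w
    have T: "sq_int P T" using sc(1) by (simp add: T_def[abs_def])
    have "\<bar>\<integral>w. T w * infl_fn w \<partial>P\<bar> \<le> l2_norm P T * sqrt B"
      using abs_integral_cauchy_schwarz[OF T infl_fn_sq_int] by (simp add: lB)
    then have "(\<integral>w. T w * infl_fn w \<partial>P)\<^sup>2 \<le> (l2_norm P T * sqrt B)\<^sup>2"
      by (subst abs_le_square_iff[symmetric]) (simp add: B0 abs_mult)
    also have "\<dots> = I * B" unfolding power_mult_distrib l2_norm_sq using B0 by (simp add: I sc(3) T_def)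
    finally have "(\<Sum>j<N. c j * D j)\<^sup>2 \<le> I * B" by (simp add: sc(2) T_def)
    then have "(\<Sum>j<N. c j * D j)\<^sup>2 / I \<le> B" using I0 by (simp add: pos_divide_le_eq mult.commute)
    then show "x \<le> ennreal (\<integral>w. (infl_fn w)\<^sup>2 \<partial>P)" unfolding x B_def[symmetric] by (rule ennreal_leI)
  qed
  show "ennreal (\<integral>w. (infl_fn w)\<^sup>2 \<partial>P) \<le> efficiency_bound \<tau> P"
  proof (cases "B = 0")
    case True
    then show ?thesis by (simp add: B_def)
  next
    case False
    then have Bpos: "0 < B" using B0 by simp
    have approx: "\<exists>T. sq_int P T \<and> l2_norm P (\<lambda>w. T w - infl_fn w) < e
      \<and> (0 < (\<integral>w. (T w)\<^sup>2 \<partial>P) \<longrightarrow>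
        ennreal ((\<integral>w. T w * infl_fn w \<partial>P)\<^sup>2 / (\<integral>w. (T w)\<^sup>2 \<partial>P)) \<le> efficiency_bound \<tau> P)"
      if e: "0 < e" for e
    proof -
      obtain N a Q S D where reg: "\<forall>j<(N::nat). regular_submodel \<tau> P (Q j) (S j) (D j)"
        and sq: "sq_int P (\<lambda>w. \<Sum>j<N. a j * S j (obs w))"
        and close: "l2_norm P (\<lambda>w. (\<Sum>j<N. a j * S j (obs w)) - infl_fn w) < e"
        using score_approximation[OF e] by blast
      note sc = score_combination[OF reg, of a]
      define T where "T w = (\<Sum>j<N. a j * S j (obs w))" for w
      have "ennreal ((\<integral>w. T w * infl_fn w \<partial>P)\<^sup>2 / (\<integral>w. (T w)\<^sup>2 \<partial>P)) \<le> efficiency_bound \<tau> P"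
        if pos: "0 < (\<integral>w. (T w)\<^sup>2 \<partial>P)"
        unfolding efficiency_bound_def
      proof (rule Sup_upper)
        show "ennreal ((\<integral>w. T w * infl_fn w \<partial>P)\<^sup>2 / (\<integral>w. (T w)\<^sup>2 \<partial>P)) \<in> ?A"
          using reg sc(2,3) pos
          by (intro CollectI exI[of _ N] exI[of _ a] exI[of _ Q] exI[of _ S] exI[of _ D]
              exI[of _ "\<integral>w. (T w)\<^sup>2 \<partial>P"]) (simp add: T_def)
      qed
      then show ?thesis using sq close by (intro exI[of _ T]) (simp add: T_def[abs_def])
    qed
    have "\<forall>n. \<exists>T. sq_int P T \<and> l2_norm P (\<lambda>w. T w - infl_fn w) < 1 / real (Suc n)
      \<and> (0 < (\<integral>w. (T w)\<^sup>2 \<partial>P) \<longrightarrow>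
        ennreal ((\<integral>w. T w * infl_fn w \<partial>P)\<^sup>2 / (\<integral>w. (T w)\<^sup>2 \<partial>P)) \<le> efficiency_bound \<tau> P)"
      by (intro allI approx) simp
    then obtain T where Tn: "\<forall>n. sq_int P (T n) \<and> l2_norm P (\<lambda>w. T n w - infl_fn w) < 1 / real (Suc n)
      \<and> (0 < (\<integral>w. (T n w)\<^sup>2 \<partial>P) \<longrightarrow>
        ennreal ((\<integral>w. T n w * infl_fn w \<partial>P)\<^sup>2 / (\<integral>w. (T n w)\<^sup>2 \<partial>P)) \<le> efficiency_bound \<tau> P)"
      by (rule choice[THEN exE])
    have T: "sq_int P (T n)" and close: "l2_norm P (\<lambda>w. T n w - infl_fn w) \<le> 1 / real (Suc n)" for n
      using Tn by (auto simp: less_imp_le)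
    have diff: "sq_int P (\<lambda>w. T n w - infl_fn w)" for n by (rule sq_int_diff[OF T infl_fn_sq_int])
    have inv0: "(\<lambda>n. 1 / real (Suc n)) \<longlonglongrightarrow> 0" by (rule LIMSEQ_inverse_real_of_nat[unfolded inverse_eq_divide])
    have "(\<lambda>n. (\<integral>w. T n w * infl_fn w \<partial>P) - B) \<longlonglongrightarrow> 0"
    proof (rule Lim_null_comparison)
      show "\<forall>\<^sub>F n in sequentially. norm ((\<integral>w. T n w * infl_fn w \<partial>P) - B) \<le> 1 / real (Suc n) * sqrt B"
      proof (intro always_eventually allI)
        fix n
        have "(\<integral>w. T n w * infl_fn w \<partial>P) - B = (\<integral>w. T n w * infl_fn w - (infl_fn w)\<^sup>2 \<partial>P)"
          unfolding B_def using sq_int_mult_integrable[OF T[of n] infl_fn_sq_int] sq_intD(2)[OF infl_fn_sq_int] by simp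
        also have "\<dots> = (\<integral>w. (T n w - infl_fn w) * infl_fn w \<partial>P)"
          by (simp add: power2_eq_square algebra_simps)
        finally have "norm ((\<integral>w. T n w * infl_fn w \<partial>P) - B) \<le> l2_norm P (\<lambda>w. T n w - infl_fn w) * sqrt B"
          using abs_integral_cauchy_schwarz[OF diff[of n] infl_fn_sq_int] by (simp add: lB)
        also have "\<dots> \<le> 1 / real (Suc n) * sqrt B" using B0 by (intro mult_right_mono close) simp
        finally show "norm ((\<integral>w. T n w * infl_fn w \<partial>P) - B) \<le> 1 / real (Suc n) * sqrt B" .
      qed
      show "(\<lambda>n. 1 / real (Suc n) * sqrt B) \<longlonglongrightarrow> 0" using tendsto_mult_left_zero[OF inv0] .
    qed
    then have num: "(\<lambda>n. \<integral>w. T n w * infl_fn w \<partial>P) \<longlonglongrightarrow> B" by (rule LIM_zero_cancel)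
    have "(\<lambda>n. l2_norm P (T n) - sqrt B) \<longlonglongrightarrow> 0"
    proof (rule Lim_null_comparison[OF _ inv0])
      show "\<forall>\<^sub>F n in sequentially. norm (l2_norm P (T n) - sqrt B) \<le> 1 / real (Suc n)"
      proof (intro always_eventually allI)
        fix n
        have "l2_norm P (T n) \<le> l2_norm P (\<lambda>w. T n w - infl_fn w) + sqrt B"
          using l2_norm_triangle[OF diff[of n] infl_fn_sq_int] by (simp add: lB)
        moreover have "sqrt B \<le> l2_norm P (T n) + l2_norm P (\<lambda>w. T n w - infl_fn w)"
          using l2_norm_triangle_diff[OF T[of n] diff[of n]] by (simp add: lB)
        ultimately show "norm (l2_norm P (T n) - sqrt B) \<le> 1 / real (Suc n)"
          using close[of n] unfolding real_norm_def by linarith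
      qed
    qed
    then have "(\<lambda>n. l2_norm P (T n)) \<longlonglongrightarrow> sqrt B" by (rule LIM_zero_cancel)
    then have "(\<lambda>n. (l2_norm P (T n))\<^sup>2) \<longlonglongrightarrow> (sqrt B)\<^sup>2" by (rule tendsto_power)
    then have den: "(\<lambda>n. \<integral>w. (T n w)\<^sup>2 \<partial>P) \<longlonglongrightarrow> B" using B0 by (simp add: l2_norm_sq)
    have "(\<lambda>n. (\<integral>w. T n w * infl_fn w \<partial>P)\<^sup>2 / (\<integral>w. (T n w)\<^sup>2 \<partial>P)) \<longlonglongrightarrow> B\<^sup>2 / B"
      using Bpos by (intro tendsto_intros num den) simp
    then have lim: "(\<lambda>n. ennreal ((\<integral>w. T n w * infl_fn w \<partial>P)\<^sup>2 / (\<integral>w. (T n w)\<^sup>2 \<partial>P))) \<longlonglongrightarrow> ennreal B"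
      using Bpos by (intro tendsto_ennrealI) (simp add: power2_eq_square)
    have "\<forall>\<^sub>F n in sequentially. 0 < (\<integral>w. (T n w)\<^sup>2 \<partial>P)"
      by (rule order_tendstoD(1)[OF den Bpos])
    then have ev: "\<forall>\<^sub>F n in sequentially.
        ennreal ((\<integral>w. T n w * infl_fn w \<partial>P)\<^sup>2 / (\<integral>w. (T n w)\<^sup>2 \<partial>P)) \<le> efficiency_bound \<tau> P"
      by eventually_elim (use Tn in blast)
    show ?thesis unfolding B_def[symmetric]
      by (rule tendsto_upperbound[OF lim ev]) simp
  qed
qed

end

section \<open>Bounded representers and the efficiency bound\<close>

text \<open>The complement of the support is a union of null open sets, and countably many basic ones suffice.\<close>

lemma AE_in_msupport:
  fixes M :: "'a::second_countable_topology measure"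
  assumes sets: "sets M = sets borel"
  shows "AE x in M. x \<in> msupport M"
proof -
  obtain B :: "'a set set" where B: "countable B" "topological_basis B" using ex_countable_basis by blast
  define N where "N = \<Union>{U \<in> B. emeasure M U = 0}"
  have "U \<in> sets M" if "U \<in> B" for U
    using topological_basis_open[OF B(2) that] sets by auto
  then have "N \<in> null_sets M"
    unfolding N_def using B(1) by (intro null_sets_UN'[of _ "\<lambda>U. U", simplified]) (auto intro: null_setsI)
  moreover have "{x \<in> space M. x \<notin> msupport M} \<subseteq> N"
  proof
    fix x assume "x \<in> {x \<in> space M. x \<notin> msupport M}"
    then obtain U where U: "open U" "x \<in> U" "emeasure M U = 0"
      unfolding msupport_def by (auto simp: zero_less_iff_neq_zero)
    then obtain V where V: "V \<in> B" "x \<in> V" "V \<subseteq> U" using topological_basisE[OF B(2)] by metis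
    then have "emeasure M V \<le> emeasure M U" using U sets by (intro emeasure_mono) auto
    then show "x \<in> N" using U V by (auto simp: N_def)
  qed
  ultimately show ?thesis by (intro AE_I'[of N]) auto
qed

lemma (in full_law) AE_in_dom_XZ: "AE w in Q. XZv w \<in> dom_XZ Q"
proof -
  have "AE w in Q. Xv w \<in> msupport (distr Q borel Xv)"
    by (rule AE_distrD[of Xv Q borel]) (auto simp: measurable_Q intro!: AE_in_msupport)
  moreover have "AE w in Q. Zv w \<in> msupport (distr Q borel Zv)"
    by (rule AE_distrD[of Zv Q borel]) (auto simp: measurable_Q intro!: AE_in_msupport)
  ultimately show ?thesis by eventually_elim (simp add: dom_XZ_def XZv_def)
qed

text \<open>The multi-index $0$ contributes the supremum of $|\rho|$ to the norm.\<close>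

lemma holder_norm_bounded:
  fixes S :: "'a::euclidean_space set"
  assumes "holder_norm S \<alpha> \<rho> < \<infinity>"
  obtains C where "\<And>w. w \<in> S \<Longrightarrow> \<bar>\<rho> w\<bar> \<le> C"
proof -
  let ?m = "floor_below \<alpha>"
  let ?a = "\<lambda>D. (SUP l \<in> (\<Union>j\<le>?m. multi_indices j). SUP w\<in>S. ennreal \<bar>D l w\<bar>)"
  obtain D where D: "partials S ?m \<rho> D" and fin: "?a D < \<infinity>"
    using assms unfolding holder_norm_def INF_less_iff by (auto intro: le_less_trans[OF add_increasing2[OF zero_le order_refl]])
  have z: "(\<lambda>_. 0) \<in> (\<Union>j\<le>?m. multi_indices j :: ('a \<Rightarrow> nat) set)"
    by (auto simp: multi_indices_def intro!: bexI[of _ 0])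
  have "\<bar>\<rho> w\<bar> \<le> enn2real (?a D)" if "w \<in> S" for w
  proof -
    have "ennreal \<bar>\<rho> w\<bar> = ennreal \<bar>D (\<lambda>_. 0) w\<bar>" using D that by (simp add: partials_def)
    also have "\<dots> \<le> (SUP w\<in>S. ennreal \<bar>D (\<lambda>_. 0) w\<bar>)" using that by (rule SUP_upper)
    also have "\<dots> \<le> ?a D" using z by (rule SUP_upper)
    finally have "ennreal \<bar>\<rho> w\<bar> \<le> ennreal (enn2real (?a D))" using fin by (simp add: less_top)
    then show ?thesis by (simp add: ennreal_le_iff)
  qed
  then show thesis by (rule that)
qed

theorem corollary2:
  fixes P :: "('d::finite) full measure"
    and \<tau> :: "(real ^ 'd) \<times> real \<Rightarrow> real"
    and \<Delta> :: "((real ^ 'd) \<times> real \<Rightarrow> real) set"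
    and \<psi> \<phi> :: "nat \<Rightarrow> (real ^ 'd) \<times> real \<Rightarrow> real"
    and q k :: "nat \<Rightarrow> nat"
    and \<eta> \<xi> :: "nat \<Rightarrow> real"
    and \<alpha> :: real
    and M :: "((real ^ 'd) \<times> real \<Rightarrow> real) \<Rightarrow> real"
    and Mn :: "'d obs list \<Rightarrow> ((real ^ 'd) \<times> real \<Rightarrow> real) \<Rightarrow> real"
    and \<delta>0 h0 :: "(real ^ 'd) \<times> real \<Rightarrow> real"
  assumes model: "M_np P"
    and tau: "\<tau> \<in> borel_measurable borel"
    and Delta: "\<Delta> \<subseteq> extensional (dom_XZ P)" "\<Delta> \<subseteq> borel_measurable borel"
    and phi: "\<And>i. \<phi> i \<in> borel_measurable borel"
    and k_pos: "\<And>n. k n \<ge> 1"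
    and xi: "\<And>n. n \<ge> 1 \<Longrightarrow> bdd_above (basis_norm \<phi> (k n) ` dom_XY P)"
            "\<And>n. n \<ge> 1 \<Longrightarrow> \<xi> n = (SUP w\<in>dom_XY P. basis_norm \<phi> (k n) w)"
    and A1: "cond_indep P Zv borel Rv (count_space UNIV) XYv"
            "\<not> cond_indep P Zv borel Yv borel Xv"
    and A2: "\<exists>\<delta>\<in>L2 P XZv. AE w in given_R1 P. Tadj P \<delta> w = \<tau> (XYv w)"
    and A3: "msupport (distr P borel Xv) = {x. \<forall>i. 0 \<le> x $ i \<and> x $ i \<le> 1}"
            "compact (msupport (distr P borel Yv))"
            "compact (msupport (distr P borel Zv))"
    and A4i: "\<alpha> > (real CARD('d) + 1) / 2"
             "(SUP \<delta>\<in>\<Delta>. holder_norm (dom_XZ P) \<alpha> \<delta>) < \<infinity>"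
             "representers \<tau> P \<Delta> \<noteq> {}"
             "supnorm_closed (dom_XZ P) \<Delta>"
             "\<And>n. n \<ge> 1 \<Longrightarrow> supnorm_closed (dom_XZ P) (sieve (dom_XZ P) \<Delta> \<psi> (q n))"
    and A4ii: "\<exists>proj C. (\<forall>n\<ge>1. \<forall>\<delta>\<in>\<Delta>. proj n \<delta> \<in> sieve (dom_XZ P) \<Delta> \<psi> (q n)) \<and>
                 (\<forall>\<^sub>F n in sequentially. \<forall>\<delta>\<in>\<Delta>. \<forall>w\<in>dom_XZ P. \<bar>\<delta> w - proj n \<delta> w\<bar> \<le> C * \<bar>\<eta> n\<bar>)"
              "\<eta> \<in> o(\<lambda>_. 1)"
    and A5i: "\<exists>c C. 0 < c \<and> (\<forall>n\<ge>1. \<forall>e. is_eigenvalue (k n) (gram P \<phi>) e \<longrightarrow> c \<le> e \<and> e \<le> C)"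
    and A5ii: "\<exists>\<pi> C. \<forall>\<^sub>F n in sequentially. \<forall>\<delta>\<in>\<Delta>. AE w in given_R1 P.
                 \<bar>Tadj P \<delta> w - (\<Sum>i=1..k n. \<phi> i (XYv w) * \<pi> n \<delta> i)\<bar>
                   \<le> C * real (k n) powr (- \<alpha> / (real CARD('d) + 1))"
    and A5iii: "(\<lambda>n. (\<xi> n)\<^sup>2 * real (k n)) \<in> o(\<lambda>n. real n)"
    and A6: "convex_class (dom_XZ P) \<Delta>"
            "strictly_convex (dom_XZ P) \<Delta> M"
            "\<delta>0 \<in> representers \<tau> P \<Delta>"
            "\<And>\<delta>. \<delta> \<in> representers \<tau> P \<Delta> \<Longrightarrow> \<delta> \<noteq> \<delta>0 \<Longrightarrow> M \<delta>0 < M \<delta>"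
            "\<And>n \<delta>. n \<ge> 1 \<Longrightarrow> \<delta> \<in> \<Delta> \<Longrightarrow> (\<lambda>\<omega>. Mn (sample n \<omega>) \<delta>) \<in> borel_measurable (iid P)"
            "\<And>n. n \<ge> 1 \<Longrightarrow> AE \<omega> in iid P. supnorm_continuous (dom_XZ P) \<Delta> (Mn (sample n \<omega>))"
            "uniformly_op1 (iid P) \<Delta> (\<lambda>n \<omega>. Mn (sample n \<omega>)) M"
    and A7i: "h0 \<in> \<Delta>"
             "\<And>\<delta>. \<delta> \<in> w_closure P \<Delta> \<Longrightarrow>
                w_inner P h0 \<delta> = (\<integral>w. of_bool (\<not> Rv w) * \<delta> (XZv w) \<partial>P)"
    and A7ii: "\<eta> \<in> o(\<lambda>n. real n powr (- 1 / 3))"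
              "(\<lambda>n. real (k n) powr (- 3 * \<alpha> / (real CARD('d) + 1))) \<in> o(\<lambda>n. 1 / real n)"
              "(\<lambda>n. real (k n) ^ 3) \<in> o(\<lambda>n. real n)"
              "(\<lambda>n. (\<xi> n)\<^sup>2 * (real (k n))\<^sup>2) \<in> o(\<lambda>n. real n)"
              "(\<lambda>n. (\<xi> n)\<^sup>2 * real (k n) powr (- 2 * \<alpha> / (real CARD('d) + 1))) \<in> o(\<lambda>_. 1)"
    and A8i: "\<And>g. g \<in> L2 P XYv \<Longrightarrow>
                (AE w in given_R1 P. Top P g w = 0) \<longleftrightarrow> (AE w in given_R1 P. g (XYv w) = 0)"
             "\<And>g. g \<in> L2 P XZv \<Longrightarrow>
                (AE w in given_R1 P. Tadj P g w = 0) \<longleftrightarrow> (AE w in given_R1 P. g (XZv w) = 0)"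
    and A8ii: "\<exists>c C. 0 < c \<and> (AE w in given_R1 P.
                 c \<le> cexp (given_R1 P) XZv (\<lambda>w. (odds P XYv w - odds P XZv w)\<^sup>2) w \<and>
                 cexp (given_R1 P) XZv (\<lambda>w. (odds P XYv w - odds P XZv w)\<^sup>2) w \<le> C)"
    and A8iii: "\<exists>C. \<forall>g\<in>L2 P XYv.
                  (\<integral>w. (Top P g w)\<^sup>2 \<partial>given_R1 P) \<le> C * (\<integral>w. (g (XYv w))\<^sup>2 \<partial>given_R1 P)"
               "\<exists>C. \<forall>g\<in>L2 P XZv.
                  (\<integral>w. (Tadj P g w)\<^sup>2 \<partial>given_R1 P) \<le> C * (\<integral>w. (g (XZv w))\<^sup>2 \<partial>given_R1 P)"
    and h0_eq: "AE w in given_R1 P. Tadj P (\<lambda>v. h0 v + 1) w = 1 / propensity P XYv w"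
  shows "integrable P (\<lambda>w. (infl \<tau> P \<delta>0 h0 w)\<^sup>2) \<and>
         ennreal (\<integral>w. (infl \<tau> P \<delta>0 h0 w - (\<integral>v. infl \<tau> P \<delta>0 h0 v \<partial>P))\<^sup>2 \<partial>P)
           = efficiency_bound \<tau> P"
proof -
  note D = model_lawD[OF model]
  interpret full_law P by (rule D(1))
  note p0 = resp_pos[OF measurable_XYv D(2)]
  interpret G: full_law "given_R1 P" by (rule full_law_given_R1[OF p0])
  let ?G = "given_R1 P"
  interpret XY: sigma_finite_subalgebra ?G "sig XYv" by (rule G.sigma_finite_sig[OF measurable_XYv])
  interpret XZ: sigma_finite_subalgebra ?G "sig XZv" by (rule G.sigma_finite_sig[OF measurable_XZv])
  have toG: "f \<in> borel_measurable full_space \<Longrightarrow> f \<in> borel_measurable ?G" for f :: "'d full \<Rightarrow> real"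
    using G.measurable_Q by auto
  have toP: "f \<in> borel_measurable full_space \<Longrightarrow> f \<in> borel_measurable P" for f :: "'d full \<Rightarrow> real"
    using measurable_Q by auto
  have bounded: "\<exists>C. \<forall>w\<in>dom_XZ P. \<bar>\<delta> w\<bar> \<le> C" if "\<delta> \<in> \<Delta>" for \<delta>
  proof -
    have "holder_norm (dom_XZ P) \<alpha> \<delta> < \<infinity>"
      using le_less_trans[OF SUP_upper[OF that] A4i(2)] .
    then show ?thesis by (rule holder_norm_bounded) blast
  qed
  have \<delta>0: "\<delta>0 \<in> \<Delta>" and rep: "AE w in ?G. Tadj P \<delta>0 w = \<tau> (XYv w)"
    using A6(3) by (auto simp: representers_def)
  obtain C1 where C1: "\<And>w. w \<in> dom_XZ P \<Longrightarrow> \<bar>\<delta>0 w\<bar> \<le> C1" using bounded[OF \<delta>0] by blast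
  obtain C2 where C2: "\<And>w. w \<in> dom_XZ P \<Longrightarrow> \<bar>h0 w\<bar> \<le> C2" using bounded[OF A7i(1)] by blast
  define K where "K = 1 + \<bar>C1\<bar> + \<bar>C2\<bar>"
  have K1: "1 \<le> K" by (simp add: K_def)
  have dm [measurable]: "\<delta>0 \<in> borel_measurable borel" and hm [measurable]: "h0 \<in> borel_measurable borel"
    using Delta(2) \<delta>0 A7i(1) by auto
  have bd: "AE w in P. \<bar>\<delta>0 (XZv w)\<bar> \<le> K" and bh: "AE w in P. \<bar>h0 (XZv w)\<bar> \<le> K - 1"
    using AE_in_dom_XZ by (eventually_elim, fastforce simp: K_def dest: C1, eventually_elim, fastforce simp: K_def dest: C2)
  note bhG = AE_given_R1_I[OF p0 bh]
  have hG: "(\<lambda>w. h0 (XZv w)) \<in> borel_measurable ?G" by (rule toG) measurable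
  have ih: "integrable ?G (\<lambda>w. h0 (XZv w))"
    by (rule G.integrable_const_bound[OF _ hG, where B = "K - 1"]) (use bhG in simp)
  \<comment> \<open>The equation for \<open>h0\<close> identifies $E(h_0\mid R=1,X,Y)$ with the odds, which are therefore bounded.\<close>
  have "AE w in ?G. real_cond_exp ?G (sig XYv) (\<lambda>w. h0 (XZv w) + 1) w
      = real_cond_exp ?G (sig XYv) (\<lambda>w. h0 (XZv w)) w + real_cond_exp ?G (sig XYv) (\<lambda>_. 1) w"
    by (rule XY.real_cond_exp_add[OF ih]) simp
  moreover have "AE w in ?G. real_cond_exp ?G (sig XYv) (\<lambda>_. 1) w = 1"
    by (rule XY.real_cond_exp_F_meas) auto
  ultimately have h_odds: "AE w in ?G. Tadj P h0 w = odds P XYv w"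
    using h0_eq AE_given_R1_I[OF p0 odds_eq(2)[OF measurable_XYv D(2)]]
    unfolding Tadj_def G.cexp_eq by eventually_elim simp
  have "AE w in ?G. real_cond_exp ?G (sig XYv) (\<lambda>w. h0 (XZv w)) w \<le> K"
    by (rule XY.real_cond_exp_le_c[OF ih]) (use bhG in eventually_elim, auto)
  then have "AE w in ?G. odds P XYv w \<le> K"
    using h_odds unfolding Tadj_def G.cexp_eq by eventually_elim simp
  moreover have "Measurable.pred (sig XYv) (\<lambda>w. odds P XYv w \<le> K)" by measurable
  ultimately have odds_le: "AE w in P. odds P XYv w \<le> K"
    by (intro AE_of_AE_given_R1[OF measurable_XYv D(2)])
  define \<gamma> where "\<gamma> w = max 0 (min K (odds P XYv w))" for w
  have g_sig: "\<gamma> \<in> borel_measurable (sig XYv)" unfolding \<gamma>_def by measurable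
  have g0: "0 \<le> \<gamma> w" and gK: "\<gamma> w \<le> K" for w using K1 by (auto simp: \<gamma>_def)
  have g_odds: "AE w in P. odds P XYv w = \<gamma> w"
    using odds_le odds_nonneg[OF measurable_XYv] by eventually_elim (simp add: \<gamma>_def)
  note g_oddsG = AE_given_R1_I[OF p0 g_odds]
  have gG [measurable]: "\<gamma> \<in> borel_measurable ?G" by (rule G.sig_borel[OF measurable_XYv g_sig])
  have oG [measurable]: "odds P V \<in> borel_measurable ?G" for V :: "'d full \<Rightarrow> (real ^ 'd) \<times> real"
    using odds_measurable measurable_given_R1 by auto
  have ig: "integrable ?G \<gamma>" by (rule G.integrable_const_bound[where B = K]) (auto simp: g0 gK)
  have "AE w in ?G. real_cond_exp ?G (sig XZv) (odds P XYv) w = real_cond_exp ?G (sig XZv) \<gamma> w"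
    by (rule XZ.real_cond_exp_cong[OF g_oddsG]) auto
  then have beta_odds: "AE w in ?G. real_cond_exp ?G (sig XZv) \<gamma> w = odds P XZv w"
    using D(4) unfolding G.cexp_eq by eventually_elim simp
  have le: "AE w in ?G. real_cond_exp ?G (sig XZv) \<gamma> w \<le> K" by (rule XZ.real_cond_exp_le_c[OF ig]) (simp add: gK)
  have ge: "AE w in ?G. 0 \<le> real_cond_exp ?G (sig XZv) \<gamma> w" by (rule XZ.real_cond_exp_ge_c[OF ig]) (simp add: g0)
  define \<beta>0 where "\<beta>0 w = max 0 (min K (odds P XZv w))" for w
  have b0_sig: "\<beta>0 \<in> borel_measurable (sig XZv)" unfolding \<beta>0_def by measurable
  have b0G [measurable]: "\<beta>0 \<in> borel_measurable ?G" by (rule G.sig_borel[OF measurable_XZv b0_sig])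
  have b0_01: "0 \<le> \<beta>0 w" "\<beta>0 w \<le> K" for w using K1 by (auto simp: \<beta>0_def)
  have ib0: "integrable ?G \<beta>0" by (rule G.integrable_const_bound[where B = K]) (auto simp: b0_01)
  have b0_odds: "AE w in ?G. odds P XZv w = \<beta>0 w"
    using beta_odds le ge by eventually_elim (simp add: \<beta>0_def)
  obtain c where c: "0 < c" and Omega: "AE w in ?G. c \<le> cexp ?G XZv (\<lambda>w. (odds P XYv w - odds P XZv w)\<^sup>2) w"
  proof -
    obtain c C where "0 < c" "AE w in ?G. c \<le> cexp ?G XZv (\<lambda>w. (odds P XYv w - odds P XZv w)\<^sup>2) w \<and>
      cexp ?G XZv (\<lambda>w. (odds P XYv w - odds P XZv w)\<^sup>2) w \<le> C" using A8ii by blast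
    then show thesis by (intro that[of c]) auto
  qed
  \<comment> \<open>From $c\le\Omega=E\{(\gamma-\beta)^2\mid R=1,X,Z\}\le E(K\gamma+K\beta\mid R=1,X,Z)=2K\beta$.\<close>
  define b where "b = c / (2 * K)"
  have b: "0 < b" using c K1 by (simp add: b_def)
  have b_le: "AE w in ?G. b \<le> real_cond_exp ?G (sig XZv) \<gamma> w"
  proof -
    have "AE w in ?G. real_cond_exp ?G (sig XZv) (\<lambda>w. (odds P XYv w - odds P XZv w)\<^sup>2) w
        = real_cond_exp ?G (sig XZv) (\<lambda>w. (\<gamma> w - \<beta>0 w)\<^sup>2) w"
    proof (rule XZ.real_cond_exp_cong)
      show "AE w in ?G. (odds P XYv w - odds P XZv w)\<^sup>2 = (\<gamma> w - \<beta>0 w)\<^sup>2"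
        using g_oddsG b0_odds by eventually_elim simp
    qed measurable
    moreover have "AE w in ?G. real_cond_exp ?G (sig XZv) (\<lambda>w. (\<gamma> w - \<beta>0 w)\<^sup>2) w
        \<le> real_cond_exp ?G (sig XZv) (\<lambda>w. K * \<gamma> w + K * \<beta>0 w) w"
    proof (rule XZ.real_cond_exp_mono)
      have "(\<gamma> w - \<beta>0 w)\<^sup>2 \<le> K * \<gamma> w + K * \<beta>0 w" for w
      proof -
        have "(\<gamma> w - \<beta>0 w)\<^sup>2 \<le> \<gamma> w * \<gamma> w + \<beta>0 w * \<beta>0 w"
          using mult_nonneg_nonneg[OF g0[of w] b0_01(1)[of w]] by (simp add: power2_eq_square algebra_simps)
        also have "\<dots> \<le> K * \<gamma> w + K * \<beta>0 w"
          using g0[of w] gK[of w] b0_01[of w] by (intro add_mono mult_right_mono) auto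
        finally show ?thesis .
      qed
      then show "AE w in ?G. (\<gamma> w - \<beta>0 w)\<^sup>2 \<le> K * \<gamma> w + K * \<beta>0 w" by simp
      have "\<bar>\<gamma> w - \<beta>0 w\<bar> \<le> K" for w using g0[of w] gK[of w] b0_01[of w] by linarith
      then have "sq_int ?G (\<lambda>w. \<gamma> w - \<beta>0 w)" by (intro G.sq_int_bounded[where K = K]) auto
      then show "integrable ?G (\<lambda>w. (\<gamma> w - \<beta>0 w)\<^sup>2)" by (simp add: sq_int_def)
    qed (use ig ib0 in auto)
    moreover have "AE w in ?G. real_cond_exp ?G (sig XZv) (\<lambda>w. K * \<gamma> w + K * \<beta>0 w) w
        = real_cond_exp ?G (sig XZv) (\<lambda>w. K * \<gamma> w) w + real_cond_exp ?G (sig XZv) (\<lambda>w. K * \<beta>0 w) w"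
      by (rule XZ.real_cond_exp_add) (use ig ib0 in auto)
    moreover have "AE w in ?G. real_cond_exp ?G (sig XZv) (\<lambda>w. K * \<gamma> w) w = K * real_cond_exp ?G (sig XZv) \<gamma> w"
      by (rule XZ.real_cond_exp_cmult[OF ig])
    moreover have "AE w in ?G. real_cond_exp ?G (sig XZv) (\<lambda>w. K * \<beta>0 w) w = K * \<beta>0 w"
      by (rule XZ.real_cond_exp_F_meas) (use ib0 b0_sig in auto)
    ultimately show ?thesis using Omega beta_odds b0_odds unfolding G.cexp_eq
    proof eventually_elim
      case (elim w)
      then have "c \<le> 2 * K * real_cond_exp ?G (sig XZv) \<gamma> w" by simp
      then show ?case using K1 by (simp add: b_def divide_le_eq mult.commute)
    qed
  qed
  define \<beta> where "\<beta> w = max b (cexp ?G XZv \<gamma> w)" for w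
  define \<delta> where "\<delta> v = clamp K (\<delta>0 v)" for v
  have d_meas [measurable]: "\<delta> \<in> borel_measurable borel" unfolding \<delta>_def by measurable
  have d_eq: "AE w in P. \<delta>0 (XZv w) = \<delta> (XZv w)"
    using bd by eventually_elim (simp add: \<delta>_def clamp_id)
  have "AE w in ?G. real_cond_exp ?G (sig XYv) (\<lambda>w. \<delta>0 (XZv w)) w = real_cond_exp ?G (sig XYv) (\<lambda>w. \<delta> (XZv w)) w"
    by (rule XY.real_cond_exp_cong[OF AE_given_R1_I[OF p0 d_eq]]) (auto intro: toG)
  then have rep': "AE w in ?G. cexp ?G XYv (\<lambda>w. \<delta> (XZv w)) w = \<tau> (XYv w)"
    using rep unfolding Tadj_def G.cexp_eq by eventually_elim simp
  interpret complete_model P \<tau> \<delta> \<gamma> K \<beta> b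
  proof (unfold_locales)
    show "\<bar>\<delta> v\<bar> \<le> K" for v unfolding \<delta>_def using K1 by (intro clamp_bounded) simp
    show "\<beta> \<in> borel_measurable (sig XZv)" unfolding \<beta>_def by measurable
    show "b \<le> \<beta> w" for w by (simp add: \<beta>_def)
    show "AE w in ?G. cexp ?G XZv \<gamma> w = \<beta> w"
      using b_le unfolding \<beta>_def G.cexp_eq by eventually_elim simp
    show "AE w in ?G. g (XZv w) = 0" if "g \<in> L2 P XZv" "AE w in ?G. Tadj P g w = 0" for g
      using A8i(2)[OF that(1)] that(2) by blast
  qed (fact model tau d_meas g_sig g0 gK g_odds rep' b)+
  have infl_eq: "AE w in P. infl \<tau> P \<delta>0 h0 w = infl_fn w"
  proof -
    have "AE w in P. Rv w \<longrightarrow> Tadj P h0 w = \<gamma> w"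
      using h_odds g_odds unfolding AE_given_R1[OF p0] by eventually_elim simp
    then show ?thesis using d_eq
    proof eventually_elim
      case (elim w)
      then show ?case
        by (cases "Rv w") (simp_all add: infl_def uncentred_infl_def gap_def)
    qed
  qed
  have infl_meas: "infl \<tau> P \<delta>0 h0 \<in> borel_measurable P"
  proof -
    have "Tadj P h0 \<in> borel_measurable P"
      unfolding Tadj_def using G.cexp_measurable measurable_given_R1 by auto
    moreover have "(\<lambda>w. \<delta>0 (XZv w)) \<in> borel_measurable P" "(\<lambda>w. \<tau> (XYv w)) \<in> borel_measurable P"
      using tau by (auto intro: toP)
    ultimately show ?thesis unfolding infl_def[abs_def] by measurable
  qed
  have fn_meas: "infl_fn \<in> borel_measurable P" by (rule sq_intD(1)[OF infl_fn_sq_int])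
  have mean: "(\<integral>v. infl \<tau> P \<delta>0 h0 v \<partial>P) = 0"
    using integral_cong_AE[OF infl_meas fn_meas infl_eq] infl_fn_mean by simp
  have sq_eq: "AE w in P. (infl \<tau> P \<delta>0 h0 w)\<^sup>2 = (infl_fn w)\<^sup>2" using infl_eq by eventually_elim simp
  have "integrable P (\<lambda>w. (infl \<tau> P \<delta>0 h0 w)\<^sup>2)"
    using integrable_cong_AE[OF _ _ sq_eq] infl_meas fn_meas sq_intD(2)[OF infl_fn_sq_int] by simp
  moreover have "(\<integral>w. (infl \<tau> P \<delta>0 h0 w)\<^sup>2 \<partial>P) = (\<integral>w. (infl_fn w)\<^sup>2 \<partial>P)"
    by (rule integral_cong_AE[OF _ _ sq_eq]) (use infl_meas fn_meas in auto)
  ultimately show ?thesis unfolding mean efficiency_bound_eq by simp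
qed

end
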